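(* Let $N$ be a fixed smooth Riemannian manifold. Let $\Sigma_1 : S_1^- \to S_1^+$ and $\Sigma_2 : S_2^- \to S_2^+$ be composable morphisms in Segal's category of Riemann surfaces. That is, $\Sigma_1,\Sigma_2$ are compact Riemann surfaces with $\partial\Sigma_i = S_i^+ - S_i^-$ and $S_1^+ = S_2^-$, and $\Sigma_2\circ\Sigma_1 : S_1^-\to S_2^+$ denotes the compact Riemann surface obtained by gluing $\Sigma_1$ and $\Sigma_2$ along $S_1^+=S_2^-$. For a morphism $\Sigma:S^-\to S^+$, regard the space of harmonic maps $Harm(\Sigma;N)$, via its Cauchy data along the boundary, as a relation from $C_{S^-}$ to $C_{S^+}$, i.e. as the subset $$\{( *d\phi|_{S^-},\, *d\phi|_{S^+}) : \phi\in Harm(\Sigma;N)\}\subset C_{S^-}^-\times C_{S^+}.$$ Then $$Harm(\Sigma_2;N)\circ Harm(\Sigma_1;N) = Harm(\Sigma_2\circ\Sigma_1;N),$$ as relations from $C_{S_1^-}$ to $C_{S_2^+}$, where $\circ$ on the left is composition of canonical relations.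
   Context: Segal's category: objects are compact oriented 1-manifolds. A morphism $S^-\to S^+$ is a compact Riemann surface $\Sigma$ (with its standard orientation) whose boundary is $\partial\Sigma = S^+ - S^-$, meaning that $S^+$ is the part of the boundary where the intrinsic orientation agrees with the induced boundary orientation and $S^-$ is the part where they are opposite. Composition is gluing of Riemann surfaces along the common boundary. Harmonic maps: a harmonic map $\phi:\Sigma\to N$ is a smooth map (smooth up to the boundary) satisfying $d^\nabla * d\phi = 0$. Here $d\phi$ is viewed as a one-form on $\Sigma$ with values in $\phi^*TN$, $\nabla$ is the pullback to $\phi^*TN$ of the Levi-Civita connection of $N$, $d^\nabla$ is the induced exterior covariant derivative, and $*$ is the Hodge star of any metric on $\Sigma$ in the given conformal class (on 1-forms in dimension two, $*$ depends only on the conformal structure and orientation). Equivalently, $\phi$ is smooth and is a critical point of the Dirichlet energy $\int_\Sigma\langle d\phi\wedge *d\phi\rangle$ under variations vanishing on $\partial\Sigma$. $Harm(\Sigma;N)$ is the set of all harmonic maps $\Sigma\to N$ (no boundary condition imposed). Cauchy data: for a compact oriented 1-manifold $S$, let $\Omega^0(S;N)$ be the smooth maps $S\to N$ and $$C_S=\bigsqcup_{\phi\in\Omega^0(S;N)}\Omega^1(S;\phi^*TN),$$ so an element is a pair consisting of a smooth map $\phi:S\to N$ and a smooth one-form $\alpha$ on $S$ with values in $\phi^*TN$. It is regarded as a subbundle of $T^*\Omega^0(S;N)$ via $\alpha(X)=\int_S\langle X\wedge\alpha\rangle$ for $X\in\Omega^0(S;\phi^*TN)=T_\phi\Omega^0(S;N)$,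 with symplectic form $\omega=d\Theta$, where $\Theta$ is the action one-form $\Theta(v)=\int_S\langle\pi_*v\wedge\alpha\rangle$ for $v$ tangent to $C_S$ at $(\phi,\alpha)$ and $\pi:C_S\to\Omega^0(S;N)$ is the projection. $C_S^-$ denotes $C_S$ with symplectic form $-\omega$. For $\phi:\Sigma\to N$ smooth and $S$ a union of boundary components of $\Sigma$, $*d\phi|_S\in C_S$ denotes the element with base map $\phi|_S$ and one-form the restriction (pullback) of $*d\phi$ to $S$. In particular, equality $*d\phi_1|_{S}=*d\phi_2|_{S}$ in $C_S$ includes $\phi_1|_S=\phi_2|_S$. Composition of relations: for $L_1\subset M_1^-\times M_2$ and $L_2\subset M_2^-\times M_3$, $$L_2\circ L_1=\{(x,z)\in M_1^-\times M_3 : \exists\, y\in M_2,\ (x,y)\in L_1,\ (y,z)\in L_2\}.$$ *)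

theory Defs
  imports "HOL-Analysis.Analysis"
begin

section \<open>Smooth functions on subsets of Euclidean space\<close>

text \<open>\<open>Ck_on\<close> is meant for open sets. On other sets (half-discs, say) smooth means locally
  the restriction of a smooth function on an open set, i.e. smooth up to the boundary.\<close>

primrec Ck_on ::
  "nat \<Rightarrow> 'e::euclidean_space set \<Rightarrow> ('e \<Rightarrow> 'f::euclidean_space) \<Rightarrow> bool" where
  "Ck_on 0 U f \<longleftrightarrow> continuous_on U f"
| "Ck_on (Suc k) U f \<longleftrightarrow>
     f differentiable_on U \<and> (\<forall>v. Ck_on k U (\<lambda>x. frechet_derivative f (at x) v))"

definition smooth_on ::
  "'e::euclidean_space set \<Rightarrow> ('e \<Rightarrow> 'f::euclidean_space) \<Rightarrow> bool" where
  "smooth_on D f \<longleftrightarrow>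
     (\<forall>x\<in>D. \<exists>U h. open U \<and> x \<in> U \<and> (\<forall>k. Ck_on k U h) \<and> (\<forall>y\<in>D \<inter> U. h y = f y))"


section \<open>Manifolds given by atlases\<close>

type_synonym ('a, 'e) chart = "'a set \<times> ('a \<Rightarrow> 'e)"

record ('a, 'e) manifold =
  mtop :: "'a topology"
  atlas :: "('a, 'e) chart set"

abbreviation points :: "('a, 'e) manifold \<Rightarrow> 'a set" where
  "points M \<equiv> topspace (mtop M)"

definition charts_at :: "('a, 'e) manifold \<Rightarrow> 'a \<Rightarrow> ('a, 'e) chart set" where
  "charts_at M p = {c \<in> atlas M. p \<in> fst c}"

definition chart_inv :: "('a, 'e) chart \<Rightarrow> 'e \<Rightarrow> 'a" where
  "chart_inv c = inv_into (fst c) (snd c)"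

definition local_rep ::
  "('a, 'e) chart \<Rightarrow> ('b, 'f) chart \<Rightarrow> ('a \<Rightarrow> 'b) \<Rightarrow> 'e \<Rightarrow> 'f" where
  "local_rep c d F = snd d \<circ> F \<circ> chart_inv c"

definition local_dom ::
  "('a, 'e) chart \<Rightarrow> ('b, 'f) chart \<Rightarrow> ('a \<Rightarrow> 'b) \<Rightarrow> 'e set" where
  "local_dom c d F = snd c ` (fst c \<inter> F -` fst d)"

text \<open>The derivative is taken within the domain of the local representative, so that it is
  the one-sided derivative at boundary points.\<close>

definition local_deriv ::
  "('a, 'e::euclidean_space) chart \<Rightarrow> ('b, 'f::euclidean_space) chart \<Rightarrow> ('a \<Rightarrow> 'b) \<Rightarrow>
   'a \<Rightarrow> 'e \<Rightarrow> 'f" where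
  "local_deriv c d F p =
     frechet_derivative (local_rep c d F) (at (snd c p) within local_dom c d F)"

text \<open>Smooth manifolds modelled on relatively open subsets of \<open>H\<close>: without boundary for
  \<open>H = UNIV\<close>, with boundary for \<open>H\<close> a closed half-space.\<close>

definition smooth_manifold :: "'e::euclidean_space set \<Rightarrow> ('a, 'e) manifold \<Rightarrow> bool" where
  "smooth_manifold H M \<longleftrightarrow>
     Hausdorff_space (mtop M) \<and> second_countable (mtop M) \<and>
     (\<forall>(U, f)\<in>atlas M. openin (mtop M) U \<and> openin (top_of_set H) (f ` U) \<and>
        homeomorphic_map (subtopology (mtop M) U) (top_of_set (f ` U)) f) \<and>
     (\<forall>p\<in>points M. charts_at M p \<noteq> {}) \<and>
     (\<forall>c\<in>atlas M. \<forall>d\<in>atlas M. smooth_on (local_dom c d id) (local_rep c d id))"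

definition smooth_map ::
  "('a, 'e::euclidean_space) manifold \<Rightarrow> ('b, 'f::euclidean_space) manifold \<Rightarrow>
   ('a \<Rightarrow> 'b) \<Rightarrow> bool" where
  "smooth_map M M' F \<longleftrightarrow> continuous_map (mtop M) (mtop M') F \<and>
     (\<forall>c\<in>atlas M. \<forall>d\<in>atlas M'. smooth_on (local_dom c d F) (local_rep c d F))"

definition smooth_embedding ::
  "('a, 'e::euclidean_space) manifold \<Rightarrow> ('b, 'f::euclidean_space) manifold \<Rightarrow>
   ('a \<Rightarrow> 'b) \<Rightarrow> bool" where
  "smooth_embedding M M' F \<longleftrightarrow> smooth_map M M' F \<and> embedding_map (mtop M) (mtop M') F \<and>
     (\<forall>p\<in>points M. \<forall>c\<in>charts_at M p. \<forall>d\<in>charts_at M' (F p). inj (local_deriv c d F p))"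


section \<open>Tangent vectors, differentials, vector-valued one-forms\<close>

text \<open>A tangent vector at \<open>p\<close> is a family of coordinate vectors, one for every chart around \<open>p\<close>,
  related by the derivatives of the coordinate changes.\<close>

type_synonym ('a, 'e) tangent = "('a, 'e) chart \<Rightarrow> 'e"

definition tangent_space ::
  "('a, 'e::euclidean_space) manifold \<Rightarrow> 'a \<Rightarrow> ('a, 'e) tangent set" where
  "tangent_space M p =
     {v. (\<forall>c\<in>charts_at M p. \<forall>d\<in>charts_at M p. v d = local_deriv c d id p (v c)) \<and>
         (\<forall>c. c \<notin> charts_at M p \<longrightarrow> v c = 0)}"

text \<open>The tangent vector at \<open>p\<close> with coordinates \<open>a\<close> in the chart \<open>c\<close>.\<close>

definition coord_vec ::
  "('a, 'e::euclidean_space) manifold \<Rightarrow> ('a, 'e) chart \<Rightarrow> 'a \<Rightarrow> 'e \<Rightarrow> ('a, 'e) tangent" where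
  "coord_vec M c p a = (\<lambda>d. if d \<in> charts_at M p then local_deriv c d id p a else 0)"

text \<open>By the chain rule the choice of the chart \<open>c\<close> is immaterial.\<close>

definition differential ::
  "('a, 'e::euclidean_space) manifold \<Rightarrow> ('b, 'f::euclidean_space) manifold \<Rightarrow>
   ('a \<Rightarrow> 'b) \<Rightarrow> 'a \<Rightarrow> ('a, 'e) tangent \<Rightarrow> ('b, 'f) tangent" where
  "differential M M' F p v =
     (\<lambda>d. if d \<in> charts_at M' (F p)
          then let c = (SOME c. c \<in> charts_at M p) in local_deriv c d F p (v c)
          else 0)"

definition form_coord ::
  "('a, 'e::euclidean_space) manifold \<Rightarrow> ('a, 'e) chart \<Rightarrow> ('b, 'f) chart \<Rightarrow>
   ('a \<Rightarrow> ('a, 'e) tangent \<Rightarrow> ('b, 'f) tangent) \<Rightarrow> 'e \<Rightarrow> 'e \<Rightarrow> 'f" where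
  "form_coord M c d \<alpha> x u = \<alpha> (chart_inv c x) (coord_vec M c (chart_inv c x) u) d"

text \<open>Smooth one-forms on \<open>M\<close> with values in the pullback of the tangent bundle of \<open>N\<close>
  along \<open>\<phi>\<close>.\<close>

definition one_forms ::
  "('a, 'e::euclidean_space) manifold \<Rightarrow> ('q, 'n::euclidean_space) manifold \<Rightarrow> ('a \<Rightarrow> 'q) \<Rightarrow>
   ('a \<Rightarrow> ('a, 'e) tangent \<Rightarrow> ('q, 'n) tangent) set" where
  "one_forms M N \<phi> =
     {\<alpha> \<in> (\<Pi>\<^sub>E p\<in>points M. tangent_space M p \<rightarrow>\<^sub>E tangent_space N (\<phi> p)).
        \<forall>c\<in>atlas M. \<forall>d\<in>atlas N.
          (\<forall>x\<in>local_dom c d \<phi>. linear (form_coord M c d \<alpha> x)) \<and>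
          (\<forall>u. smooth_on (local_dom c d \<phi>) (\<lambda>x. form_coord M c d \<alpha> x u))}"


section \<open>Riemannian metrics and the Levi-Civita connection\<close>

type_synonym ('q, 'n) metric = "'q \<Rightarrow> ('q, 'n) tangent \<Rightarrow> ('q, 'n) tangent \<Rightarrow> real"

definition metric_coord ::
  "('q, 'n::euclidean_space) manifold \<Rightarrow> ('q, 'n) metric \<Rightarrow> ('q, 'n) chart \<Rightarrow>
   'n \<Rightarrow> 'n \<Rightarrow> 'n \<Rightarrow> real" where
  "metric_coord N g d x a b =
     (let q = chart_inv d x in g q (coord_vec N d q a) (coord_vec N d q b))"

definition riemannian_metric ::
  "('q, 'n::euclidean_space) manifold \<Rightarrow> ('q, 'n) metric \<Rightarrow> bool" where
  "riemannian_metric N g \<longleftrightarrow>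
     (\<forall>d\<in>atlas N.
        (\<forall>x\<in>snd d ` fst d.
           bilinear (metric_coord N g d x) \<and>
           (\<forall>a b. metric_coord N g d x a b = metric_coord N g d x b a) \<and>
           (\<forall>a. a \<noteq> 0 \<longrightarrow> metric_coord N g d x a a > 0)) \<and>
        (\<forall>a b. smooth_on (snd d ` fst d) (\<lambda>x. metric_coord N g d x a b)))"

text \<open>The Christoffel symbols in the chart \<open>d\<close> of the torsion-free metric connection:
  \<open>christoffel N g d x u a\<close> is the covariant derivative at \<open>x\<close>, in direction \<open>u\<close>, of the
  vector field with constant coordinates \<open>a\<close>.\<close>

definition christoffel ::
  "('q, 'n::euclidean_space) manifold \<Rightarrow> ('q, 'n) metric \<Rightarrow> ('q, 'n) chart \<Rightarrow>
   'n \<Rightarrow> 'n \<Rightarrow> 'n \<Rightarrow> 'n" where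
  "christoffel N g d x =
     (THE \<Gamma>. bilinear \<Gamma> \<and> (\<forall>u a. \<Gamma> u a = \<Gamma> a u) \<and>
        (\<forall>u a b. frechet_derivative (\<lambda>y. metric_coord N g d y a b) (at x) u =
           metric_coord N g d x (\<Gamma> u a) b + metric_coord N g d x a (\<Gamma> u b)))"

text \<open>The pullback of the Levi-Civita connection along a map with local representative \<open>f\<close> on
  \<open>D\<close>, applied to a section along that map with coordinates \<open>X\<close>.\<close>

definition pullback_conn ::
  "('q, 'n::euclidean_space) manifold \<Rightarrow> ('q, 'n) metric \<Rightarrow> ('q, 'n) chart \<Rightarrow>
   'e::euclidean_space set \<Rightarrow> ('e \<Rightarrow> 'n) \<Rightarrow> ('e \<Rightarrow> 'n) \<Rightarrow> 'e \<Rightarrow> 'e \<Rightarrow> 'n" where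
  "pullback_conn N g d D f X z u =
     frechet_derivative X (at z within D) u +
     christoffel N g d (f z) (frechet_derivative f (at z within D) u) (X z)"

text \<open>The exterior covariant derivative of a one-form with values in the pullback of the tangent
  bundle along \<open>\<phi>\<close>, evaluated on the coordinate fields \<open>u\<close> and \<open>v\<close>. These have constant
  coordinates, so the term with their Lie bracket vanishes.\<close>

definition ext_cov_deriv ::
  "('a, 'e::euclidean_space) manifold \<Rightarrow> ('q, 'n::euclidean_space) manifold \<Rightarrow>
   ('q, 'n) metric \<Rightarrow> ('a \<Rightarrow> 'q) \<Rightarrow> ('a \<Rightarrow> ('a, 'e) tangent \<Rightarrow> ('q, 'n) tangent) \<Rightarrow>
   ('a, 'e) chart \<Rightarrow> ('q, 'n) chart \<Rightarrow> 'e \<Rightarrow> 'e \<Rightarrow> 'e \<Rightarrow> 'n" where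
  "ext_cov_deriv M N g \<phi> \<alpha> c d z u v =
     pullback_conn N g d (local_dom c d \<phi>) (local_rep c d \<phi>)
       (\<lambda>w. form_coord M c d \<alpha> w v) z u -
     pullback_conn N g d (local_dom c d \<phi>) (local_rep c d \<phi>)
       (\<lambda>w. form_coord M c d \<alpha> w u) z v"


section \<open>Riemann surfaces with boundary and Segal's category\<close>

definition half_plane :: "complex set" where
  "half_plane = {z. 0 \<le> Im z}"

text \<open>Open subsets of the complex plane need no separate kind of chart: locally they can be
  translated into the open upper half-plane.\<close>

definition riemann_surface :: "('a, complex) manifold \<Rightarrow> bool" where
  "riemann_surface \<Sigma> \<longleftrightarrow> smooth_manifold half_plane \<Sigma> \<and>
     (\<forall>c\<in>atlas \<Sigma>. \<forall>d\<in>atlas \<Sigma>. local_rep c d id holomorphic_on interior (local_dom c d id))"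

definition surface_boundary :: "('a, complex) manifold \<Rightarrow> 'a set" where
  "surface_boundary \<Sigma> = {p \<in> points \<Sigma>. \<exists>c\<in>charts_at \<Sigma> p. Im (snd c p) = 0}"

definition holomorphic_embedding ::
  "('a, complex) manifold \<Rightarrow> ('b, complex) manifold \<Rightarrow> ('a \<Rightarrow> 'b) \<Rightarrow> bool" where
  "holomorphic_embedding \<Sigma> \<Sigma>' F \<longleftrightarrow> smooth_embedding \<Sigma> \<Sigma>' F \<and>
     (\<forall>c\<in>atlas \<Sigma>. \<forall>d\<in>atlas \<Sigma>'. local_rep c d F holomorphic_on interior (local_dom c d F))"

text \<open>The orientation of a one-manifold is carried by its atlas: all charts are positive.\<close>

definition oriented_1_manifold :: "('s, real) manifold \<Rightarrow> bool" where
  "oriented_1_manifold S \<longleftrightarrow> smooth_manifold UNIV S \<and>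
     (\<forall>p\<in>points S. \<forall>c\<in>charts_at S p. \<forall>d\<in>charts_at S p. local_deriv c d id p 1 > 0)"

text \<open>A surface together with identifications of its boundary with the incoming and the outgoing
  one-manifold. If these are subsets of the surface, both maps are inclusions.\<close>

record ('s, 'a, 't) cobordism =
  surface :: "('a, complex) manifold"
  source :: "('s, real) manifold"
  target :: "('t, real) manifold"
  in_map :: "'s \<Rightarrow> 'a"
  out_map :: "'t \<Rightarrow> 'a"

text \<open>In a chart to the upper half-plane the induced orientation of the boundary (outward normal
  first) is the positive direction of the real axis. Outgoing boundary maps preserve the
  orientation, incoming ones reverse it.\<close>

definition segal_morphism :: "('s, 'a, 't) cobordism \<Rightarrow> bool" where
  "segal_morphism W \<longleftrightarrow>
     riemann_surface (surface W) \<and> compact_space (mtop (surface W)) \<and>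
     oriented_1_manifold (source W) \<and> compact_space (mtop (source W)) \<and>
     oriented_1_manifold (target W) \<and> compact_space (mtop (target W)) \<and>
     smooth_embedding (source W) (surface W) (in_map W) \<and>
     smooth_embedding (target W) (surface W) (out_map W) \<and>
     in_map W ` points (source W) \<inter> out_map W ` points (target W) = {} \<and>
     in_map W ` points (source W) \<union> out_map W ` points (target W)
       = surface_boundary (surface W) \<and>
     (\<forall>s\<in>points (source W). \<forall>c\<in>charts_at (source W) s.
        \<forall>d\<in>charts_at (surface W) (in_map W s). Re (local_deriv c d (in_map W) s 1) < 0) \<and>
     (\<forall>s\<in>points (target W). \<forall>c\<in>charts_at (target W) s.
        \<forall>d\<in>charts_at (surface W) (out_map W s). Re (local_deriv c d (out_map W) s 1) > 0)"

text \<open>\<open>W\<close> is the morphism obtained by gluing \<open>W1\<close> and \<open>W2\<close> along the target of \<open>W1\<close>. The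
  conformal structure on the glued surface is the one for which the two pieces are embedded
  holomorphically and smoothly up to the boundary. It is determined up to isomorphism, but the
  seam need not be an analytic curve.\<close>

definition segal_composite ::
  "('t, 'b, 'r) cobordism \<Rightarrow> ('s, 'a, 't) cobordism \<Rightarrow> ('s, 'c, 'r) cobordism \<Rightarrow> bool" where
  "segal_composite W2 W1 W \<longleftrightarrow>
     segal_morphism W \<and> source W = source W1 \<and> target W = target W2 \<and>
     (\<exists>j1 j2.
        holomorphic_embedding (surface W1) (surface W) j1 \<and>
        holomorphic_embedding (surface W2) (surface W) j2 \<and>
        j1 ` points (surface W1) \<union> j2 ` points (surface W2) = points (surface W) \<and>
        (\<forall>x\<in>points (surface W1). \<forall>y\<in>points (surface W2).
           j1 x = j2 y \<longleftrightarrow> (\<exists>s\<in>points (target W1). x = out_map W1 s \<and> y = in_map W2 s)) \<and>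
        (\<forall>s\<in>points (source W). in_map W s = j1 (in_map W1 s)) \<and>
        (\<forall>s\<in>points (target W). out_map W s = j2 (out_map W2 s)))"


section \<open>Harmonic maps and their Cauchy data\<close>

text \<open>On a Riemann surface every metric in the conformal class has the same Hodge star on
  one-forms, determined by \<open>*dx = dy\<close> and \<open>*dy = -dx\<close> in a complex coordinate \<open>x + iy\<close>;
  that is, \<open>*\<alpha>\<close> sends \<open>v\<close> to \<open>\<alpha> (- i v)\<close>.\<close>

definition hodge_star ::
  "('a \<Rightarrow> ('a, complex) tangent \<Rightarrow> 'v) \<Rightarrow> 'a \<Rightarrow> ('a, complex) tangent \<Rightarrow> 'v" where
  "hodge_star \<alpha> p v = \<alpha> p (\<lambda>c. - \<i> * v c)"

definition harmonic_maps ::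
  "('a, complex) manifold \<Rightarrow> ('q, 'n::euclidean_space) manifold \<Rightarrow> ('q, 'n) metric \<Rightarrow>
   ('a \<Rightarrow> 'q) set" where
  "harmonic_maps \<Sigma> N g =
     {\<phi> \<in> extensional (points \<Sigma>). smooth_map \<Sigma> N \<phi> \<and>
        (\<forall>c\<in>atlas \<Sigma>. \<forall>d\<in>atlas N. \<forall>z\<in>local_dom c d \<phi>. \<forall>u v.
           ext_cov_deriv \<Sigma> N g \<phi> (hodge_star (differential \<Sigma> N \<phi>)) c d z u v = 0)}"

type_synonym ('s, 'q, 'n) cauchy =
  "('s \<Rightarrow> 'q) \<times> ('s \<Rightarrow> ('s, real) tangent \<Rightarrow> ('q, 'n) tangent)"

definition cauchy_space ::
  "('s, real) manifold \<Rightarrow> ('q, 'n::euclidean_space) manifold \<Rightarrow> ('s, 'q, 'n) cauchy set" where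
  "cauchy_space S N =
     (SIGMA \<phi> : {\<phi> \<in> extensional (points S). smooth_map S N \<phi>}. one_forms S N \<phi>)"

definition cauchy_data ::
  "('s, real) manifold \<Rightarrow> ('a, complex) manifold \<Rightarrow> ('q, 'n::euclidean_space) manifold \<Rightarrow>
   ('s \<Rightarrow> 'a) \<Rightarrow> ('a \<Rightarrow> 'q) \<Rightarrow> ('s, 'q, 'n) cauchy" where
  "cauchy_data S \<Sigma> N i \<phi> =
     (\<lambda>s\<in>points S. \<phi> (i s),
      \<lambda>s\<in>points S. \<lambda>v\<in>tangent_space S s.
        hodge_star (differential \<Sigma> N \<phi>) (i s) (differential S \<Sigma> i s v))"

definition harm_relation ::
  "('q, 'n::euclidean_space) manifold \<Rightarrow> ('q, 'n) metric \<Rightarrow> ('s, 'a, 't) cobordism \<Rightarrow>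
   (('s, 'q, 'n) cauchy \<times> ('t, 'q, 'n) cauchy) set" where
  "harm_relation N g W =
     {(cauchy_data (source W) (surface W) N (in_map W) \<phi>,
       cauchy_data (target W) (surface W) N (out_map W) \<phi>) |
      \<phi>. \<phi> \<in> harmonic_maps (surface W) N g}"

text \<open>The sign of the symplectic form on the first factor does not affect the underlying sets.\<close>

definition compose_relations ::
  "'x set \<Rightarrow> 'y set \<Rightarrow> 'z set \<Rightarrow> ('y \<times> 'z) set \<Rightarrow> ('x \<times> 'y) set \<Rightarrow> ('x \<times> 'z) set" where
  "compose_relations M1 M2 M3 L2 L1 =
     {(x, z) \<in> M1 \<times> M3. \<exists>y\<in>M2. (x, y) \<in> L1 \<and> (y, z) \<in> L2}"

end

theory Submission
  imports Defs
begin

text \<open>Restricting a harmonic map on the glued surface to the two pieces gives one inclusion, because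
  harmonicity and Cauchy data are invariant under holomorphic embeddings. Conversely, two harmonic maps
  with the same Cauchy data along the seam glue to a continuous map that is smooth on both closed sides.
  No elliptic regularity is needed to see that it is smooth across the seam: the seam is
  noncharacteristic for the second-order harmonic map equation, so all higher normal derivatives are
  determined by the Cauchy data, the jets of the two maps agree along the seam to all orders, and the
  glued map is smooth. The equation is used with its free index lowered by the metric, so that
  smoothness of the inverse metric and of the Christoffel symbols never enters; the lowered equation
  also passes by continuity from interior points to boundary points.\<close>

section \<open>Differential calculus on open sets\<close>

text \<open>The seam is only a smooth curve: a holomorphic coordinate need not straighten it, and a
  merely smooth one would destroy the flat Laplacian. Of the curve only a nonzero tangent direction
  \<tau> at each point enters, through the fact that a function vanishing on the seam has derivative
  zero along \<tau>. Around a seam point each map is represented by a smooth function,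
  \<open>F1\<close> or \<open>F2\<close>, defined on both sides and solving the equation on its own
  side. The Cauchy data give the derivative along \<open>- \<i> * \<tau>\<close>, hence all first
  derivatives of \<open>D = F1 - F2\<close> vanish on the seam. If the Laplacian of \<open>D\<close>
  vanishes there too, the second derivatives \<open>p = D_xx\<close> and \<open>q = D_xy\<close>
  satisfy a linear system of determinant |\<tau>|^2, so they vanish. Higher orders follow because
  partial derivatives commute with the Laplacian. The Laplacian of \<open>D\<close> is flat to order
  k once \<open>D\<close> is flat to order k + 1, since the equation is semilinear: its other terms
  contain only \<open>F\<close> and first derivatives of \<open>F\<close>, and the metric in front
  of the Laplacian is invertible.\<close>

abbreviation fderiv ::
  "('e::real_normed_vector \<Rightarrow> 'f::real_normed_vector) \<Rightarrow> 'e \<Rightarrow> 'e \<Rightarrow> 'f" where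
  "fderiv f x \<equiv> frechet_derivative f (at x)"

text \<open>The direction comes first, so that \<open>dd v\<close> is an operator on functions and
  iterates as in the recursion of \<open>Ck_on\<close>.\<close>

abbreviation dd :: "'e::euclidean_space \<Rightarrow> ('e \<Rightarrow> 'f::euclidean_space) \<Rightarrow> 'e \<Rightarrow> 'f" where
  "dd v f \<equiv> (\<lambda>x. fderiv f x v)"

definition Cinf_on :: "'e::euclidean_space set \<Rightarrow> ('e \<Rightarrow> 'f::euclidean_space) \<Rightarrow> bool" where
  "Cinf_on U f \<longleftrightarrow> (\<forall>k. Ck_on k U f)"

lemma dd_eqI: "(f has_derivative f') (at x) \<Longrightarrow> fderiv f x v = f' v"
  by (metis frechet_derivative_at)

lemma dd_cong:
  assumes "open U" "\<And>x. x \<in> U \<Longrightarrow> f x = g x" "x \<in> U"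
  shows "fderiv f x = fderiv g x"
proof -
  have "(f has_derivative f') (at x) \<longleftrightarrow> (g has_derivative f') (at x)" for f'
    using assms by (metis has_derivative_transform_within_open)
  then show ?thesis unfolding frechet_derivative_def by presburger
qed

text \<open>Formulas such as the product rule compute \<open>dd v\<close> only at points of
  \<open>U\<close>. The closure properties below therefore prove \<open>Ck_on\<close> for the
  right-hand side of the formula and transfer it by this rule.\<close>

lemma Ck_on_cong_imp:
  assumes "open U" "\<And>x. x \<in> U \<Longrightarrow> f x = g x" "Ck_on k U f"
  shows "Ck_on k U g"
  using assms(2,3)
proof (induction k arbitrary: f g)
  case 0
  then show ?case by (simp cong: continuous_on_cong)
next
  case (Suc k)
  have "g differentiable_on U"
    unfolding differentiable_on_eq_differentiable_at[OF assms(1)]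
  proof
    fix x assume x: "x \<in> U"
    then obtain f' where "(f has_derivative f') (at x)"
      using Suc.prems by (auto simp: differentiable_on_eq_differentiable_at assms(1) differentiable_def)
    from has_derivative_transform_within_open[OF this assms(1) x Suc.prems(1)]
    show "g differentiable (at x)" by (auto simp: differentiable_def)
  qed
  moreover have "Ck_on k U (dd v g)" for v
    by (rule Suc.IH[of "dd v f"]) (use Suc.prems dd_cong[OF assms(1), of f g] in auto)
  ultimately show ?case by simp
qed

lemma Ck_on_subset:
  "Ck_on k U f \<Longrightarrow> V \<subseteq> U \<Longrightarrow> Ck_on k V f"
  by (induction k arbitrary: f) (auto intro: continuous_on_subset differentiable_on_subset)

lemma Ck_on_SucD: "Ck_on (Suc k) U f \<Longrightarrow> Ck_on k U f"
proof (induction k arbitrary: f)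
  case 0 then show ?case by (simp add: differentiable_imp_continuous_on)
next
  case (Suc k)
  then have "Ck_on k U (dd v f)" for v by simp
  with Suc.prems show ?case by simp
qed

lemma Ck_on_imp_continuous_on: "Ck_on k U f \<Longrightarrow> continuous_on U f"
  by (cases k) (auto simp: differentiable_imp_continuous_on)

lemma Ck_on_Suc_differentiable:
  "Ck_on (Suc k) U f \<Longrightarrow> open U \<Longrightarrow> x \<in> U \<Longrightarrow> f differentiable (at x)"
  by (simp add: differentiable_on_eq_differentiable_at)

lemma Ck_on_local:
  assumes "\<And>x. x \<in> U \<Longrightarrow> \<exists>V. open V \<and> x \<in> V \<and> Ck_on k V f" and "open U"
  shows "Ck_on k U f"
  using assms(1)
proof (induction k arbitrary: f)
  case 0
  then show ?case
    by (auto simp: continuous_on_eq_continuous_at[OF assms(2)])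
      (metis continuous_on_eq_continuous_at)
next
  case (Suc k)
  have "f differentiable_on U"
    unfolding differentiable_on_eq_differentiable_at[OF assms(2)]
    using Suc.prems by (metis Ck_on_Suc_differentiable)
  moreover have "Ck_on k U (dd v f)" for v
    by (rule Suc.IH) (use Suc.prems in fastforce)
  ultimately show ?case by simp
qed

section \<open>Closure properties of \<open>Ck_on\<close> and \<open>Cinf_on\<close>\<close>

lemma Ck_on_const: "Ck_on k U (\<lambda>x. c)"
  by (induction k arbitrary: c) auto

lemma has_derivative_dd: "f differentiable (at x) \<Longrightarrow> (f has_derivative fderiv f x) (at x)"
  using frechet_derivative_works by blast

lemma dd_add:
  "f differentiable (at x) \<Longrightarrow> g differentiable (at x) \<Longrightarrow>
   fderiv (\<lambda>x. f x + g x) x v =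
   fderiv f x v + fderiv g x v"
  by (rule dd_eqI) (intro has_derivative_add has_derivative_dd)

lemma dd_diff:
  "f differentiable (at x) \<Longrightarrow> g differentiable (at x) \<Longrightarrow>
   fderiv (\<lambda>x. f x - g x) x v =
   fderiv f x v - fderiv g x v"
  by (rule dd_eqI) (intro has_derivative_diff has_derivative_dd)

lemma dd_sum:
  "(\<And>i. i \<in> I \<Longrightarrow> f i differentiable (at x)) \<Longrightarrow>
   fderiv (\<lambda>x. \<Sum>i\<in>I. f i x) x v = (\<Sum>i\<in>I. fderiv (f i) x v)"
  by (rule dd_eqI) (intro has_derivative_sum has_derivative_dd)

lemma (in bounded_linear) dd_compose:
  "g differentiable (at x) \<Longrightarrow>
   fderiv (\<lambda>x. f (g x)) x v = f (fderiv g x v)"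
  by (rule dd_eqI) (intro has_derivative has_derivative_dd)

lemma (in bounded_bilinear) dd_prod:
  "f differentiable (at x) \<Longrightarrow> g differentiable (at x) \<Longrightarrow>
   fderiv (\<lambda>x. prod (f x) (g x)) x v =
   prod (f x) (fderiv g x v) + prod (fderiv f x v) (g x)"
  by (rule dd_eqI) (intro FDERIV has_derivative_dd)

lemma Ck_on_add:
  assumes "open U" "Ck_on k U f" "Ck_on k U g"
  shows "Ck_on k U (\<lambda>x. f x + g x)"
  using assms(2,3)
proof (induction k arbitrary: f g)
  case 0 then show ?case by (simp add: continuous_on_add)
next
  case (Suc k)
  have "Ck_on k U (dd v (\<lambda>x. f x + g x))" for v
    by (rule Ck_on_cong_imp[OF assms(1) _ Suc.IH[of "dd v f" "dd v g"]])
      (use Suc.prems in \<open>auto simp: dd_add differentiable_on_eq_differentiable_at assms(1)\<close>)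
  moreover have "(\<lambda>x. f x + g x) differentiable_on U"
    using Suc.prems by (simp add: differentiable_on_eq_differentiable_at assms(1))
  ultimately show ?case by simp
qed

lemma Ck_on_sum:
  assumes "open U" "\<And>i. i \<in> I \<Longrightarrow> Ck_on k U (f i)"
  shows "Ck_on k U (\<lambda>x. \<Sum>i\<in>I. f i x)"
  using assms(2)
  by (induction I rule: infinite_finite_induct) (auto intro: Ck_on_const Ck_on_add[OF assms(1)])

lemma Ck_on_bounded_linear:
  assumes "open U" "bounded_linear L" "Ck_on k U f"
  shows "Ck_on k U (\<lambda>x. L (f x))"
  using assms(3)
proof (induction k arbitrary: f)
  case 0 then show ?case
    using linear_continuous_on_compose[OF _ bounded_linear.linear[OF assms(2)]] by (simp add: o_def)
next
  case (Suc k)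
  interpret bounded_linear L by fact
  have d: "f differentiable (at x)" if "x \<in> U" for x
    using Suc.prems that by (simp add: differentiable_on_eq_differentiable_at assms(1))
  have "Ck_on k U (dd v (\<lambda>x. L (f x)))" for v
    by (rule Ck_on_cong_imp[OF assms(1) _ Suc.IH[of "dd v f"]])
      (use Suc.prems d in \<open>auto simp: dd_compose\<close>)
  moreover have "(\<lambda>x. L (f x)) differentiable_on U"
    unfolding differentiable_on_eq_differentiable_at[OF assms(1)]
    using has_derivative[OF has_derivative_dd[OF d]] differentiableI by blast
  ultimately show ?case by simp
qed

lemma Ck_on_bounded_bilinear:
  assumes "open U" "bounded_bilinear B" "Ck_on k U f" "Ck_on k U g"
  shows "Ck_on k U (\<lambda>x. B (f x) (g x))"
  using assms(3,4)
proof (induction k arbitrary: f g)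
  case 0 then show ?case
    using bounded_bilinear.continuous_on[OF assms(2)] by simp
next
  case (Suc k)
  interpret bounded_bilinear B by fact
  have d: "f differentiable (at x)" "g differentiable (at x)" if "x \<in> U" for x
    using Suc.prems that by (simp_all add: differentiable_on_eq_differentiable_at assms(1))
  have "Ck_on k U (dd v (\<lambda>x. B (f x) (g x)))" for v
    by (rule Ck_on_cong_imp[OF assms(1) _ Ck_on_add[OF assms(1)
          Suc.IH[of f "dd v g"] Suc.IH[of "dd v f" g]]])
      (use Suc.prems Ck_on_SucD[OF Suc.prems(1)] Ck_on_SucD[OF Suc.prems(2)] d in \<open>auto simp: dd_prod\<close>)
  moreover have "(\<lambda>x. B (f x) (g x)) differentiable_on U"
    unfolding differentiable_on_eq_differentiable_at[OF assms(1)]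
    using FDERIV[OF has_derivative_dd[OF d(1)] has_derivative_dd[OF d(2)]] differentiableI by blast
  ultimately show ?case by simp
qed

lemma linear_eq_sum_Basis:
  fixes L :: "'e::euclidean_space \<Rightarrow> 'f::real_vector"
  assumes "linear L"
  shows "L w = (\<Sum>b\<in>Basis. (w \<bullet> b) *\<^sub>R L b)"
proof -
  have "L w = L (\<Sum>b\<in>Basis. (w \<bullet> b) *\<^sub>R b)"
    by (simp add: euclidean_representation)
  also have "\<dots> = (\<Sum>b\<in>Basis. (w \<bullet> b) *\<^sub>R L b)"
    using assms by (simp add: linear_sum linear_scale)
  finally show ?thesis .
qed

lemma dd_compose:
  assumes "h differentiable (at (u x))" "u differentiable (at x)"
  shows "fderiv (\<lambda>x. h (u x)) x v =
    fderiv h (u x) (fderiv u x v)"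
  using frechet_derivative_compose[of u x h] assms by (simp add: o_def)

text \<open>The direction \<open>fderiv u x v\<close> varies with \<open>x\<close>. Expanding it in
  the basis leaves derivatives of \<open>h\<close> in fixed directions, to which an induction
  hypothesis about \<open>dd b h\<close> applies.\<close>

lemma dd_compose_sum:
  assumes "h differentiable (at (u x))" "u differentiable (at x)"
  shows "fderiv (\<lambda>x. h (u x)) x v =
    (\<Sum>b\<in>Basis. (fderiv u x v \<bullet> b) *\<^sub>R fderiv h (u x) b)"
  using linear_eq_sum_Basis[OF linear_frechet_derivative[OF assms(1)]] dd_compose[OF assms] by metis

lemma Cinf_on_dd: "Cinf_on U f \<Longrightarrow> Cinf_on U (dd v f)"
  unfolding Cinf_on_def by (metis Ck_on.simps(2))

lemma Cinf_on_differentiable: "Cinf_on U f \<Longrightarrow> open U \<Longrightarrow> x \<in> U \<Longrightarrow> f differentiable (at x)"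
  unfolding Cinf_on_def by (metis Ck_on_Suc_differentiable)

lemma Cinf_on_continuous: "Cinf_on U f \<Longrightarrow> continuous_on U f"
  unfolding Cinf_on_def by (metis Ck_on_imp_continuous_on)

text \<open>The outer function is smooth of all orders, a hypothesis that survives when the
  induction replaces \<open>h\<close> by \<open>dd b h\<close>.\<close>

lemma Ck_on_compose:
  assumes "open U" "open W" "Cinf_on W h" "Ck_on k U u" "u ` U \<subseteq> W"
  shows "Ck_on k U (\<lambda>x. h (u x))"
  using assms(3,4,5)
proof (induction k arbitrary: h)
  case 0 then show ?case
    by (auto intro: continuous_on_compose2 Cinf_on_continuous)
next
  case (Suc k)
  have du: "u differentiable (at x)" if "x \<in> U" for x
    using Suc.prems that by (simp add: differentiable_on_eq_differentiable_at assms(1))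
  have dh: "h differentiable (at (u x))" if "x \<in> U" for x
    using Cinf_on_differentiable Suc.prems that assms by blast
  have "Ck_on k U (dd v (\<lambda>x. h (u x)))" for v
  proof (rule Ck_on_cong_imp[OF assms(1)])
    show "Ck_on k U (\<lambda>x. \<Sum>b\<in>Basis. (fderiv u x v \<bullet> b) *\<^sub>R fderiv h (u x) b)"
    proof (intro Ck_on_sum[OF assms(1)] Ck_on_bounded_bilinear[OF assms(1) bounded_bilinear_scaleR])
      show "Ck_on k U (\<lambda>x. fderiv u x v \<bullet> b)" for b
        using Suc.prems by (intro Ck_on_bounded_linear[OF assms(1) bounded_linear_inner_left]) simp
      show "Ck_on k U (\<lambda>x. fderiv h (u x) b)" for b
        by (rule Suc.IH[OF Cinf_on_dd]) (use Suc.prems Ck_on_SucD[OF Suc.prems(2)] in auto)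
    qed
  qed (simp add: du dh dd_compose_sum)
  moreover have "(\<lambda>x. h (u x)) differentiable_on U"
    unfolding differentiable_on_eq_differentiable_at[OF assms(1)]
    using differentiable_compose[OF dh du] by blast
  ultimately show ?case by simp
qed

lemma Cinf_on_compose:
  "open U \<Longrightarrow> open W \<Longrightarrow> Cinf_on W h \<Longrightarrow> Cinf_on U u \<Longrightarrow> u ` U \<subseteq> W \<Longrightarrow> Cinf_on U (\<lambda>x. h (u x))"
  unfolding Cinf_on_def using Ck_on_compose[of U W h _ u] by (simp add: Cinf_on_def)

lemma Cinf_on_cong_imp:
  "open U \<Longrightarrow> (\<And>x. x \<in> U \<Longrightarrow> f x = g x) \<Longrightarrow> Cinf_on U f \<Longrightarrow> Cinf_on U g"
  unfolding Cinf_on_def by (metis Ck_on_cong_imp)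

lemma Cinf_on_subset: "Cinf_on U f \<Longrightarrow> V \<subseteq> U \<Longrightarrow> Cinf_on V f"
  unfolding Cinf_on_def by (metis Ck_on_subset)

lemma Cinf_on_const: "Cinf_on U (\<lambda>x. c)"
  by (simp add: Cinf_on_def Ck_on_const)

lemma Cinf_on_add: "open U \<Longrightarrow> Cinf_on U f \<Longrightarrow> Cinf_on U g \<Longrightarrow> Cinf_on U (\<lambda>x. f x + g x)"
  by (simp add: Cinf_on_def Ck_on_add)

lemma Cinf_on_sum:
  "open U \<Longrightarrow> (\<And>i. i \<in> I \<Longrightarrow> Cinf_on U (f i)) \<Longrightarrow> Cinf_on U (\<lambda>x. \<Sum>i\<in>I. f i x)"
  by (simp add: Cinf_on_def Ck_on_sum)

lemma Cinf_on_bounded_linear: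
  "open U \<Longrightarrow> bounded_linear L \<Longrightarrow> Cinf_on U f \<Longrightarrow> Cinf_on U (\<lambda>x. L (f x))"
  by (simp add: Cinf_on_def Ck_on_bounded_linear)

lemma Cinf_on_bounded_bilinear:
  "open U \<Longrightarrow> bounded_bilinear B \<Longrightarrow> Cinf_on U f \<Longrightarrow> Cinf_on U g \<Longrightarrow> Cinf_on U (\<lambda>x. B (f x) (g x))"
  by (simp add: Cinf_on_def Ck_on_bounded_bilinear)

lemma Cinf_on_minus: "open U \<Longrightarrow> Cinf_on U f \<Longrightarrow> Cinf_on U (\<lambda>x. - f x)"
  by (rule Cinf_on_bounded_linear[OF _ bounded_linear_minus[OF bounded_linear_ident]])

lemma Cinf_on_diff: "open U \<Longrightarrow> Cinf_on U f \<Longrightarrow> Cinf_on U g \<Longrightarrow> Cinf_on U (\<lambda>x. f x - g x)"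
  using Cinf_on_add[of U f "\<lambda>x. - g x"] Cinf_on_minus[of U g] by simp

lemmas Cinf_on_mult = Cinf_on_bounded_bilinear[OF _ bounded_bilinear_mult]
lemmas Cinf_on_scaleR = Cinf_on_bounded_bilinear[OF _ bounded_bilinear_scaleR]
lemmas Cinf_on_inner_left = Cinf_on_bounded_linear[OF _ bounded_linear_inner_left]

lemma Cinf_on_ident: "open U \<Longrightarrow> Cinf_on U (\<lambda>x. x)"
proof -
  assume "open U"
  have "Ck_on k U (\<lambda>x. x)" for k
  proof (cases k)
    case (Suc m) then show ?thesis
      by (auto simp: Ck_on_const)
  qed simp
  then show ?thesis by (simp add: Cinf_on_def)
qed

text \<open>The derivative at \<open>x\<close> along \<open>v\<close> is a product of two inverses
  and the constant \<open>- v\<close>, so the induction closes by the product rule.\<close>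

lemma Ck_on_inverse: "Ck_on k (- {0::real}) inverse"
proof (induction k)
  case 0 then show ?case by (auto intro: continuous_intros)
next
  case (Suc k)
  have d: "(inverse has_derivative (\<lambda>h. - (inverse x * h * inverse x))) (at x)" if "x \<noteq> 0" for x :: real
    using has_derivative_inverse'[of x UNIV] that by simp
  have "Ck_on k (-{0}) (\<lambda>x::real. (inverse x * inverse x) * (- v))" for v
    by (intro Ck_on_bounded_bilinear[OF _ bounded_bilinear_mult] Suc.IH Ck_on_const) auto
  then have "Ck_on k (-{0}) (dd v inverse)" for v :: real
    by (rule Ck_on_cong_imp[rotated 2]) (auto simp: dd_eqI[OF d])
  moreover have "inverse differentiable_on (- {0::real})"
    using d by (auto simp: differentiable_on_eq_differentiable_at open_Compl differentiable_def)
  ultimately show ?case by simp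
qed

lemma Ck_on_divide:
  fixes f g :: "'e::euclidean_space \<Rightarrow> real"
  assumes "open U" "Ck_on k U f" "Ck_on k U g" "\<And>x. x \<in> U \<Longrightarrow> g x \<noteq> 0"
  shows "Ck_on k U (\<lambda>x. f x / g x)"
proof -
  have "Ck_on k U (\<lambda>x. inverse (g x))"
    by (rule Ck_on_compose[OF assms(1) _ _ assms(3), of "-{0}"])
      (use assms(4) in \<open>auto simp: Cinf_on_def Ck_on_inverse open_Compl\<close>)
  from Ck_on_bounded_bilinear[OF assms(1) bounded_bilinear_mult assms(2) this]
  show ?thesis by (simp add: divide_inverse)
qed

text \<open>The second difference over the parallelogram is the increment along \<open>u\<close> of
  the first difference along \<open>v\<close>. One mean value theorem in \<open>s\<close> and one in
  \<open>t\<close> turn it into a mixed derivative at an inner point.\<close>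

lemma second_difference_mvt:
  fixes f :: "'e::euclidean_space \<Rightarrow> real"
  assumes "open U" "Cinf_on U f" "0 < h"
    and U: "\<And>s t. \<lbrakk>0 \<le> s; s \<le> h; 0 \<le> t; t \<le> h\<rbrakk> \<Longrightarrow> x + s *\<^sub>R u + t *\<^sub>R v \<in> U"
  obtains s t where "0 < s" "s < h" "0 < t" "t < h"
    "f (x + h *\<^sub>R u + h *\<^sub>R v) - f (x + h *\<^sub>R u) - f (x + h *\<^sub>R v) + f x =
     h * h * dd v (dd u f) (x + s *\<^sub>R u + t *\<^sub>R v)"
proof -
  have D: "((\<lambda>s. g (a + s *\<^sub>R w)) has_real_derivative dd w g (a + s *\<^sub>R w)) (at s)"
    if "Cinf_on U g" "a + s *\<^sub>R w \<in> U" for g :: "'e \<Rightarrow> real" and a w s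
  proof -
    have g: "(g has_derivative fderiv g (a + s *\<^sub>R w)) (at (a + s *\<^sub>R w))"
      using Cinf_on_differentiable has_derivative_dd that assms(1) by blast
    have "((\<lambda>s. a + s *\<^sub>R w) has_derivative (\<lambda>s. s *\<^sub>R w)) (at s)"
      by (auto intro!: derivative_eq_intros)
    from has_derivative_compose[OF this g]
    have "((\<lambda>s. g (a + s *\<^sub>R w)) has_derivative (\<lambda>t. fderiv g (a + s *\<^sub>R w) (t *\<^sub>R w))) (at s)" .
    moreover have "fderiv g (a + s *\<^sub>R w) (t *\<^sub>R w) = t * dd w g (a + s *\<^sub>R w)" for t
      using g has_derivative_linear linear_scale by fastforce
    ultimately show ?thesis
      by (simp add: has_field_derivative_def mult_commute_abs)
  qed
  have "((\<lambda>s. f ((x + h *\<^sub>R v) + s *\<^sub>R u) - f (x + s *\<^sub>R u)) has_real_derivative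
      dd u f ((x + h *\<^sub>R v) + s *\<^sub>R u) - dd u f (x + s *\<^sub>R u)) (at s)" if "0 \<le> s" "s \<le> h" for s
    using U[of s h] U[of s 0] that assms(3)
    by (intro derivative_intros D assms(2)) (auto simp: add_ac)
  from MVT2[OF assms(3) this] obtain s where s: "0 < s" "s < h" and
    1: "f ((x + h *\<^sub>R v) + h *\<^sub>R u) - f (x + h *\<^sub>R u) - (f ((x + h *\<^sub>R v) + 0 *\<^sub>R u) - f (x + 0 *\<^sub>R u)) =
     (h - 0) * (dd u f ((x + h *\<^sub>R v) + s *\<^sub>R u) - dd u f (x + s *\<^sub>R u))"
    by blast
  have "((\<lambda>t. dd u f ((x + s *\<^sub>R u) + t *\<^sub>R v)) has_real_derivative
     dd v (dd u f) ((x + s *\<^sub>R u) + t *\<^sub>R v)) (at t)" if "0 \<le> t" "t \<le> h" for t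
    using U[of s t] that s by (intro D Cinf_on_dd assms(2)) auto
  from MVT2[OF assms(3) this] obtain t where t: "0 < t" "t < h" and
    2: "dd u f ((x + s *\<^sub>R u) + h *\<^sub>R v) - dd u f ((x + s *\<^sub>R u) + 0 *\<^sub>R v) =
     (h - 0) * dd v (dd u f) ((x + s *\<^sub>R u) + t *\<^sub>R v)" by blast
  show thesis
  proof (rule that[OF s t])
    have e: "x + h *\<^sub>R v + h *\<^sub>R u = x + h *\<^sub>R u + h *\<^sub>R v" "x + h *\<^sub>R v + s *\<^sub>R u = x + s *\<^sub>R u + h *\<^sub>R v"
      by (simp_all only: add_ac)
    show "f (x + h *\<^sub>R u + h *\<^sub>R v) - f (x + h *\<^sub>R u) - f (x + h *\<^sub>R v) + f x =
     h * h * dd v (dd u f) (x + s *\<^sub>R u + t *\<^sub>R v)"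
      using 1[unfolded e] 2 by simp
  qed
qed

text \<open>The second difference is symmetric in \<open>u\<close> and \<open>v\<close>, so both
  mixed derivatives take a common value, each at some point of the same small parallelogram.
  Continuity at \<open>x\<close> excludes a gap between them.\<close>

lemma dd_commute_real:
  fixes f :: "'e::euclidean_space \<Rightarrow> real"
  assumes "open U" "Cinf_on U f" "x \<in> U"
  shows "dd u (dd v f) x = dd v (dd u f) x"
proof (rule ccontr)
  let ?A = "dd u (dd v f)" and ?B = "dd v (dd u f)"
  assume "?A x \<noteq> ?B x"
  define \<epsilon> where "\<epsilon> = \<bar>?A x - ?B x\<bar> / 2"
  have "\<epsilon> > 0" using \<open>?A x \<noteq> ?B x\<close> by (simp add: \<epsilon>_def)
  have "isCont ?A x" "isCont ?B x"
    using Cinf_on_continuous[OF Cinf_on_dd[OF Cinf_on_dd[OF assms(2)]]] assms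
    by (auto simp: continuous_on_eq_continuous_at)
  then obtain d1 d2 where d: "d1 > 0" "\<And>y. dist y x < d1 \<Longrightarrow> dist (?A y) (?A x) < \<epsilon>"
     "d2 > 0" "\<And>y. dist y x < d2 \<Longrightarrow> dist (?B y) (?B x) < \<epsilon>"
    using \<open>\<epsilon> > 0\<close> unfolding continuous_at_eps_delta by (metis dist_norm)
  obtain d3 where d3: "d3 > 0" "ball x d3 \<subseteq> U" using assms openE by blast
  define \<delta> where "\<delta> = min d1 (min d2 d3)"
  have "\<delta> > 0" using d d3 by (simp add: \<delta>_def)
  \<comment> \<open>The summand 1 keeps the denominator positive even for \<open>u = v = 0\<close>
    and puts the parallelogram strictly within distance \<delta> of \<open>x\<close>.\<close>
  define h where "h = \<delta> / (norm u + norm v + 1)"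
  have h: "h > 0" using \<open>\<delta> > 0\<close> by (simp add: h_def add_nonneg_pos)
  have near: "dist (x + s *\<^sub>R u + t *\<^sub>R v) x < \<delta>" if "0 \<le> s" "s \<le> h" "0 \<le> t" "t \<le> h" for s t
  proof -
    have "dist (x + s *\<^sub>R u + t *\<^sub>R v) x \<le> s * norm u + t * norm v"
      using that norm_triangle_ineq[of "s *\<^sub>R u" "t *\<^sub>R v"] by (simp add: dist_norm)
    also have "\<dots> \<le> h * norm u + h * norm v"
      using that by (intro add_mono mult_right_mono) auto
    also have "\<dots> < h * (norm u + norm v + 1)" using h by (simp add: algebra_simps)
    also have "\<dots> = \<delta>" unfolding h_def using norm_ge_zero[of u] norm_ge_zero[of v]
      by (smt (verit) nonzero_eq_divide_eq)
    finally show ?thesis .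
  qed
  have inU: "x + s *\<^sub>R u + t *\<^sub>R v \<in> U" "x + t *\<^sub>R v + s *\<^sub>R u \<in> U" if "0 \<le> s" "s \<le> h" "0 \<le> t" "t \<le> h" for s t
    using near[OF that] d3 by (auto simp: \<delta>_def dist_commute add_ac subset_iff)
  obtain s t where st: "0 < s" "s < h" "0 < t" "t < h" and 1:
    "f (x + h *\<^sub>R u + h *\<^sub>R v) - f (x + h *\<^sub>R u) - f (x + h *\<^sub>R v) + f x =
     h * h * ?B (x + s *\<^sub>R u + t *\<^sub>R v)"
    by (rule second_difference_mvt[OF assms(1,2) h, of x u v]) (simp_all add: inU)
  obtain s' t' where st': "0 < s'" "s' < h" "0 < t'" "t' < h" and 2:
    "f (x + h *\<^sub>R v + h *\<^sub>R u) - f (x + h *\<^sub>R v) - f (x + h *\<^sub>R u) + f x =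
     h * h * ?A (x + t' *\<^sub>R v + s' *\<^sub>R u)"
    by (rule second_difference_mvt[OF assms(1,2) h, of x v u]) (simp_all add: inU)
  have "h * h * ?A (x + t' *\<^sub>R v + s' *\<^sub>R u) = h * h * ?B (x + s *\<^sub>R u + t *\<^sub>R v)"
    unfolding 1[symmetric] 2[symmetric] by (simp add: add_ac)
  then have eq: "?A (x + s' *\<^sub>R u + t' *\<^sub>R v) = ?B (x + s *\<^sub>R u + t *\<^sub>R v)"
    using h by (simp add: add_ac)
  have "dist (?A (x + s' *\<^sub>R u + t' *\<^sub>R v)) (?A x) < \<epsilon>" "dist (?B (x + s *\<^sub>R u + t *\<^sub>R v)) (?B x) < \<epsilon>"
    using near[of s t] near[of s' t'] st st' by (intro d; simp add: \<delta>_def)+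
  then show False unfolding eq \<epsilon>_def dist_real_def by (smt (verit) field_sum_of_halves)
qed

lemma dd_inner: "f differentiable (at x) \<Longrightarrow>
   fderiv (\<lambda>x. f x \<bullet> b) x v = fderiv f x v \<bullet> b"
  by (rule bounded_linear.dd_compose[OF bounded_linear_inner_left])

lemma dd_commute:
  assumes "open U" "Cinf_on U f" "x \<in> U"
  shows "dd u (dd v f) x = dd v (dd u f) x"
proof (rule euclidean_eqI)
  fix b
  have 2: "dd u (dd v (\<lambda>x. f x \<bullet> b)) x = dd u (dd v f) x \<bullet> b" for u v
  proof -
    have "dd u (dd v (\<lambda>x. f x \<bullet> b)) x = dd u (\<lambda>x. dd v f x \<bullet> b) x"
      using dd_inner[OF Cinf_on_differentiable[OF assms(2,1)]]
      by (intro fun_cong[OF dd_cong[OF assms(1) _ assms(3)]]) auto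
    then show ?thesis
      by (simp add: dd_inner Cinf_on_differentiable[OF Cinf_on_dd[OF assms(2)] assms(1,3)])
  qed
  show "dd u (dd v f) x \<bullet> b = dd v (dd u f) x \<bullet> b"
    unfolding 2[symmetric]
    by (rule dd_commute_real[OF assms(1) Cinf_on_inner_left[OF assms(1,2)] assms(3)])
qed

text \<open>Cramer's rule for a real-linear map of the plane with columns \<open>\<alpha>\<close> and \<open>\<beta>\<close>.\<close>

lemma complex_linear_solve:
  fixes L :: "complex \<Rightarrow> complex"
  assumes "linear L" "inj L"
  defines "\<Delta> \<equiv> Im (cnj (L 1) * L \<i>)"
  shows "\<Delta> \<noteq> 0"
    and "L w = v \<Longrightarrow> w = of_real (Im (cnj v * L \<i>) / \<Delta>) + \<i> * of_real (Im (cnj (L 1) * v) / \<Delta>)"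
proof -
  have L: "L w = Re w *\<^sub>R L 1 + Im w *\<^sub>R L \<i>" for w
    using linear_eq_sum_Basis[OF assms(1), of w] by (simp add: Basis_complex_def complex_inner_1_right complex_inner_i_right)
  show nz: "\<Delta> \<noteq> 0"
  proof
    assume \<Delta>: "\<Delta> = 0"
    have "L (Complex (Re (L \<i>)) (- Re (L 1))) = 0" "L (Complex (Im (L \<i>)) (- Im (L 1))) = 0"
      unfolding L[of "Complex _ _"] using \<Delta> by (auto simp: \<Delta>_def complex_eq_iff algebra_simps)
    then have "Complex (Re (L \<i>)) (- Re (L 1)) = 0" "Complex (Im (L \<i>)) (- Im (L 1)) = 0"
      using assms(1,2) by (metis injD linear_0)+
    then have "L 1 = L 0" using assms(1) by (auto simp: complex_eq_iff linear_0)
    then show False using assms(2) by (metis injD zero_neq_one)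
  qed
  assume "L w = v"
  then have "Im (cnj v * L \<i>) = Re w * \<Delta>" "Im (cnj (L 1) * v) = Im w * \<Delta>"
    by (auto simp: L[of w] \<Delta>_def algebra_simps)
  then show "w = of_real (Im (cnj v * L \<i>) / \<Delta>) + \<i> * of_real (Im (cnj (L 1) * v) / \<Delta>)"
    using nz by (simp add: complex_eq_iff)
qed

text \<open>The inverse function theorem yields a differentiable inverse \<open>g\<close>. By
  Cramer's rule \<open>dd v g\<close> is a rational expression, with nonzero denominator, in the
  columns \<open>dd 1 J\<close> and \<open>dd \<i> J\<close> evaluated at \<open>g y\<close>. These
  are as smooth as \<open>g\<close>, so each order of smoothness of \<open>g\<close> gives the
  next.\<close>

lemma Cinf_local_inverse_complex:
  fixes J :: "complex \<Rightarrow> complex"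
  assumes "open U" "Cinf_on U J" "z \<in> U" "inj (fderiv J z)"
  obtains U' V g where "open U'" "U' \<subseteq> U" "z \<in> U'" "open V" "J z \<in> V"
    "homeomorphism U' V J g" "Cinf_on V g"
    "\<And>w. w \<in> U' \<Longrightarrow> inj (fderiv J w)"
proof -
  have dJ: "(J has_derivative fderiv J x) (at x)" if "x \<in> U" for x
    using Cinf_on_differentiable assms(1,2) has_derivative_dd that by blast
  define J' where "J' x = Blinfun (fderiv J x)" for x
  have J': "blinfun_apply (J' x) = fderiv J x" if "x \<in> U" for x
    using bounded_linear_Blinfun_apply has_derivative_bounded_linear[OF dJ[OF that]] by (auto simp: J'_def)
  have cont: "continuous_on U J'"
  proof (rule continuous_on_blinfun_componentwise)
    fix i :: complex assume "i \<in> Basis"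
    have "continuous_on U (dd i J)"
      using assms(2) Cinf_on_continuous Cinf_on_dd by blast
    then show "continuous_on U (\<lambda>x. blinfun_apply (J' x) i)"
      by (rule continuous_on_eq) (simp add: J')
  qed
  have lin: "linear (fderiv J z)"
    using dJ[OF assms(3)] has_derivative_linear by blast
  then obtain K where K: "linear K" "K \<circ> fderiv J z = id"
    using linear_injective_left_inverse[OF _ assms(4)] by blast
  have "Blinfun K o\<^sub>L J' z = id_blinfun"
    using K by (intro blinfun_eqI)
      (simp add: J' assms(3) bounded_linear_Blinfun_apply linear_conv_bounded_linear pointfree_idE)
  from inverse_function_theorem[OF assms(1) _ cont assms(3) this, of J] dJ J'
  obtain U' V g g' where *: "open U'" "U' \<subseteq> U" "z \<in> U'" "open V" "J z \<in> V" "homeomorphism U' V J g"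
    "\<And>y. y \<in> V \<Longrightarrow> (g has_derivative (g' y)) (at y)"
    "\<And>y. y \<in> V \<Longrightarrow> g' y = inv (blinfun_apply (J'(g y)))"
    "\<And>y. y \<in> V \<Longrightarrow> bij (blinfun_apply (J'(g y)))"
    by metis
  have gV: "g y \<in> U'" "J (g y) = y" if "y \<in> V" for y
    using *(6) that by (auto simp: homeomorphism_def)
  have bij: "bij (fderiv J (g y))" if "y \<in> V" for y
    using *(9)[OF that] J'[of "g y"] gV(1)[OF that] *(2) by auto
  have "Ck_on k V g" for k
  proof (induction k)
    case 0
    then show ?case using *(6) by (simp add: homeomorphism_def)
  next
    case (Suc k)
    define \<alpha> where "\<alpha> y = dd 1 J (g y)" for y
    define \<beta> where "\<beta> y = dd \<i> J (g y)" for y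
    have ab: "Ck_on k V \<alpha>" "Ck_on k V \<beta>"
      unfolding \<alpha>_def \<beta>_def
      by (rule Ck_on_compose[OF *(4) assms(1) Cinf_on_dd[OF assms(2)] Suc]; use gV *(2) in blast)+
    have det: "Im (cnj (\<alpha> y) * \<beta> y) \<noteq> 0" and
      dg: "dd v g y = of_real (Im (cnj v * \<beta> y) / Im (cnj (\<alpha> y) * \<beta> y)) +
         \<i> * of_real (Im (cnj (\<alpha> y) * v) / Im (cnj (\<alpha> y) * \<beta> y))" if "y \<in> V" for y v
    proof -
      have "g y \<in> U" using gV[OF that] *(2) by auto
      then have l: "linear (fderiv J (g y))"
        using dJ has_derivative_linear by blast
      have i: "inj (fderiv J (g y))" using bij[OF that] bij_is_inj by blast
      show "Im (cnj (\<alpha> y) * \<beta> y) \<noteq> 0"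
        unfolding \<alpha>_def \<beta>_def by (rule complex_linear_solve[OF l i])
      have "dd v g y = inv (fderiv J (g y)) v"
        using dd_eqI[OF *(7)[OF that]] *(8)[OF that] J'[OF \<open>g y \<in> U\<close>] by simp
      then have "fderiv J (g y) (dd v g y) = v"
        using bij[OF that] by (simp add: bij_is_surj surj_f_inv_f)
      from complex_linear_solve(2)[OF l i this]
      show "dd v g y = of_real (Im (cnj v * \<beta> y) / Im (cnj (\<alpha> y) * \<beta> y)) +
         \<i> * of_real (Im (cnj (\<alpha> y) * v) / Im (cnj (\<alpha> y) * \<beta> y))"
        unfolding \<alpha>_def \<beta>_def .
    qed
    have cnj: "Ck_on k V (\<lambda>y. cnj (\<alpha> y))"
      by (rule Ck_on_bounded_linear[OF *(4) bounded_linear_cnj ab(1)])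
    have Im: "Ck_on k V (\<lambda>y. Im (p y * q y))" if "Ck_on k V p" "Ck_on k V q" for p q
      by (intro Ck_on_bounded_linear[OF *(4) bounded_linear_Im]
          Ck_on_bounded_bilinear[OF *(4) bounded_bilinear_mult] that)
    have "Ck_on k V (\<lambda>y. of_real (Im (cnj v * \<beta> y) / Im (cnj (\<alpha> y) * \<beta> y)) +
         \<i> * of_real (Im (cnj (\<alpha> y) * v) / Im (cnj (\<alpha> y) * \<beta> y)))" for v
      by (intro Ck_on_add Ck_on_bounded_bilinear[OF *(4) bounded_bilinear_mult]
          Ck_on_bounded_linear[OF *(4) bounded_linear_of_real] Ck_on_divide Im cnj ab Ck_on_const *(4) det)
    then have "Ck_on k V (dd v g)" for v
      by (rule Ck_on_cong_imp[OF *(4), rotated]) (simp add: dg)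
    moreover have "g differentiable_on V"
      unfolding differentiable_on_eq_differentiable_at[OF *(4)] using *(7) differentiableI by blast
    ultimately show ?case by simp
  qed
  then have "Cinf_on V g" by (simp add: Cinf_on_def)
  moreover have "inj (fderiv J w)" if "w \<in> U'" for w
  proof -
    have "J w \<in> V" "g (J w) = w" using *(6) that by (auto simp: homeomorphism_def)
    then show ?thesis using bij[of "J w"] bij_is_inj by auto
  qed
  ultimately show thesis using that[OF *(1-6)] by blast
qed

section \<open>Jets along the seam\<close>

text \<open>The jet of order k of \<open>D\<close> vanishes at every point of \<open>Z\<close>.
  Derivatives are taken in all directions of the ambient space, so those transversal to
  \<open>Z\<close> are included.\<close>

primrec flat_on :: "nat \<Rightarrow> 'e::euclidean_space set \<Rightarrow> ('e \<Rightarrow> 'f::euclidean_space) \<Rightarrow> bool" where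
  "flat_on 0 Z D \<longleftrightarrow> (\<forall>z\<in>Z. D z = 0)"
| "flat_on (Suc k) Z D \<longleftrightarrow> (\<forall>z\<in>Z. D z = 0) \<and> (\<forall>v. flat_on k Z (dd v D))"

lemma flat_on_zero: "flat_on k Z D \<Longrightarrow> z \<in> Z \<Longrightarrow> D z = 0"
  by (cases k) auto

lemma flat_on_SucD: "flat_on (Suc k) Z D \<Longrightarrow> flat_on k Z D"
proof (induction k arbitrary: D)
  case (Suc k)
  then have "flat_on k Z (dd v D)" for v by simp
  with Suc.prems show ?case by simp
qed simp

lemma flat_on_cong_imp:
  assumes "open V" "Z \<subseteq> V" "\<And>x. x \<in> V \<Longrightarrow> f x = g x" "flat_on k Z f"
  shows "flat_on k Z g"
  using assms(3,4)
proof (induction k arbitrary: f g)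
  case 0 then show ?case using assms(2) by (metis flat_on.simps(1) subsetD)
next
  case (Suc k)
  have "flat_on k Z (dd v g)" for v
    by (rule Suc.IH[of "dd v f"]) (use Suc.prems dd_cong[OF assms(1), of f g] in auto)
  moreover have "\<forall>z\<in>Z. g z = 0" using Suc.prems assms(2) by (metis flat_on.simps(2) subsetD)
  ultimately show ?case by simp
qed

context
  fixes V Z :: "'e::euclidean_space set"
  assumes V: "open V" and Z: "Z \<subseteq> V"
begin

lemma flat_on_add:
  assumes "Cinf_on V f" "Cinf_on V g" "flat_on k Z f" "flat_on k Z g"
  shows "flat_on k Z (\<lambda>x. f x + g x)"
  using assms
proof (induction k arbitrary: f g)
  case (Suc k)
  have "flat_on k Z (dd v (\<lambda>x. f x + g x))" for v
    by (rule flat_on_cong_imp[OF V Z _ Suc.IH[of "dd v f" "dd v g"]])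
      (use Suc.prems in \<open>auto simp: dd_add Cinf_on_differentiable V intro: Cinf_on_dd\<close>)
  then show ?case using Suc.prems by simp
qed simp

lemma flat_on_zero_fun: "flat_on k Z (\<lambda>x. 0)"
  by (induction k) auto

lemma flat_on_sum:
  assumes "\<And>i. i \<in> I \<Longrightarrow> Cinf_on V (f i)" "\<And>i. i \<in> I \<Longrightarrow> flat_on k Z (f i)"
  shows "flat_on k Z (\<lambda>x. \<Sum>i\<in>I. f i x)"
  using assms
proof (induction I rule: infinite_finite_induct)
  case (insert i I)
  have "flat_on k Z (\<lambda>x. f i x + (\<Sum>i\<in>I. f i x))"
    by (intro flat_on_add Cinf_on_sum[OF V] insert.IH insert.prems) auto
  then show ?case using insert by simp
qed (simp_all add: flat_on_zero_fun)

lemma flat_on_bounded_linear: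
  assumes "bounded_linear L" "Cinf_on V f" "flat_on k Z f"
  shows "flat_on k Z (\<lambda>x. L (f x))"
  using assms(2,3)
proof (induction k arbitrary: f)
  case 0 then show ?case by (simp add: linear_simps(3)[OF assms(1)])
next
  case (Suc k)
  have "flat_on k Z (dd v (\<lambda>x. L (f x)))" for v
    by (rule flat_on_cong_imp[OF V Z _ Suc.IH[of "dd v f"]])
      (use Suc.prems in \<open>auto simp: bounded_linear.dd_compose[OF assms(1)] Cinf_on_differentiable V intro: Cinf_on_dd\<close>)
  then show ?case using Suc.prems by (simp add: linear_simps(3)[OF assms(1)])
qed

lemma flat_on_diff:
  assumes "Cinf_on V f" "Cinf_on V g" "flat_on k Z f" "flat_on k Z g"
  shows "flat_on k Z (\<lambda>x. f x - g x)"
  using flat_on_add[OF assms(1) Cinf_on_minus[OF V assms(2)] assms(3)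
      flat_on_bounded_linear[OF bounded_linear_minus[OF bounded_linear_ident] assms(2,4)]] by simp

lemma flat_on_mult:
  fixes f g :: "'e \<Rightarrow> real"
  assumes "Cinf_on V f" "Cinf_on V g" "flat_on k Z f"
  shows "flat_on k Z (\<lambda>x. f x * g x)"
  using assms
proof (induction k arbitrary: f g)
  case (Suc k)
  have "flat_on k Z (dd v (\<lambda>x. f x * g x))" for v
  proof (rule flat_on_cong_imp[OF V Z _ flat_on_add[OF _ _ Suc.IH[of f "dd v g"] Suc.IH[of "dd v f" g]]])
    show "x \<in> V \<Longrightarrow> f x * dd v g x + dd v f x * g x = dd v (\<lambda>x. f x * g x) x" for x
      using bounded_bilinear.dd_prod[OF bounded_bilinear_mult, of f x g v] Suc.prems
      by (simp add: Cinf_on_differentiable V)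
  qed (use Suc.prems flat_on_SucD[OF Suc.prems(3)] in \<open>auto intro: Cinf_on_dd Cinf_on_mult V\<close>)
  then show ?case using Suc.prems by simp
qed simp

lemma flat_on_mult_left:
  fixes f g :: "'e \<Rightarrow> real"
  shows "Cinf_on V f \<Longrightarrow> Cinf_on V g \<Longrightarrow> flat_on k Z f \<Longrightarrow> flat_on k Z (\<lambda>x. g x * f x)"
  using flat_on_mult[of f g k] by (simp add: mult.commute)

lemma flat_on_inner:
  "Cinf_on V f \<Longrightarrow> flat_on k Z f \<Longrightarrow> flat_on k Z (\<lambda>x. f x \<bullet> b)"
  by (rule flat_on_bounded_linear[OF bounded_linear_inner_left])

text \<open>All derivatives vanish on the open set, and continuity carries this to its closure. In
  this way an identity known on one side reaches the seam or the boundary.\<close>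

lemma flat_on_of_vanishing:
  assumes "Cinf_on V E" "open O'" "O' \<subseteq> V" "\<And>x. x \<in> O' \<Longrightarrow> E x = 0" "Z \<subseteq> closure O'"
  shows "flat_on k Z E"
  using assms(1,4)
proof (induction k arbitrary: E)
  case 0
  have "E z = 0" if "z \<in> Z" for z
  proof (rule ccontr)
    assume "E z \<noteq> 0"
    have "open (V \<inter> E -` (- {0}))"
      using Cinf_on_continuous[OF 0(1)] V by (intro continuous_open_preimage) auto
    moreover have "z \<in> V \<inter> E -` (- {0})" using that Z \<open>E z \<noteq> 0\<close> by auto
    moreover have "z \<in> closure O'" using that assms(5) by auto
    ultimately have "(V \<inter> E -` (- {0})) \<inter> O' \<noteq> {}"
      using closure_iff_nhds_not_empty by blast
    then show False using 0(2) by auto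
  qed
  then show ?case by simp
next
  case (Suc k)
  have "dd v E x = 0" if "x \<in> O'" for x v
    using dd_cong[OF assms(2), of E "\<lambda>_. 0", OF _ that] Suc.prems(2) by simp
  then have "flat_on k Z (dd v E)" for v
    by (intro Suc.IH Cinf_on_dd Suc.prems(1)) auto
  moreover have "flat_on k Z E" using Suc by blast
  ultimately show ?case using flat_on_zero by auto
qed

text \<open>By the chain rule the derivative of the difference is a sum of two kinds of terms: a
  component of a derivative of \<open>u1 - u2\<close> times a smooth factor, and a smooth factor
  times \<open>dd b h (u1 x) - dd b h (u2 x)\<close>. The second kind is covered by the induction
  hypothesis for \<open>dd b h\<close>.\<close>

lemma flat_on_compose_diff:
  fixes h :: "'m::euclidean_space \<Rightarrow> real"
  assumes "open B" "Cinf_on B h" "Cinf_on V u1" "Cinf_on V u2" "u1 ` V \<subseteq> B" "u2 ` V \<subseteq> B"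
    and "flat_on k Z (\<lambda>x. u1 x - u2 x)"
  shows "flat_on k Z (\<lambda>x. h (u1 x) - h (u2 x))"
  using assms(2,7)
proof (induction k arbitrary: h)
  case 0 then show ?case by simp
next
  case (Suc k)
  have u: "u1 differentiable (at x)" "u2 differentiable (at x)" if "x \<in> V" for x
    using assms(3,4) that by (auto intro: Cinf_on_differentiable V)
  have h: "h differentiable (at (u1 x))" "h differentiable (at (u2 x))" if "x \<in> V" for x
    using assms(1,5,6) Suc.prems(1) that by (auto intro!: Cinf_on_differentiable)
  have hu: "(\<lambda>x. h (u1 x)) differentiable (at x)" "(\<lambda>x. h (u2 x)) differentiable (at x)" if "x \<in> V" for x
    using differentiable_compose[OF h(1)[OF that] u(1)[OF that]]
      differentiable_compose[OF h(2)[OF that] u(2)[OF that]] by auto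
  have c: "Cinf_on V (\<lambda>x. dd b h (u1 x))" "Cinf_on V (\<lambda>x. dd b h (u2 x))" for b
    by (rule Cinf_on_compose[OF V assms(1) Cinf_on_dd[OF Suc.prems(1)]]; use assms in blast)+
  have d: "Cinf_on V (\<lambda>x. u1 x - u2 x)" by (intro Cinf_on_diff V assms)
  have "flat_on k Z (dd v (\<lambda>x. h (u1 x) - h (u2 x)))" for v
  proof (rule flat_on_cong_imp[OF V Z])
    show "flat_on k Z (\<lambda>x. \<Sum>b\<in>Basis. (dd v (\<lambda>x. u1 x - u2 x) x \<bullet> b) * dd b h (u1 x) +
        (dd v u2 x \<bullet> b) * (dd b h (u1 x) - dd b h (u2 x)))"
      by (intro flat_on_sum flat_on_add flat_on_mult flat_on_mult_left[OF _ Cinf_on_inner_left[OF V]] flat_on_inner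
          Suc.IH Cinf_on_add Cinf_on_mult Cinf_on_diff[OF V] V Cinf_on_inner_left Cinf_on_dd d c assms Suc.prems)
        (use Suc.prems flat_on_SucD[OF Suc.prems(2)] in auto)
  next
    fix x assume x: "x \<in> V"
    show "(\<Sum>b\<in>Basis. (dd v (\<lambda>x. u1 x - u2 x) x \<bullet> b) * dd b h (u1 x) +
        (dd v u2 x \<bullet> b) * (dd b h (u1 x) - dd b h (u2 x))) = dd v (\<lambda>x. h (u1 x) - h (u2 x)) x"
      by (simp add: dd_diff[OF hu[OF x]] dd_diff[OF u[OF x]] dd_compose_sum h u x
          inner_diff_left algebra_simps sum.distrib sum_subtractf)
  qed
  then show ?case using Suc.prems by simp
qed

text \<open>Inverting the matrix \<open>A\<close> is avoided: differentiating the contraction of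
  \<open>Y\<close> with \<open>A\<close> expresses the contraction of \<open>dd v Y\<close> by that
  derivative and a term with \<open>Y\<close> itself, which is already flat to the order in
  question. Nondegeneracy enters pointwise at order 0.\<close>

lemma flat_on_nondegenerate:
  fixes Y :: "'e \<Rightarrow> 'm::euclidean_space" and A :: "'m \<Rightarrow> 'm \<Rightarrow> 'e \<Rightarrow> real"
  assumes A: "\<And>p b. Cinf_on V (A p b)"
    and nd: "\<And>z a. z \<in> Z \<Longrightarrow> (\<And>b. b \<in> Basis \<Longrightarrow> (\<Sum>p\<in>Basis. (a \<bullet> p) * A p b z) = 0) \<Longrightarrow> a = 0"
    and "Cinf_on V Y" "\<And>b. b \<in> Basis \<Longrightarrow> flat_on k Z (\<lambda>x. \<Sum>p\<in>Basis. (Y x \<bullet> p) * A p b x)"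
  shows "flat_on k Z Y"
  using assms(3,4)
proof (induction k arbitrary: Y)
  case 0
  then show ?case using nd by simp
next
  case (Suc k)
  have IH: "flat_on k Z Y" by (rule Suc.IH) (use Suc.prems flat_on_SucD in blast)+
  have "flat_on k Z (dd v Y)" for v
  proof (rule Suc.IH)
    show "Cinf_on V (dd v Y)" using Suc.prems Cinf_on_dd by blast
    fix b :: 'm assume b: "b \<in> Basis"
    let ?S = "\<lambda>x. \<Sum>p\<in>Basis. (Y x \<bullet> p) * A p b x"
    have dY: "Y differentiable (at x)" "(\<lambda>x. Y x \<bullet> p) differentiable (at x)" if "x \<in> V" for x p
      using Suc.prems(1) that by (auto intro: Cinf_on_differentiable V Cinf_on_inner_left)
    have dA: "A p b differentiable (at x)" if "x \<in> V" for x p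
      using A that by (auto intro: Cinf_on_differentiable V)
    have cS: "Cinf_on V (\<lambda>x. Y x \<bullet> p)" for p using Suc.prems V Cinf_on_inner_left by blast
    show "flat_on k Z (\<lambda>x. \<Sum>p\<in>Basis. (dd v Y x \<bullet> p) * A p b x)"
    proof (rule flat_on_cong_imp[OF V Z])
      show "flat_on k Z (\<lambda>x. dd v ?S x - (\<Sum>p\<in>Basis. (Y x \<bullet> p) * dd v (A p b) x))"
        by (intro flat_on_diff flat_on_sum flat_on_mult flat_on_inner IH cS Cinf_on_dd A Suc.prems
            Cinf_on_sum V Cinf_on_mult) (use Suc.prems(2)[OF b] in simp)
      fix x assume x: "x \<in> V"
      have "dd v ?S x = (\<Sum>p\<in>Basis. dd v (\<lambda>x. (Y x \<bullet> p) * A p b x) x)"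
        using dY(2)[OF x] dA[OF x] by (intro dd_sum differentiable_mult)
      also have "\<dots> = (\<Sum>p\<in>Basis. (Y x \<bullet> p) * dd v (A p b) x + (dd v Y x \<bullet> p) * A p b x)"
        using bounded_bilinear.dd_prod[OF bounded_bilinear_mult dY(2)[OF x] dA[OF x]] dY(1)[OF x]
        by (simp add: dd_inner)
      finally show "dd v ?S x - (\<Sum>p\<in>Basis. (Y x \<bullet> p) * dd v (A p b) x) = (\<Sum>p\<in>Basis. (dd v Y x \<bullet> p) * A p b x)"
        by (simp add: sum.distrib)
    qed
  qed
  then show ?case using flat_on_zero[OF IH] by simp
qed

end

section \<open>The Laplacian and the lowered harmonic map equation in the plane\<close>

definition laplace :: "(complex \<Rightarrow> 'f::euclidean_space) \<Rightarrow> complex \<Rightarrow> 'f" where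
  "laplace f x = dd 1 (dd 1 f) x + dd \<i> (dd \<i> f) x"

lemma Cinf_on_laplace: "open U \<Longrightarrow> Cinf_on U f \<Longrightarrow> Cinf_on U (laplace f)"
  unfolding laplace_def[abs_def] by (intro Cinf_on_add Cinf_on_dd)

lemma linear_complex_split:
  fixes L :: "complex \<Rightarrow> 'f::real_vector"
  assumes "linear L" shows "L w = Re w *\<^sub>R L 1 + Im w *\<^sub>R L \<i>"
  using linear_eq_sum_Basis[OF assms, of w] by (simp add: Basis_complex_def)

text \<open>Tangency is encoded by what the jet argument takes from it, with no parametrisation of
  \<open>Z\<close>. The type argument fixes the value type of the test functions, because a
  definition cannot quantify over types.\<close>

definition tangent_direction :: "'f::euclidean_space itself \<Rightarrow> complex set \<Rightarrow> complex \<Rightarrow> complex \<Rightarrow> bool" where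
  "tangent_direction _ Z z \<tau> \<longleftrightarrow> \<tau> \<noteq> 0 \<and>
     (\<forall>D :: complex \<Rightarrow> 'f. D differentiable (at z) \<longrightarrow> (\<forall>y\<in>Z. D y = 0) \<longrightarrow> fderiv D z \<tau> = 0)"

text \<open>At order 0 the first derivatives of \<open>D\<close> vanish on \<open>Z\<close>, so
  their derivatives along \<tau> vanish; together with the Laplacian this determines the Hessian.
  The step applies the claim to \<open>dd v D\<close>, since \<open>dd v\<close> commutes with
  \<open>laplace\<close>.\<close>

lemma flat_on_laplace:
  fixes D :: "complex \<Rightarrow> 'f::euclidean_space"
  assumes V: "open V" and Z: "Z \<subseteq> V"
    and tan: "\<And>z. z \<in> Z \<Longrightarrow> \<exists>\<tau>. tangent_direction TYPE('f) Z z \<tau>"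
    and "Cinf_on V D" "flat_on (Suc k) Z D" "flat_on k Z (laplace D)"
  shows "flat_on (Suc (Suc k)) Z D"
  using assms(4-6)
proof (induction k arbitrary: D)
  case 0
  have "dd w (dd v D) z = 0" if "z \<in> Z" for z v w
  proof -
    have z: "z \<in> V" using that Z by auto
    obtain \<tau> where \<tau>: "tangent_direction TYPE('f) Z z \<tau>" using tan[OF \<open>z \<in> Z\<close>] by blast
    have d: "dd v D differentiable (at z)" for v
      using Cinf_on_differentiable[OF Cinf_on_dd[OF 0(1)] V z] .
    have lin: "dd w (dd v D) z = Re w *\<^sub>R dd 1 (dd v D) z + Im w *\<^sub>R dd \<i> (dd v D) z" for v w
      using linear_complex_split[OF linear_frechet_derivative[OF d]] .
    have sym: "dd u (dd v D) z = dd v (dd u D) z" for u v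
      using dd_commute[OF V 0(1) z] .
    define p where "p = dd 1 (dd 1 D) z"
    define q where "q = dd 1 (dd \<i> D) z"
    have r: "dd \<i> (dd \<i> D) z = - p"
      using 0(3) that by (simp add: laplace_def p_def add_eq_0_iff)
    have "dd \<tau> (dd v D) z = 0" for v
      using \<tau> d[of v] 0(2) unfolding tangent_direction_def by auto
    from this[of 1] this[of \<i>]
    have e: "Re \<tau> *\<^sub>R p + Im \<tau> *\<^sub>R q = 0" "Re \<tau> *\<^sub>R q - Im \<tau> *\<^sub>R p = 0"
      unfolding lin[where w=\<tau>] using sym[of \<i> 1] r by (auto simp: p_def q_def)
    \<comment> \<open>Elimination in the system \<open>e\<close> for \<open>p\<close> and
      \<open>q\<close>; its determinant is the square of the norm of \<tau>.\<close>
    have "(Re \<tau> * Re \<tau> + Im \<tau> * Im \<tau>) *\<^sub>R p = Re \<tau> *\<^sub>R (Re \<tau> *\<^sub>R p + Im \<tau> *\<^sub>R q) - Im \<tau> *\<^sub>R (Re \<tau> *\<^sub>R q - Im \<tau> *\<^sub>R p)"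
      "(Re \<tau> * Re \<tau> + Im \<tau> * Im \<tau>) *\<^sub>R q = Im \<tau> *\<^sub>R (Re \<tau> *\<^sub>R p + Im \<tau> *\<^sub>R q) + Re \<tau> *\<^sub>R (Re \<tau> *\<^sub>R q - Im \<tau> *\<^sub>R p)"
      by (simp_all add: algebra_simps)
    moreover have "Re \<tau> * Re \<tau> + Im \<tau> * Im \<tau> \<noteq> 0"
      using \<tau> unfolding tangent_direction_def by (simp add: complex_eq_iff sum_squares_eq_zero_iff)
    ultimately have "p = 0" "q = 0" unfolding e by auto
    have 2: "dd 1 (dd v D) z = 0" "dd \<i> (dd v D) z = 0" for v
      unfolding sym[of v 1] sym[of v \<i>] lin[where w=v] using \<open>p = 0\<close> \<open>q = 0\<close> r sym[of \<i> 1]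
      by (auto simp: p_def q_def)
    show ?thesis unfolding lin[where w=w] 2 by simp
  qed
  then show ?case using 0 by simp
next
  case (Suc k)
  have "flat_on (Suc (Suc k)) Z (dd v D)" for v
  proof (rule Suc.IH)
    show c: "Cinf_on V (dd v D)" using Suc.prems Cinf_on_dd by blast
    show "flat_on (Suc k) Z (dd v D)" using Suc.prems(2) by simp
    have *: "dd v (dd u (dd u D)) x = dd u (dd u (dd v D)) x" if "x \<in> V" for x u
    proof -
      have "dd v (dd u (dd u D)) x = dd u (dd v (dd u D)) x"
        by (rule dd_commute[OF V Cinf_on_dd[OF Suc.prems(1)] that])
      also have "\<dots> = dd u (dd u (dd v D)) x"
        by (rule fun_cong[OF dd_cong[OF V dd_commute[OF V Suc.prems(1)] that]])
      finally show ?thesis .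
    qed
    show "flat_on k Z (laplace (dd v D))"
    proof (rule flat_on_cong_imp[OF V Z, of "dd v (laplace D)"])
      fix x assume x: "x \<in> V"
      have "dd v (laplace D) x = dd v (dd 1 (dd 1 D)) x + dd v (dd \<i> (dd \<i> D)) x"
        unfolding laplace_def[abs_def]
        by (intro dd_add Cinf_on_differentiable[OF _ V x] Cinf_on_dd Suc.prems)
      then show "dd v (laplace D) x = laplace (dd v D) x"
        unfolding laplace_def using *[OF x] by simp
    qed (use Suc.prems(3) in simp)
  qed
  then show ?case using Suc.prems(2) by simp
qed

text \<open>For \<open>G\<close> the metric and \<open>K\<close> the Christoffel symbols of the
  first kind this is the component \<open>b\<close> of the tension field with its index lowered.
  Keeping \<open>G\<close> and \<open>K\<close> abstract separates the jet argument from Riemannian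
  geometry.\<close>

definition lowered_tension ::
  "('n \<Rightarrow> 'n \<Rightarrow> 'n \<Rightarrow> real) \<Rightarrow> ('n \<Rightarrow> 'n \<Rightarrow> 'n \<Rightarrow> 'n \<Rightarrow> real) \<Rightarrow>
   (complex \<Rightarrow> 'n::euclidean_space) \<Rightarrow> 'n \<Rightarrow> complex \<Rightarrow> real" where
  "lowered_tension G K F b x =
     (\<Sum>p\<in>Basis. (laplace F x \<bullet> p) * G (F x) p b) +
     (\<Sum>p\<in>Basis. \<Sum>q\<in>Basis. ((dd 1 F x \<bullet> p) * (dd 1 F x \<bullet> q) + (dd \<i> F x \<bullet> p) * (dd \<i> F x \<bullet> q)) * K (F x) p q b)"

lemma Cinf_on_lowered_tension:
  assumes "open V" "open B" "Cinf_on V F" "F ` V \<subseteq> B"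
    and "\<And>p q. Cinf_on B (\<lambda>y. G y p q)" "\<And>p q b. Cinf_on B (\<lambda>y. K y p q b)"
  shows "Cinf_on V (lowered_tension G K F b)"
  unfolding lowered_tension_def[abs_def]
  by (intro Cinf_on_add Cinf_on_sum Cinf_on_mult Cinf_on_inner_left Cinf_on_laplace Cinf_on_dd assms(1,3)
     Cinf_on_compose[OF assms(1,2) assms(5) assms(3,4)] Cinf_on_compose[OF assms(1,2) assms(6) assms(3,4)])

text \<open>The seam is noncharacteristic for the Laplacian, so the equation determines the jets of a
  solution along the seam from its Cauchy data there.\<close>

theorem lowered_tension_jets_agree:
  fixes F1 F2 :: "complex \<Rightarrow> 'n::euclidean_space"
  assumes V: "open V" and B: "open B" and Z: "Z \<subseteq> V"
    and F: "Cinf_on V F1" "Cinf_on V F2" "F1 ` V \<subseteq> B" "F2 ` V \<subseteq> B"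
    and G: "\<And>p q. Cinf_on B (\<lambda>y. G y p q)" and K: "\<And>p q b. Cinf_on B (\<lambda>y. K y p q b)"
    and nd: "\<And>y a. y \<in> B \<Longrightarrow> (\<And>b. b \<in> Basis \<Longrightarrow> (\<Sum>p\<in>Basis. (a \<bullet> p) * G y p b) = 0) \<Longrightarrow> a = 0"
    and O1: "open O1" "O1 \<subseteq> V" "Z \<subseteq> closure O1" "\<And>x b. x \<in> O1 \<Longrightarrow> b \<in> Basis \<Longrightarrow> lowered_tension G K F1 b x = 0"
    and O2: "open O2" "O2 \<subseteq> V" "Z \<subseteq> closure O2" "\<And>x b. x \<in> O2 \<Longrightarrow> b \<in> Basis \<Longrightarrow> lowered_tension G K F2 b x = 0"
    and tan: "\<And>z. z \<in> Z \<Longrightarrow> \<exists>\<tau>. tangent_direction TYPE('n) Z z \<tau>"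
    and eq: "\<And>z. z \<in> Z \<Longrightarrow> F1 z = F2 z"
    and deq: "\<And>z v. z \<in> Z \<Longrightarrow> dd v F1 z = dd v F2 z"
  shows "flat_on k Z (\<lambda>x. F1 x - F2 x)"
proof -
  let ?D = "\<lambda>x. F1 x - F2 x"
  have dF: "F1 differentiable (at x)" "F2 differentiable (at x)"
    "dd v F1 differentiable (at x)" "dd v F2 differentiable (at x)" if "x \<in> V" for x v
    using F that by (auto intro: Cinf_on_differentiable V Cinf_on_dd)
  have cD: "Cinf_on V ?D" by (intro Cinf_on_diff V F)
  have dD: "dd v ?D x = dd v F1 x - dd v F2 x" if "x \<in> V" for x v
    by (rule dd_diff[OF dF(1,2)[OF that]])
  have ddD: "dd u (dd v ?D) x = dd u (dd v F1) x - dd u (dd v F2) x" if "x \<in> V" for x u v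
  proof -
    have "dd u (dd v ?D) x = dd u (\<lambda>x. dd v F1 x - dd v F2 x) x"
      by (rule fun_cong[OF dd_cong[OF V _ that]]) (rule dD)
    then show ?thesis using dd_diff[OF dF(3,4)[OF that]] by simp
  qed
  have lD: "laplace ?D x = laplace F1 x - laplace F2 x" if "x \<in> V" for x
    unfolding laplace_def ddD[OF that] by simp
  have base: "flat_on (Suc 0) Z ?D"
    using eq deq dD Z by auto
  have cL: "Cinf_on V (laplace F1)" "Cinf_on V (laplace F2)" "Cinf_on V (laplace ?D)"
    using Cinf_on_laplace V F cD by blast+
  have GF: "Cinf_on V (\<lambda>x. G (F1 x) p q)" "Cinf_on V (\<lambda>x. G (F2 x) p q)" for p q
    by (rule Cinf_on_compose[OF V B G F(1,3)], rule Cinf_on_compose[OF V B G F(2,4)])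
  have KF: "Cinf_on V (\<lambda>x. K (F1 x) p q b)" "Cinf_on V (\<lambda>x. K (F2 x) p q b)" for p q b
    by (rule Cinf_on_compose[OF V B K F(1,3)], rule Cinf_on_compose[OF V B K F(2,4)])
  \<comment> \<open>Subtract the two equations. The Laplacian of \<open>?D\<close> appears
    multiplied by \<open>G (F2 x)\<close>, and each remaining term has a factor that is a difference
    of values or of first derivatives of \<open>F1\<close> and \<open>F2\<close>, hence flat to
    order k.\<close>
  have step: "flat_on k Z (laplace ?D)" if fD: "flat_on (Suc k) Z ?D" for k
  proof (rule flat_on_nondegenerate[OF V Z, of "\<lambda>p b x. G (F2 x) p b"])
    show "Cinf_on V (\<lambda>x. G (F2 x) p b)" for p b by (rule GF)
    show "Cinf_on V (laplace ?D)" by (rule cL)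
    show "a = 0" if "z \<in> Z" "\<And>b. b \<in> Basis \<Longrightarrow> (\<Sum>p\<in>Basis. (a \<bullet> p) * G (F2 z) p b) = 0" for z a
      using nd[of "F2 z" a] that F(4) Z by blast
    fix b :: 'n assume b: "b \<in> Basis"
    have f: "flat_on k Z ?D" using fD flat_on_SucD by blast
    have fd: "flat_on k Z (dd v ?D)" for v using fD by simp
    have fG: "flat_on k Z (\<lambda>x. G (F1 x) p b - G (F2 x) p b)" for p
      by (rule flat_on_compose_diff[OF V Z B G F f])
    have fK: "flat_on k Z (\<lambda>x. K (F1 x) p q b - K (F2 x) p q b)" for p q
      by (rule flat_on_compose_diff[OF V Z B K F f])
    \<comment> \<open>Each equation holds on one side only, but approaching the seam from that side
      makes its left-hand side vanish there to all orders.\<close>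
    have T: "flat_on k Z (lowered_tension G K F1 b)" "flat_on k Z (lowered_tension G K F2 b)"
      by (rule flat_on_of_vanishing[OF V Z Cinf_on_lowered_tension[OF V B F(1,3) G K] O1(1,2) O1(4) O1(3)];
          use b in blast)
        (rule flat_on_of_vanishing[OF V Z Cinf_on_lowered_tension[OF V B F(2,4) G K] O2(1,2) O2(4) O2(3)];
          use b in blast)
    have cT: "Cinf_on V (lowered_tension G K F1 b)" "Cinf_on V (lowered_tension G K F2 b)"
      by (rule Cinf_on_lowered_tension[OF V B F(1,3) G K], rule Cinf_on_lowered_tension[OF V B F(2,4) G K])
    let ?Q = "\<lambda>F p q x. (dd 1 F x \<bullet> p) * (dd 1 F x \<bullet> q) + (dd \<i> F x \<bullet> p) * (dd \<i> F x \<bullet> q)"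
    \<comment> \<open>The difference of the quadratic terms, split by
      \<open>a1 * b1 - a2 * b2 = (a1 - a2) * b1 + (b1 - b2) * a2\<close>.\<close>
    let ?QD = "\<lambda>p q x. ((dd 1 ?D x \<bullet> p) * (dd 1 F1 x \<bullet> q) + (dd 1 ?D x \<bullet> q) * (dd 1 F2 x \<bullet> p)) +
       ((dd \<i> ?D x \<bullet> p) * (dd \<i> F1 x \<bullet> q) + (dd \<i> ?D x \<bullet> q) * (dd \<i> F2 x \<bullet> p))"
    let ?R1 = "\<lambda>x. \<Sum>p\<in>Basis. (G (F1 x) p b - G (F2 x) p b) * (laplace F1 x \<bullet> p)"
    let ?R2 = "\<lambda>x. \<Sum>p\<in>Basis. \<Sum>q\<in>Basis. ?QD p q x * K (F1 x) p q b + (K (F1 x) p q b - K (F2 x) p q b) * ?Q F2 p q x"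
    have i: "Cinf_on V (\<lambda>x. dd v F1 x \<bullet> p)" "Cinf_on V (\<lambda>x. dd v F2 x \<bullet> p)" "Cinf_on V (\<lambda>x. dd v ?D x \<bullet> p)"
      "Cinf_on V (\<lambda>x. laplace F1 x \<bullet> p)" for v p
      by (intro Cinf_on_inner_left V Cinf_on_dd F cD cL)+
    have fi: "flat_on k Z (\<lambda>x. dd v ?D x \<bullet> p)" for v p
      by (rule flat_on_inner[OF V Z Cinf_on_dd[OF cD] fd])
    have QD: "Cinf_on V (\<lambda>x. ?QD p q x)" "Cinf_on V (\<lambda>x. ?Q F2 p q x)" "flat_on k Z (\<lambda>x. ?QD p q x)" for p q
      by (intro Cinf_on_add Cinf_on_mult V i flat_on_add[OF V Z] flat_on_mult[OF V Z] fi)+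
    have R1: "Cinf_on V ?R1" "flat_on k Z ?R1"
      by (intro Cinf_on_sum Cinf_on_mult Cinf_on_diff V GF i flat_on_sum[OF V Z] flat_on_mult[OF V Z] fG)+
    have R2: "Cinf_on V ?R2" "flat_on k Z ?R2"
      by (intro Cinf_on_sum Cinf_on_add[OF V Cinf_on_mult[OF V QD(1) KF(1)] Cinf_on_mult[OF V Cinf_on_diff[OF V KF] QD(2)]] V
          flat_on_sum[OF V Z]
          flat_on_add[OF V Z _ _ flat_on_mult[OF V Z QD(1) KF(1) QD(3)] flat_on_mult[OF V Z Cinf_on_diff[OF V KF] QD(2) fK]]
          Cinf_on_mult[OF V QD(1) KF(1)] Cinf_on_mult[OF V Cinf_on_diff[OF V KF] QD(2)])+
    show "flat_on k Z (\<lambda>x. \<Sum>p\<in>Basis. (laplace ?D x \<bullet> p) * G (F2 x) p b)"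
    proof (rule flat_on_cong_imp[OF V Z])
      show "flat_on k Z (\<lambda>x. lowered_tension G K F1 b x - lowered_tension G K F2 b x - ?R1 x - ?R2 x)"
        by (intro flat_on_diff[OF V Z] Cinf_on_diff V T cT R1 R2)
      fix x assume x: "x \<in> V"
      have "(\<Sum>p\<in>Basis. (laplace F1 x \<bullet> p) * G (F1 x) p b) - (\<Sum>p\<in>Basis. (laplace F2 x \<bullet> p) * G (F2 x) p b) - ?R1 x
        = (\<Sum>p\<in>Basis. (laplace ?D x \<bullet> p) * G (F2 x) p b)"
        unfolding lD[OF x] sum_subtractf[symmetric] by (intro sum.cong refl) (simp add: algebra_simps)
      moreover have "(\<Sum>p\<in>Basis. \<Sum>q\<in>Basis. ?Q F1 p q x * K (F1 x) p q b) - (\<Sum>p\<in>Basis. \<Sum>q\<in>Basis. ?Q F2 p q x * K (F2 x) p q b) - ?R2 x = 0"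
        unfolding sum_subtractf[symmetric] dD[OF x] by (intro sum.neutral ballI) (simp add: algebra_simps)
      ultimately show "lowered_tension G K F1 b x - lowered_tension G K F2 b x - ?R1 x - ?R2 x = (\<Sum>p\<in>Basis. (laplace ?D x \<bullet> p) * G (F2 x) p b)"
        unfolding lowered_tension_def by simp
    qed
  qed
  \<comment> \<open>The induction starts at order 1, the Cauchy data. Each round gains one order:
    flatness of order k + 1 makes the Laplacian flat to order k, and both give order k + 2.\<close>
  have "flat_on (Suc k) Z ?D" for k
  proof (induction k)
    case 0 show ?case by (rule base)
  next
    case (Suc k) show ?case by (rule flat_on_laplace[OF V Z tan cD Suc step[OF Suc]])
  qed
  then show ?thesis using flat_on_SucD by blast
qed

text \<open>Agreement of the first jets on the overlap makes \<open>F\<close> differentiable, and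
  \<open>dd v F\<close> is glued in the same way from \<open>dd v F1\<close> and
  \<open>dd v F2\<close>, whose difference is again flat to all orders. Hence the induction runs
  over all such triples.\<close>

lemma Cinf_on_glue:
  fixes F F1 F2 :: "'e::euclidean_space \<Rightarrow> 'f::euclidean_space"
  assumes "open V" "A1 \<union> A2 = V" "open (V - A1)" "open (V - A2)"
    and "Cinf_on V F1" "Cinf_on V F2" "\<And>x. x \<in> A1 \<Longrightarrow> F x = F1 x" "\<And>x. x \<in> A2 \<Longrightarrow> F x = F2 x"
    and "\<And>k. flat_on k (A1 \<inter> A2) (\<lambda>x. F1 x - F2 x)"
  shows "Cinf_on V F"
proof -
  have "Ck_on k V F" for k
    using assms(5-9)
  proof (induction k arbitrary: F F1 F2)
    case (Suc k)
    have dF: "F1 differentiable (at x)" "F2 differentiable (at x)" if "x \<in> V" for x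
      using Suc.prems that by (auto intro: Cinf_on_differentiable assms(1))
    have dD: "dd v (\<lambda>x. F1 x - F2 x) x = dd v F1 x - dd v F2 x" if "x \<in> V" for x v
      by (rule dd_diff[OF dF[OF that]])
    have "flat_on (Suc 0) (A1 \<inter> A2) (\<lambda>x. F1 x - F2 x)" by (rule Suc.prems(5))
    then have deq: "fderiv F1 x = fderiv F2 x" if "x \<in> A1 \<inter> A2" for x
      using that dD[of x] assms(2) by fastforce
    have D: "(x \<in> A1 \<longrightarrow> (F has_derivative fderiv F1 x) (at x)) \<and>
        (x \<in> A2 \<longrightarrow> (F has_derivative fderiv F2 x) (at x))" if x: "x \<in> V" for x
    proof -
      note d1 = has_derivative_dd[OF dF(1)[OF x]] and d2 = has_derivative_dd[OF dF(2)[OF x]]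
      consider "x \<in> V - A1" | "x \<in> V - A2" | "x \<in> A1 \<inter> A2" using x by blast
      then show ?thesis
      proof cases
        case 1
        have "F2 y = F y" if "y \<in> V - A1" for y using that assms(2) Suc.prems(4) by force
        from has_derivative_transform_within_open[OF d2 assms(3) 1 this] 1 show ?thesis by auto
      next
        case 2
        have "F1 y = F y" if "y \<in> V - A2" for y using that assms(2) Suc.prems(3) by force
        from has_derivative_transform_within_open[OF d1 assms(4) 2 this] 2 show ?thesis by auto
      next
        case 3
        \<comment> \<open>On the overlap the derivatives within \<open>A1\<close> and within
          \<open>A2\<close> coincide, and the two sets cover the open set \<open>V\<close>, so they
          combine to a derivative.\<close>
        have "(F has_derivative fderiv F1 x) (at x within A1)"
          by (rule has_derivative_transform[OF _ _ has_derivative_at_withinI[OF d1]]) (use 3 Suc.prems(3) in auto)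
        moreover have "(F has_derivative fderiv F1 x) (at x within A2)"
          unfolding deq[OF 3]
          by (rule has_derivative_transform[OF _ _ has_derivative_at_withinI[OF d2]]) (use 3 Suc.prems(4) in auto)
        ultimately have "(F has_derivative fderiv F1 x) (at x within (A1 \<union> A2))"
          unfolding has_derivative_within by (auto intro: Lim_Un)
        then have "(F has_derivative fderiv F1 x) (at x)"
          unfolding assms(2) at_within_open[OF x assms(1)] .
        then show ?thesis using deq[OF 3] by simp
      qed
    qed
    have "F differentiable_on V"
      unfolding differentiable_on_eq_differentiable_at[OF assms(1)]
      using D assms(2) differentiableI by blast
    moreover have "Ck_on k V (dd v F)" for v
    proof (rule Suc.IH)
      show "Cinf_on V (dd v F1)" "Cinf_on V (dd v F2)" using Suc.prems Cinf_on_dd by blast+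
      show "dd v F x = dd v F1 x" if "x \<in> A1" for x using D that assms(2) by (auto intro!: dd_eqI)
      show "dd v F x = dd v F2 x" if "x \<in> A2" for x using D that assms(2) by (auto intro!: dd_eqI)
      show "flat_on k (A1 \<inter> A2) (\<lambda>x. dd v F1 x - dd v F2 x)" for k
      proof (rule flat_on_cong_imp[OF assms(1)])
        show "flat_on k (A1 \<inter> A2) (dd v (\<lambda>x. F1 x - F2 x))" using Suc.prems(5)[of "Suc k"] by simp
      qed (use assms(2) dD in auto)
    qed
    ultimately show ?case by simp
  next
    case 0
    have c: "continuous_on V F1" "continuous_on V F2" using 0 Cinf_on_continuous by blast+
    have "closedin (top_of_set V) A1" "closedin (top_of_set V) A2"
      using assms(1-4) unfolding closedin_def
      by (auto simp: openin_open_eq)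
    moreover have "continuous_on A1 F" "continuous_on A2 F"
      using continuous_on_subset[OF c(1), of A1] continuous_on_subset[OF c(2), of A2] assms(2) 0(3,4)
      by (auto cong: continuous_on_cong)
    ultimately show ?case
      using continuous_on_closed_Un[of V] by (metis Ck_on.simps(1) assms(2) continuous_on_Un_local)
  qed
  then show ?thesis by (simp add: Cinf_on_def)
qed

section \<open>Charts, derivatives and tangent vectors\<close>

text \<open>Derivatives within relatively open subsets of a solid set are unique.\<close>

definition solid :: "'e::euclidean_space set \<Rightarrow> bool" where
  "solid H \<longleftrightarrow> (\<forall>x\<in>H. \<forall>i\<in>Basis. \<forall>e>0. \<exists>d. 0 < \<bar>d\<bar> \<and> \<bar>d\<bar> < e \<and> x + d *\<^sub>R i \<in> H)"

lemma solidD: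
  "solid H \<Longrightarrow> x \<in> H \<Longrightarrow> i \<in> Basis \<Longrightarrow> 0 < e \<Longrightarrow> \<exists>d. 0 < \<bar>d\<bar> \<and> \<bar>d\<bar> < e \<and> x + d *\<^sub>R i \<in> H"
  by (simp add: solid_def)

lemma solid_UNIV: "solid UNIV"
  unfolding solid_def by (metis UNIV_I abs_of_pos dense)

lemma solid_half_plane: "solid half_plane"
  unfolding solid_def
proof (intro ballI allI impI)
  fix x i :: complex and e :: real assume *: "x \<in> half_plane" "i \<in> Basis" "0 < e"
  then have "x + (e/2) *\<^sub>R i \<in> half_plane" by (auto simp: half_plane_def Basis_complex_def)
  then show "\<exists>d. 0 < \<bar>d\<bar> \<and> \<bar>d\<bar> < e \<and> x + d *\<^sub>R i \<in> half_plane"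
    using * by (intro exI[of _ "e/2"]) auto
qed

text \<open>Near \<open>z\<close> the set \<open>D\<close> coincides with \<open>H\<close>, which
  accumulates at \<open>z\<close> along every coordinate axis. So a derivative within
  \<open>D\<close> is unique, and the choice made by \<open>frechet_derivative\<close> must be the
  derivative of any smooth extension.\<close>

lemma within_deriv_eq:
  assumes "solid H" and A: "openin (top_of_set H) A" and z: "z \<in> A" "open U" "z \<in> U"
    and D: "D \<inter> U = A \<inter> U" and k: "\<And>x. x \<in> A \<inter> U \<Longrightarrow> k x = h x"
    and h: "h differentiable (at z)"
  shows "frechet_derivative k (at z within D) = fderiv h z"
proof -
  obtain O' where O': "open O'" "A = H \<inter> O'" using A by (auto simp: openin_open)
  let ?S = "U \<inter> O'" let ?T = "H \<inter> ?S"
  have S: "open ?S" "z \<in> ?S" using O' z by auto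
  have "D \<inter> ?S - {z} = H \<inter> ?S - {z}" using D O' by auto
  with at_within_nhd[OF S(2,1)] have D_H: "at z within D = at z within H" by blast
  have T_H: "at z within ?T = at z within H"
    by (rule at_within_nhd[OF S(2,1)]) auto
  have k': "(k has_derivative fderiv h z) (at z within ?T)"
    by (rule has_derivative_transform[OF _ _ has_derivative_at_withinI[OF has_derivative_dd[OF h]]])
      (use z O' k in auto)
  obtain r where r: "r > 0" "ball z r \<subseteq> ?S" using S openE by blast
  have app: "\<exists>d. 0 < \<bar>d\<bar> \<and> \<bar>d\<bar> < e \<and> z + d *\<^sub>R i \<in> ?T" if i: "i \<in> Basis" and "e > 0" for i e
  proof -
    have "z \<in> H" using z O' by auto
    moreover have "min e r > 0" using that r by simp
    ultimately obtain d where d: "0 < \<bar>d\<bar>" "\<bar>d\<bar> < min e r" "z + d *\<^sub>R i \<in> H"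
      using solidD[OF \<open>solid H\<close> _ i, of z "min e r"] by auto
    then have "z + d *\<^sub>R i \<in> ball z r" using that by (simp add: dist_norm)
    then show ?thesis using d r(2) by (intro exI[of _ d]) auto
  qed
  have "(k has_derivative frechet_derivative k (at z within D)) (at z within ?T)"
    using k' unfolding T_H D_H by (metis frechet_derivative_works differentiable_def)
  from frechet_derivative_unique_within[OF this k' app] show ?thesis .
qed

lemma smooth_on_open_imp_Cinf_on:
  assumes "open B" "smooth_on B f" shows "Cinf_on B f"
proof -
  have "\<exists>V. open V \<and> x \<in> V \<and> Ck_on k V f" if "x \<in> B" for x k
  proof -
    obtain U h where U: "open U" "x \<in> U" "\<forall>k. Ck_on k U h" "\<forall>y\<in>B \<inter> U. h y = f y"
      using assms(2) \<open>x \<in> B\<close> unfolding smooth_on_def by blast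
    have "Ck_on k (B \<inter> U) h" using U(3) Ck_on_subset by (metis inf_le2)
    from Ck_on_cong_imp[OF _ _ this, of f] U assms(1) \<open>x \<in> B\<close> show ?thesis
      by (intro exI[of _ "B \<inter> U"]) auto
  qed
  then show ?thesis unfolding Cinf_on_def using Ck_on_local[OF _ assms(1)] by blast
qed

lemma Cinf_on_imp_smooth_on:
  assumes "\<And>x. x \<in> D \<Longrightarrow> \<exists>U h. open U \<and> x \<in> U \<and> Cinf_on U h \<and> (\<forall>y\<in>D \<inter> U. h y = f y)"
  shows "smooth_on D f"
  using assms unfolding smooth_on_def Cinf_on_def by blast

section \<open>Charts as homeomorphisms onto relatively open sets\<close>

lemma
  assumes "smooth_manifold H M" "c \<in> atlas M"
  shows chart_openin: "openin (mtop M) (fst c)"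
    and chart_subset: "fst c \<subseteq> points M"
    and chart_image_openin: "openin (top_of_set H) (snd c ` fst c)"
    and chart_image_subset: "snd c ` fst c \<subseteq> H"
    and chart_inj_on: "inj_on (snd c) (fst c)"
    and chart_homeomorphic: "homeomorphic_map (subtopology (mtop M) (fst c)) (top_of_set (snd c ` fst c)) (snd c)"
proof -
  show 1: "openin (mtop M) (fst c)" and 2: "openin (top_of_set H) (snd c ` fst c)"
    and 3: "homeomorphic_map (subtopology (mtop M) (fst c)) (top_of_set (snd c ` fst c)) (snd c)"
    using assms unfolding smooth_manifold_def by (cases c; force)+
  show 4: "fst c \<subseteq> points M" using 1 openin_subset by blast
  show "snd c ` fst c \<subseteq> H" using 2 openin_imp_subset by blast
  show "inj_on (snd c) (fst c)"
    using homeomorphic_imp_injective_map[OF 3] 4 by (simp add: Int_absorb1)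
qed

lemma chart_open_image:
  assumes "smooth_manifold H M" "c \<in> atlas M" "openin (mtop M) Q" "Q \<subseteq> fst c"
  shows "openin (top_of_set H) (snd c ` Q)"
proof -
  have "openin (subtopology (mtop M) (fst c)) Q"
    using assms by (simp add: chart_openin openin_open_subtopology)
  then have "openin (top_of_set (snd c ` fst c)) (snd c ` Q)"
    using homeomorphic_imp_open_map[OF chart_homeomorphic[OF assms(1,2)]] open_map_def by blast
  then show ?thesis using chart_image_openin[OF assms(1,2)] openin_trans by blast
qed

lemma chart_open_preimage:
  assumes "smooth_manifold H M" "c \<in> atlas M" "open U"
  shows "openin (mtop M) {q \<in> fst c. snd c q \<in> U}"
proof -
  have "openin (top_of_set (snd c ` fst c)) (snd c ` fst c \<inter> U)" using assms(3) by auto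
  then have "openin (subtopology (mtop M) (fst c)) {q \<in> topspace (subtopology (mtop M) (fst c)). snd c q \<in> snd c ` fst c \<inter> U}"
    using homeomorphic_imp_continuous_map[OF chart_homeomorphic[OF assms(1,2)]]
      openin_continuous_map_preimage by blast
  moreover have "{q \<in> topspace (subtopology (mtop M) (fst c)). snd c q \<in> snd c ` fst c \<inter> U} = {q \<in> fst c. snd c q \<in> U}"
    using chart_subset[OF assms(1,2)] by auto
  ultimately show ?thesis
    using chart_openin[OF assms(1,2)] by (simp add: openin_open_subtopology)
qed

lemma chart_inv_chart:
  "smooth_manifold H M \<Longrightarrow> c \<in> atlas M \<Longrightarrow> q \<in> fst c \<Longrightarrow> chart_inv c (snd c q) = q"
  unfolding chart_inv_def using chart_inj_on by (metis inv_into_f_f)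

lemma charts_atD: "c \<in> charts_at M p \<Longrightarrow> c \<in> atlas M \<and> p \<in> fst c"
  by (simp add: charts_at_def)

lemma charts_at_nonempty: "smooth_manifold H M \<Longrightarrow> p \<in> points M \<Longrightarrow> \<exists>c. c \<in> charts_at M p"
  unfolding smooth_manifold_def by blast

lemma charts_at_points: "smooth_manifold H M \<Longrightarrow> c \<in> charts_at M p \<Longrightarrow> p \<in> points M"
  using chart_subset[of H M c] by (auto simp: charts_at_def)

text \<open>\<open>h\<close> is smooth on the open set \<open>U\<close> around \<open>p\<close> and restricts to the local representative of \<open>F\<close>
  in the charts \<open>c\<close> and \<open>d\<close>, so derivatives at boundary points can be computed from \<open>h\<close>.\<close>

definition local_ext ::
  "('a, 'e::euclidean_space) chart \<Rightarrow> ('b, 'f::euclidean_space) chart \<Rightarrow> ('a \<Rightarrow> 'b) \<Rightarrow> 'a \<Rightarrow>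
   'e set \<Rightarrow> ('e \<Rightarrow> 'f) \<Rightarrow> bool" where
  "local_ext c d F p U h \<longleftrightarrow> open U \<and> snd c p \<in> U \<and> Cinf_on U h \<and>
     (\<forall>q\<in>fst c. snd c q \<in> U \<longrightarrow> F q \<in> fst d \<and> h (snd c q) = snd d (F q))"

lemma local_extD:
  assumes "local_ext c d F p U h"
  shows "open U" "snd c p \<in> U" "Cinf_on U h"
    "q \<in> fst c \<Longrightarrow> snd c q \<in> U \<Longrightarrow> F q \<in> fst d" "q \<in> fst c \<Longrightarrow> snd c q \<in> U \<Longrightarrow> h (snd c q) = snd d (F q)"
  using assms unfolding local_ext_def by auto

lemma local_ext_move:
  "local_ext c d F p U h \<Longrightarrow> snd c q \<in> U \<Longrightarrow> local_ext c d F q U h"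
  unfolding local_ext_def by blast

lemma local_ext_subset:
  "local_ext c d F p U h \<Longrightarrow> open U' \<Longrightarrow> snd c p \<in> U' \<Longrightarrow> U' \<subseteq> U \<Longrightarrow> local_ext c d F p U' h"
  unfolding local_ext_def using Cinf_on_subset by blast

lemma local_ext_compose:
  assumes "local_ext c d F p U h" "local_ext d e G (F p) U' h'" "p \<in> fst c"
  shows "local_ext c e (\<lambda>x. G (F x)) p (U \<inter> h -` U') (\<lambda>x. h' (h x))"
proof -
  note 1 = local_extD[OF assms(1)] and 2 = local_extD[OF assms(2)]
  have "open (U \<inter> h -` U')"
    using continuous_open_preimage[OF Cinf_on_continuous[OF 1(3)] 1(1) 2(1)] .
  moreover from this have "Cinf_on (U \<inter> h -` U') (\<lambda>x. h' (h x))"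
    by (intro Cinf_on_compose[OF _ 2(1) 2(3) Cinf_on_subset[OF 1(3)]]) auto
  moreover have "snd c p \<in> U \<inter> h -` U'" using 1(2) 2(2) 1(5)[OF assms(3)] by simp
  ultimately show ?thesis
    unfolding local_ext_def using 1(4,5) 2(4,5) by auto
qed

lemma local_ext_cong:
  assumes "local_ext c d F p U h" "\<And>q. q \<in> fst c \<Longrightarrow> F q = F' q"
  shows "local_ext c d F' p U h"
  using assms unfolding local_ext_def by auto

lemma local_dom_openin:
  assumes "smooth_manifold H M" "smooth_manifold H' M'" "continuous_map (mtop M) (mtop M') F"
    "c \<in> atlas M" "d \<in> atlas M'"
  shows "openin (top_of_set H) (local_dom c d F)"
proof -
  have "openin (mtop M) {x \<in> points M. F x \<in> fst d}"
    using assms chart_openin openin_continuous_map_preimage by blast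
  then have "openin (mtop M) (fst c \<inter> {x \<in> points M. F x \<in> fst d})"
    using chart_openin[OF assms(1,4)] by blast
  moreover have "fst c \<inter> {x \<in> points M. F x \<in> fst d} = fst c \<inter> F -` fst d"
    using chart_subset[OF assms(1,4)] by auto
  ultimately show ?thesis
    unfolding local_dom_def using chart_open_image[OF assms(1,4)] by simp
qed

text \<open>The extension supplied by \<open>smooth_on\<close> controls only points of
  \<open>local_dom\<close>. Since that set is relatively open in \<open>H\<close>, the neighbourhood
  can be cut down until all its points in \<open>H\<close> are chart points that \<open>F\<close>
  maps into the domain of \<open>d\<close>.\<close>

lemma smooth_map_local_ext:
  assumes "smooth_manifold H M" "smooth_manifold H' M'" "smooth_map M M' F"
    "c \<in> charts_at M p" "d \<in> charts_at M' (F p)" "open Q" "snd c p \<in> Q"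
  obtains U h where "local_ext c d F p U h" "U \<subseteq> Q" "U \<inter> H \<subseteq> snd c ` fst c"
proof -
  have c: "c \<in> atlas M" "p \<in> fst c" and d: "d \<in> atlas M'" "F p \<in> fst d"
    using assms(4,5) by (auto simp: charts_at_def)
  have z: "snd c p \<in> local_dom c d F" unfolding local_dom_def using c d by auto
  have "smooth_on (local_dom c d F) (local_rep c d F)"
    using assms(3) c d unfolding smooth_map_def by blast
  then obtain U h where U: "open U" "snd c p \<in> U" "Cinf_on U h"
    "\<And>y. y \<in> local_dom c d F \<inter> U \<Longrightarrow> h y = local_rep c d F y"
    using z unfolding smooth_on_def Cinf_on_def by metis
  have "openin (top_of_set H) (local_dom c d F)"
    using local_dom_openin assms(1-3) c d unfolding smooth_map_def by blast
  then obtain O' where O': "open O'" "local_dom c d F = H \<inter> O'" by (auto simp: openin_open)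
  show thesis
  proof (rule that)
    let ?U = "U \<inter> O' \<inter> Q"
    show "?U \<inter> H \<subseteq> snd c ` fst c" using O' unfolding local_dom_def by auto
    have "F q \<in> fst d \<and> h (snd c q) = snd d (F q)" if "q \<in> fst c" "snd c q \<in> ?U" for q
    proof -
      have "snd c q \<in> local_dom c d F"
        using O' that chart_image_subset[OF assms(1) c(1)] by auto
      then obtain q' where q': "q' \<in> fst c" "F q' \<in> fst d" "snd c q = snd c q'"
        unfolding local_dom_def by auto
      then have "q' = q" using chart_inj_on[OF assms(1) c(1)] that by (metis inj_onD)
      then show ?thesis
        using q' U(4)[of "snd c q"] that \<open>snd c q \<in> local_dom c d F\<close> chart_inv_chart[OF assms(1) c(1)]
        by (simp add: local_rep_def)
    qed
    moreover have "Cinf_on ?U h" by (rule Cinf_on_subset[OF U(3)]) auto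
    ultimately show "local_ext c d F p ?U h"
      unfolding local_ext_def using U O' z assms by auto
  qed auto
qed

lemma smooth_map_local_ext_ex:
  assumes "smooth_manifold H M" "smooth_manifold H' M'" "smooth_map M M' F"
    "c \<in> charts_at M p" "d \<in> charts_at M' (F p)"
  shows "\<exists>U h. local_ext c d F p U h"
  by (rule smooth_map_local_ext[OF assms open_UNIV UNIV_I]) blast

lemma smooth_mapI:
  assumes "smooth_manifold H M" "continuous_map (mtop M) (mtop M') F"
    and "\<And>c d p. \<lbrakk>c \<in> atlas M; d \<in> atlas M'; p \<in> fst c; F p \<in> fst d\<rbrakk> \<Longrightarrow>
      \<exists>U h. open U \<and> snd c p \<in> U \<and> Cinf_on U h \<and>
        (\<forall>q\<in>fst c. F q \<in> fst d \<longrightarrow> snd c q \<in> U \<longrightarrow> h (snd c q) = snd d (F q))"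
  shows "smooth_map M M' F"
  unfolding smooth_map_def
proof (intro conjI ballI assms(2) Cinf_on_imp_smooth_on)
  fix c d z assume c: "c \<in> atlas M" and d: "d \<in> atlas M'" and "z \<in> local_dom c d F"
  then obtain p where p: "p \<in> fst c" "F p \<in> fst d" "z = snd c p" unfolding local_dom_def by auto
  then obtain U h where U: "open U" "z \<in> U" "Cinf_on U h"
    "\<And>q. \<lbrakk>q\<in>fst c; F q \<in> fst d; snd c q \<in> U\<rbrakk> \<Longrightarrow> h (snd c q) = snd d (F q)"
    using assms(3)[OF c d] by metis
  have "h y = local_rep c d F y" if "y \<in> local_dom c d F \<inter> U" for y
    using that U(4) chart_inv_chart[OF assms(1) c] by (auto simp: local_dom_def local_rep_def)
  then show "\<exists>U h. open U \<and> z \<in> U \<and> Cinf_on U h \<and> (\<forall>y\<in>local_dom c d F \<inter> U. h y = local_rep c d F y)"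
    using U by blast
qed

lemma local_ext_deriv_within:
  assumes "smooth_manifold H M" "solid H" "c \<in> charts_at M p" "local_ext c d F p U h"
    "g differentiable (at (snd c p))" "\<And>q. q \<in> fst c \<Longrightarrow> snd c q \<in> U \<Longrightarrow> k (snd c q) = g (snd c q)"
  shows "frechet_derivative k (at (snd c p) within local_dom c d F) = fderiv g (snd c p)"
proof (rule within_deriv_eq[OF assms(2) chart_image_openin[OF assms(1)]])
  show "local_dom c d F \<inter> U = snd c ` fst c \<inter> U"
    using assms(4) unfolding local_dom_def local_ext_def by auto
qed (use assms local_extD(1,2)[OF assms(4)] in \<open>auto simp: charts_at_def\<close>)

lemma local_deriv_eq:
  assumes "smooth_manifold H M" "solid H" "c \<in> charts_at M p" "local_ext c d F p U h"
  shows "local_deriv c d F p = fderiv h (snd c p)"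
  unfolding local_deriv_def
proof (rule local_ext_deriv_within[OF assms])
  show "h differentiable (at (snd c p))"
    using local_extD[OF assms(4)] Cinf_on_differentiable by blast
  show "local_rep c d F (snd c q) = h (snd c q)" if "q \<in> fst c" "snd c q \<in> U" for q
    using that local_extD(5)[OF assms(4)] chart_inv_chart[OF assms(1) conjunct1[OF charts_atD[OF assms(3)]]]
    by (simp add: local_rep_def)
qed

lemma local_deriv_linear:
  assumes "smooth_manifold H M" "solid H" "smooth_manifold H' M'" "smooth_map M M' F"
    "c \<in> charts_at M p" "d \<in> charts_at M' (F p)"
  shows "linear (local_deriv c d F p)"
proof -
  obtain U h where U: "local_ext c d F p U h"
    using smooth_map_local_ext_ex[OF assms(1,3-6)] by blast
  show ?thesis unfolding local_deriv_eq[OF assms(1,2,5) U]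
    using local_extD[OF U] Cinf_on_differentiable linear_frechet_derivative by blast
qed

lemma local_deriv_chain:
  assumes "smooth_manifold H M" "solid H" "smooth_manifold H' M'" "solid H'" "smooth_manifold H'' M''"
    "smooth_map M M' F" "smooth_map M' M'' G"
    "c \<in> charts_at M p" "d \<in> charts_at M' (F p)" "e \<in> charts_at M'' (G (F p))"
  shows "local_deriv c e (\<lambda>x. G (F x)) p v = local_deriv d e G (F p) (local_deriv c d F p v)"
proof -
  obtain U h where U: "local_ext c d F p U h"
    using smooth_map_local_ext_ex[OF assms(1,3,6,8,9)] by blast
  obtain U' h' where U': "local_ext d e G (F p) U' h'"
    using smooth_map_local_ext_ex[OF assms(3,5,7,9,10)] by blast
  have p: "p \<in> fst c" using charts_atD[OF assms(8)] by blast
  have e: "h (snd c p) = snd d (F p)" using local_extD(2,5)[OF U] p by blast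
  have d: "h differentiable (at (snd c p))" "h' differentiable (at (h (snd c p)))"
    using local_extD[OF U] local_extD[OF U'] Cinf_on_differentiable unfolding e by blast+
  show ?thesis
    unfolding local_deriv_eq[OF assms(1,2,8) U] local_deriv_eq[OF assms(3,4,9) U']
      local_deriv_eq[OF assms(1,2,8) local_ext_compose[OF U U' p]] e[symmetric]
    by (rule dd_compose[OF d(2,1)])
qed

lemma local_deriv_cong:
  assumes "\<And>q. q \<in> fst c \<Longrightarrow> F q = F' q" "smooth_manifold H M" "c \<in> charts_at M p" "F p \<in> fst d"
  shows "local_deriv c d F p = local_deriv c d F' p"
proof -
  have c: "c \<in> atlas M" "p \<in> fst c" using assms(3) by (auto simp: charts_at_def)
  have D: "local_dom c d F = local_dom c d F'" unfolding local_dom_def using assms(1) by force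
  have p: "snd c p \<in> local_dom c d F" using c assms(4) unfolding local_dom_def by auto
  have r: "local_rep c d F x = local_rep c d F' x" if "x \<in> local_dom c d F" for x
    using that assms(1) chart_inv_chart[OF assms(2) c(1)] unfolding local_rep_def local_dom_def by auto
  have "(local_rep c d F has_derivative f') (at (snd c p) within local_dom c d F) \<longleftrightarrow>
        (local_rep c d F' has_derivative f') (at (snd c p) within local_dom c d F)" for f'
    using has_derivative_transform[OF p, of "local_rep c d F" "local_rep c d F'"]
      has_derivative_transform[OF p, of "local_rep c d F'" "local_rep c d F"] r by metis
  then show ?thesis unfolding local_deriv_def D[symmetric] frechet_derivative_def by presburger
qed

lemma smooth_map_id: "smooth_manifold H M \<Longrightarrow> smooth_map M M id"
  unfolding smooth_map_def smooth_manifold_def using continuous_map_id[of "mtop M"] by (auto simp: id_def)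

lemma local_deriv_id_same:
  assumes "smooth_manifold H M" "solid H" "c \<in> charts_at M p"
  shows "local_deriv c c id p v = v"
proof -
  have "local_ext c c id p UNIV (\<lambda>x. x)" unfolding local_ext_def by (simp add: Cinf_on_ident)
  from local_deriv_eq[OF assms this] show ?thesis by simp
qed

lemma local_deriv_chart_change:
  assumes "smooth_manifold H M" "solid H" "smooth_manifold H' M'" "smooth_map M M' F"
    "c \<in> charts_at M p" "c' \<in> charts_at M p" "d \<in> charts_at M' (F p)"
  shows "local_deriv c d F p v = local_deriv c' d F p (local_deriv c c' id p v)"
  using local_deriv_chain[OF assms(1,2,1,2,3) smooth_map_id[OF assms(1)] assms(4,5), of c' d v] assms(6,7)
  by (simp only: id_apply)

section \<open>Tangent vectors, differentials and composition of smooth maps\<close>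

lemma coord_vec_tangent:
  assumes "smooth_manifold H M" "solid H" "c \<in> charts_at M p"
  shows "coord_vec M c p a \<in> tangent_space M p" "coord_vec M c p a c = a"
proof -
  show "coord_vec M c p a c = a"
    unfolding coord_vec_def using local_deriv_id_same[OF assms] assms(3) by simp
  show "coord_vec M c p a \<in> tangent_space M p"
    unfolding tangent_space_def
  proof (intro CollectI conjI ballI allI impI)
    fix d e assume de: "d \<in> charts_at M p" "e \<in> charts_at M p"
    show "coord_vec M c p a e = local_deriv d e id p (coord_vec M c p a d)"
      using local_deriv_chart_change[OF assms(1,2,1) smooth_map_id[OF assms(1)] assms(3) de(1), of e a] de
      by (simp only: coord_vec_def if_True id_apply)
  qed (simp add: coord_vec_def)
qed

text \<open>The chart chosen by \<open>SOME\<close> is immaterial: the coordinates of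
  \<open>v\<close> change by the derivative of the coordinate change, which the chain rule
  absorbs.\<close>

lemma differential_eq:
  assumes "smooth_manifold H M" "solid H" "smooth_manifold H' M'" "smooth_map M M' F"
    "c \<in> charts_at M p" "d \<in> charts_at M' (F p)" "v \<in> tangent_space M p"
  shows "differential M M' F p v d = local_deriv c d F p (v c)"
proof -
  let ?c = "SOME c. c \<in> charts_at M p"
  have c: "?c \<in> charts_at M p" using assms(5) by (metis someI)
  have "v ?c = local_deriv c ?c id p (v c)"
    using assms(5,7) c unfolding tangent_space_def by blast
  then show ?thesis
    unfolding differential_def Let_def local_deriv_chart_change[OF assms(1-5) c assms(6), of "v c"]
    using assms(6) by (simp only: if_True)
qed

lemma smooth_map_points: "smooth_map M M' F \<Longrightarrow> p \<in> points M \<Longrightarrow> F p \<in> points M'"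
  unfolding smooth_map_def continuous_map_def by blast

lemma differential_tangent:
  assumes "smooth_manifold H M" "solid H" "smooth_manifold H' M'" "solid H'" "smooth_map M M' F"
    "p \<in> points M" "v \<in> tangent_space M p"
  shows "differential M M' F p v \<in> tangent_space M' (F p)"
proof -
  obtain c where c: "c \<in> charts_at M p" using charts_at_nonempty[OF assms(1,6)] by blast
  have "differential M M' F p v d' = local_deriv d d' id (F p) (differential M M' F p v d)"
    if "d \<in> charts_at M' (F p)" "d' \<in> charts_at M' (F p)" for d d'
    unfolding differential_eq[OF assms(1-3,5) c that(1) assms(7)] differential_eq[OF assms(1-3,5) c that(2) assms(7)]
    using local_deriv_chain[OF assms(1-4,3) assms(5) smooth_map_id[OF assms(3)] c that(1), of d' "v c"] that(2)
    by (simp only: id_apply)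
  moreover have "differential M M' F p v d = 0" if "d \<notin> charts_at M' (F p)" for d
    using that by (simp add: differential_def)
  ultimately show ?thesis unfolding tangent_space_def by blast
qed

lemma smooth_map_compose:
  assumes "smooth_manifold H M" "smooth_manifold H' M'" "smooth_manifold H'' M''"
    "smooth_map M M' F" "smooth_map M' M'' G"
  shows "smooth_map M M'' (\<lambda>x. G (F x))"
proof (rule smooth_mapI[OF assms(1)])
  show "continuous_map (mtop M) (mtop M'') (\<lambda>x. G (F x))"
    using continuous_map_compose[of "mtop M" "mtop M'" F "mtop M''" G] assms(4,5)
    unfolding smooth_map_def by (simp add: o_def)
  fix c e p assume *: "c \<in> atlas M" "e \<in> atlas M''" "p \<in> fst c" "G (F p) \<in> fst e"
  then have c: "c \<in> charts_at M p" and e: "e \<in> charts_at M'' (G (F p))" by (auto simp: charts_at_def)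
  then obtain d where d: "d \<in> charts_at M' (F p)"
    using charts_at_nonempty[OF assms(2) smooth_map_points[OF assms(4) charts_at_points[OF assms(1) c]]] by blast
  obtain U h where U: "local_ext c d F p U h"
    using smooth_map_local_ext_ex[OF assms(1,2,4) c d] by blast
  obtain U' h' where U': "local_ext d e G (F p) U' h'"
    using smooth_map_local_ext_ex[OF assms(2,3,5) d e] by blast
  from local_extD[OF local_ext_compose[OF U U' *(3)]]
  show "\<exists>U h. open U \<and> snd c p \<in> U \<and> Cinf_on U h \<and>
        (\<forall>q\<in>fst c. G (F q) \<in> fst e \<longrightarrow> snd c q \<in> U \<longrightarrow> h (snd c q) = snd e (G (F q)))"
    by blast
qed

lemma smooth_map_cong:
  assumes "smooth_manifold H M" "smooth_manifold H' M'" "smooth_map M M' F" "\<And>x. x \<in> points M \<Longrightarrow> F x = F' x"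
  shows "smooth_map M M' F'"
proof (rule smooth_mapI[OF assms(1)])
  show "continuous_map (mtop M) (mtop M') F'"
    using assms(3,4) continuous_map_eq unfolding smooth_map_def by blast
  fix c d p assume *: "c \<in> atlas M" "d \<in> atlas M'" "p \<in> fst c" "F' p \<in> fst d"
  then have e: "F q = F' q" if "q \<in> fst c" for q using assms(4) chart_subset[OF assms(1) *(1)] that by blast
  have "c \<in> charts_at M p" "d \<in> charts_at M' (F p)" using * e by (auto simp: charts_at_def)
  then obtain U h where "local_ext c d F p U h"
    using smooth_map_local_ext_ex[OF assms(1,2,3)] by blast
  from local_extD[OF this] e
  show "\<exists>U h. open U \<and> snd c p \<in> U \<and> Cinf_on U h \<and>
        (\<forall>q\<in>fst c. F' q \<in> fst d \<longrightarrow> snd c q \<in> U \<longrightarrow> h (snd c q) = snd d (F' q))"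
    by metis
qed

section \<open>The Levi-Civita connection and the tension field\<close>

lemma bilinear_eq_sum_Basis:
  fixes f :: "'n::euclidean_space \<Rightarrow> 'n \<Rightarrow> 'f::real_vector"
  assumes "bilinear f"
  shows "f u w = (\<Sum>p\<in>Basis. \<Sum>q\<in>Basis. ((u \<bullet> p) * (w \<bullet> q)) *\<^sub>R f p q)"
proof -
  have l: "linear (\<lambda>x. f x w)" "linear (f p)" for p using assms by (auto simp: bilinear_def)
  have "f u w = (\<Sum>p\<in>Basis. (u \<bullet> p) *\<^sub>R f p w)" by (rule linear_eq_sum_Basis[OF l(1)])
  also have "\<dots> = (\<Sum>p\<in>Basis. (u \<bullet> p) *\<^sub>R (\<Sum>q\<in>Basis. (w \<bullet> q) *\<^sub>R f p q))"
    using linear_eq_sum_Basis[OF l(2)] by metis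
  finally show ?thesis by (simp add: scaleR_sum_right)
qed

lemma linear_realI:
  fixes f :: "'a::real_vector \<Rightarrow> real"
  shows "(\<And>x y. f (x + y) = f x + f y) \<Longrightarrow> (\<And>r x. f (r *\<^sub>R x) = r * f x) \<Longrightarrow> linear f"
  by (rule linearI) auto

text \<open>The linear algebra of the Levi-Civita connection at a single point: \<open>m\<close> is
  the metric there and \<open>dg u a b\<close> the derivative along \<open>u\<close> of its
  coefficient \<open>m a b\<close>.\<close>

locale koszul =
  fixes m :: "'n::euclidean_space \<Rightarrow> 'n \<Rightarrow> real" and dg :: "'n \<Rightarrow> 'n \<Rightarrow> 'n \<Rightarrow> real"
  assumes m: "bilinear m" and msym: "\<And>a b. m a b = m b a" and mpos: "\<And>a. a \<noteq> 0 \<Longrightarrow> m a a > 0"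
    and dg_lin: "\<And>a b. linear (\<lambda>u. dg u a b)" and dg_bilin: "\<And>u. bilinear (dg u)"
    and dg_sym: "\<And>u a b. dg u a b = dg u b a"
begin

lemma m_lin: "linear (m a)" "linear (\<lambda>x. m x b)"
  using m by (auto simp: bilinear_def)

lemma nondegenerate:
  assumes "\<And>b. b \<in> Basis \<Longrightarrow> m a b = 0" shows "a = 0"
proof (rule ccontr)
  assume "a \<noteq> 0"
  have "m a a = (\<Sum>b\<in>Basis. (a \<bullet> b) *\<^sub>R m a b)" by (rule linear_eq_sum_Basis[OF m_lin(1)])
  also have "\<dots> = 0" using assms by simp
  finally show False using mpos[OF \<open>a \<noteq> 0\<close>] by simp
qed

lemma m_eqI: "(\<And>b. m x b = m y b) \<Longrightarrow> x = y"
  using nondegenerate[of "x - y"] linear_diff[OF m_lin(2)] by simp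

text \<open>The form \<open>m\<close> need not be the inner product of the type. The map
  \<open>T\<close> expresses it through that inner product; it is injective by nondegeneracy, hence
  onto in finite dimension.\<close>

lemma riesz:
  assumes "linear l" shows "\<exists>w. \<forall>b. m w b = l b"
proof -
  define T where "T w = (\<Sum>b\<in>Basis. m w b *\<^sub>R b)" for w
  have T: "T w \<bullet> b = m w b" if "b \<in> Basis" for w b
    unfolding T_def using that by (simp add: inner_sum_left_Basis)
  have "linear T"
    unfolding T_def
    by (rule linearI) (simp_all add: linear_add[OF m_lin(2)] linear_scale[OF m_lin(2)]
        scaleR_left_distrib sum.distrib scaleR_sum_right)
  moreover have "inj T"
  proof (rule injI)
    fix x y assume "T x = T y"
    then have "m (x - y) b = 0" if "b \<in> Basis" for b
      using T[OF that] by (simp add: linear_diff[OF m_lin(2)]) (metis T that)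
    then show "x = y" using nondegenerate[of "x - y"] by simp
  qed
  ultimately have "surj T" by (rule linear_inj_imp_surj)
  then obtain w where w: "T w = (\<Sum>b\<in>Basis. l b *\<^sub>R b)" by (metis surjD)
  have "m w b = l b" if "b \<in> Basis" for b
    using T[OF that, of w] that unfolding w by (simp add: inner_sum_left_Basis)
  then have "m w b = l b" for b
    unfolding linear_eq_sum_Basis[OF m_lin(1), of w b] linear_eq_sum_Basis[OF assms, of b] by simp
  then show ?thesis by blast
qed

text \<open>The right-hand side of the Koszul formula; there are no bracket terms because fields
  with constant coordinates commute.\<close>

definition K where "K u a b = (dg u a b + dg a u b - dg b u a) / 2"

abbreviation is_conn where
  "is_conn \<Gamma> \<equiv> bilinear \<Gamma> \<and> (\<forall>u a. \<Gamma> u a = \<Gamma> a u) \<and>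
     (\<forall>u a b. dg u a b = m (\<Gamma> u a) b + m a (\<Gamma> u b))"

text \<open>Add the compatibility equations for \<open>u a b\<close> and \<open>a u b\<close> and
  subtract the one for \<open>b u a\<close>. By the symmetry of \<Gamma> and of the metric
  everything cancels except twice the left-hand side.\<close>

lemma koszul_formula:
  assumes "is_conn \<Gamma>" shows "m (\<Gamma> u a) b = K u a b"
proof -
  have s: "\<Gamma> a u = \<Gamma> u a" "\<Gamma> b u = \<Gamma> u b" "\<Gamma> b a = \<Gamma> a b" using assms by blast+
  have "dg u a b = m (\<Gamma> u a) b + m a (\<Gamma> u b)" "dg a u b = m (\<Gamma> a u) b + m u (\<Gamma> a b)"
    "dg b u a = m (\<Gamma> b u) a + m u (\<Gamma> b a)" using assms by blast+
  then show ?thesis unfolding K_def s using msym[of a "\<Gamma> u b"] by simp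
qed

lemma dg_lins: "linear (\<lambda>a. dg u a b)" "linear (\<lambda>b. dg u a b)"
  using dg_bilin[of u] by (auto simp: bilinear_def)

lemma K_linear: "linear (\<lambda>b. K u a b)" "linear (\<lambda>a. K u a b)" "linear (\<lambda>u. K u a b)"
  unfolding K_def
  by (rule linear_realI; simp add: linear_add[OF dg_lins(1)] linear_add[OF dg_lins(2)] linear_add[OF dg_lin]
      linear_scale[OF dg_lins(1)] linear_scale[OF dg_lins(2)] linear_scale[OF dg_lin] field_simps)+

lemma connection_exists: "\<exists>\<Gamma>. is_conn \<Gamma>"
proof -
  \<comment> \<open>The Koszul formula is turned into a definition: \<open>K u a\<close> is a linear
    functional, so it is represented by a vector.\<close>
  define \<Gamma> where "\<Gamma> u a = (SOME w. \<forall>b. m w b = K u a b)" for u a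
  have \<Gamma>: "m (\<Gamma> u a) b = K u a b" for u a b
    unfolding \<Gamma>_def using someI_ex[OF riesz[OF K_linear(1)]] by blast
  have sym: "\<Gamma> u a = \<Gamma> a u" for u a
    by (rule m_eqI) (simp add: \<Gamma> K_def dg_sym[of _ u a])
  have l: "linear (\<Gamma> u)" for u
    by (rule linearI; rule m_eqI)
      (simp_all add: \<Gamma> linear_add[OF m_lin(2)] linear_scale[OF m_lin(2)] linear_add[OF K_linear(2)] linear_scale[OF K_linear(2)])
  then have "linear (\<lambda>u. \<Gamma> u a)" for a using sym[of _ a] by simp
  moreover have "dg u a b = m (\<Gamma> u a) b + m a (\<Gamma> u b)" for u a b
    unfolding msym[of a] \<Gamma> K_def using dg_sym[of u a b] dg_sym[of a b u] dg_sym[of b u a] by (simp add: field_simps)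
  ultimately show ?thesis using l sym by (auto simp: bilinear_def intro!: exI[of _ \<Gamma>])
qed

lemma connection_unique:
  assumes "is_conn \<Gamma>" "is_conn \<Gamma>'" shows "\<Gamma> = \<Gamma>'"
  by (intro ext m_eqI) (simp only: koszul_formula[OF assms(1)] koszul_formula[OF assms(2)])

lemma the_connection: "is_conn (THE \<Gamma>. is_conn \<Gamma>)"
proof -
  have "\<exists>!\<Gamma>. is_conn \<Gamma>"
    by (rule ex_ex1I[OF connection_exists connection_unique])
  then show ?thesis by (rule theI')
qed

end

section \<open>Christoffel symbols and tension in a chart of the target\<close>

abbreviation chart_range :: "('q, 'n) chart \<Rightarrow> 'n set" where
  "chart_range d \<equiv> snd d ` fst d"

text \<open>The Christoffel symbols of the first kind, built from derivatives of the metric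
  alone.\<close>

definition christoffel_low ::
  "('q, 'n::euclidean_space) manifold \<Rightarrow> ('q, 'n) metric \<Rightarrow> ('q, 'n) chart \<Rightarrow> 'n \<Rightarrow> 'n \<Rightarrow> 'n \<Rightarrow> 'n \<Rightarrow> real" where
  "christoffel_low N g d y p q b =
     (dd p (\<lambda>y. metric_coord N g d y q b) y + dd q (\<lambda>y. metric_coord N g d y p b) y
      - dd b (\<lambda>y. metric_coord N g d y p q) y) / 2"

text \<open>The tension field with respect to the flat metric of a holomorphic coordinate. Another
  metric of the conformal class multiplies it by a positive function, so its zeros do not depend on
  that choice.\<close>

definition tension :: "('n \<Rightarrow> 'n \<Rightarrow> 'n \<Rightarrow> 'n) \<Rightarrow> (complex \<Rightarrow> 'n::euclidean_space) \<Rightarrow> complex \<Rightarrow> 'n" where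
  "tension \<Gamma> F x = laplace F x + \<Gamma> (F x) (dd 1 F x) (dd 1 F x) + \<Gamma> (F x) (dd \<i> F x) (dd \<i> F x)"

abbreviation low_tension where
  "low_tension N g d \<equiv> lowered_tension (metric_coord N g d) (christoffel_low N g d)"

context
  fixes N :: "('q, 'n::euclidean_space) manifold" and g :: "('q, 'n) metric" and d :: "('q, 'n) chart"
  assumes N: "smooth_manifold UNIV N" and g: "riemannian_metric N g" and d: "d \<in> atlas N"
begin

lemma chart_range_open: "open (chart_range d)"
  using chart_image_openin[OF N d] by simp

lemma metric_coord_props:
  assumes "y \<in> chart_range d"
  shows "bilinear (metric_coord N g d y)" "metric_coord N g d y a b = metric_coord N g d y b a"
    "a \<noteq> 0 \<Longrightarrow> metric_coord N g d y a a > 0"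
  using g d assms unfolding riemannian_metric_def by blast+

lemma metric_coord_Cinf: "Cinf_on (chart_range d) (\<lambda>y. metric_coord N g d y a b)"
proof -
  have "smooth_on (chart_range d) (\<lambda>y. metric_coord N g d y a b)"
    using g d unfolding riemannian_metric_def by blast
  then show ?thesis by (rule smooth_on_open_imp_Cinf_on[OF chart_range_open])
qed

lemma christoffel_low_Cinf: "Cinf_on (chart_range d) (\<lambda>y. christoffel_low N g d y p q b)"
  unfolding christoffel_low_def divide_inverse
  by (intro Cinf_on_mult Cinf_on_diff Cinf_on_add Cinf_on_dd metric_coord_Cinf chart_range_open Cinf_on_const)

text \<open>Bilinearity and symmetry of the metric hold at every point of an open set, so they can
  be differentiated.\<close>

lemma metric_koszul:
  assumes y: "y \<in> chart_range d"
  shows "koszul (metric_coord N g d y) (\<lambda>u a b. fderiv (\<lambda>y. metric_coord N g d y a b) y u)"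
proof -
  let ?G = "metric_coord N g d"
  have diff: "(\<lambda>y. ?G y a b) differentiable (at y)" for a b
    using Cinf_on_differentiable[OF metric_coord_Cinf chart_range_open y] .
  have l: "linear (?G y a)" "linear (\<lambda>x. ?G y x b)" if "y \<in> chart_range d" for y a b
    using metric_coord_props(1)[OF that] by (auto simp: bilinear_def)
  note cong = fun_cong[OF dd_cong[OF chart_range_open _ y]]
  have sc: "dd u (\<lambda>y. r * ?G y a b) y = r * dd u (\<lambda>y. ?G y a b) y" for u r a b
    by (rule bounded_linear.dd_compose[OF bounded_linear_mult_right diff])
  have sym: "dd u (\<lambda>y. ?G y a b) y = dd u (\<lambda>y. ?G y b a) y" for u a b
    by (rule cong) (rule metric_coord_props(2))
  have 1: "linear (\<lambda>a. dd u (\<lambda>y. ?G y a b) y)" for u b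
  proof (rule linear_realI)
    show "dd u (\<lambda>y. ?G y (a + a') b) y = dd u (\<lambda>y. ?G y a b) y + dd u (\<lambda>y. ?G y a' b) y" for a a'
      unfolding dd_add[OF diff diff, symmetric] by (rule cong) (simp add: linear_add[OF l(2)])
    show "dd u (\<lambda>y. ?G y (r *\<^sub>R a) b) y = r * dd u (\<lambda>y. ?G y a b) y" for r a
      unfolding sc[symmetric] by (rule cong) (simp add: linear_scale[OF l(2)])
  qed
  have bi: "bilinear (\<lambda>a b. dd u (\<lambda>y. ?G y a b) y)" for u
  proof -
    have "linear (\<lambda>b. dd u (\<lambda>y. ?G y a b) y)" for a
      unfolding sym[where a=a] by (rule 1)
    with 1 show ?thesis unfolding bilinear_def by blast
  qed
  have lu: "linear (\<lambda>u. dd u (\<lambda>y. ?G y a b) y)" for a b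
    using linear_frechet_derivative[OF diff] .
  show ?thesis
    by (rule koszul.intro) (fact metric_coord_props[OF y] sym bi lu)+
qed

lemma christoffel_props:
  assumes y: "y \<in> chart_range d"
  shows "bilinear (christoffel N g d y)"
    and "metric_coord N g d y (christoffel N g d y u a) b =
         (\<Sum>p\<in>Basis. \<Sum>q\<in>Basis. (u \<bullet> p) * (a \<bullet> q) * christoffel_low N g d y p q b)"
proof -
  interpret koszul "metric_coord N g d y" "\<lambda>u a b. fderiv (\<lambda>y. metric_coord N g d y a b) y u"
    by (rule metric_koszul[OF y])
  have c: "is_conn (christoffel N g d y)"
    using the_connection unfolding christoffel_def .
  then show bi: "bilinear (christoffel N g d y)" by blast
  have "metric_coord N g d y (christoffel N g d y u a) b = K u a b" by (rule koszul_formula[OF c])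
  also have "\<dots> = (\<Sum>p\<in>Basis. \<Sum>q\<in>Basis. ((u \<bullet> p) * (a \<bullet> q)) *\<^sub>R K p q b)"
    by (rule bilinear_eq_sum_Basis) (simp add: bilinear_def K_linear)
  finally show "metric_coord N g d y (christoffel N g d y u a) b =
         (\<Sum>p\<in>Basis. \<Sum>q\<in>Basis. (u \<bullet> p) * (a \<bullet> q) * christoffel_low N g d y p q b)"
    by (simp add: K_def christoffel_low_def)
qed

lemma metric_nondegenerate:
  assumes "y \<in> chart_range d" "\<And>b. b \<in> Basis \<Longrightarrow> (\<Sum>p\<in>Basis. (a \<bullet> p) * metric_coord N g d y p b) = 0"
  shows "a = 0"
proof -
  interpret koszul "metric_coord N g d y" "\<lambda>u a b. fderiv (\<lambda>y. metric_coord N g d y a b) y u"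
    by (rule metric_koszul[OF assms(1)])
  show ?thesis
    using nondegenerate[of a] assms(2) linear_eq_sum_Basis[OF m_lin(2), of a] by simp
qed

lemma lowered_tension_eq:
  assumes "F x \<in> chart_range d"
  shows "metric_coord N g d (F x) (tension (christoffel N g d) F x) b =
    low_tension N g d F b x"
proof -
  interpret koszul "metric_coord N g d (F x)" "\<lambda>u a b. fderiv (\<lambda>y. metric_coord N g d y a b) (F x) u"
    by (rule metric_koszul[OF assms(1)])
  show ?thesis
    unfolding tension_def lowered_tension_def linear_add[OF m_lin(2)] christoffel_props(2)[OF assms]
    using linear_eq_sum_Basis[OF m_lin(2), of "laplace F x" b]
    by (simp add: sum.distrib distrib_right)
qed

lemma tension_zero_iff:
  assumes "F x \<in> chart_range d"
  shows "tension (christoffel N g d) F x = 0 \<longleftrightarrow>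
    (\<forall>b\<in>Basis. low_tension N g d F b x = 0)"
proof -
  interpret koszul "metric_coord N g d (F x)" "\<lambda>u a b. fderiv (\<lambda>y. metric_coord N g d y a b) (F x) u"
    by (rule metric_koszul[OF assms(1)])
  show ?thesis
    unfolding lowered_tension_eq[where F=F and x=x, OF assms, symmetric] using nondegenerate linear_0[OF m_lin(2)] by metis
qed

end

section \<open>Conformal invariance of the tension field\<close>

lemma dd_complex_split:
  fixes f :: "complex \<Rightarrow> 'f::euclidean_space"
  assumes "f differentiable (at x)"
  shows "fderiv f x w = Re w *\<^sub>R fderiv f x 1 + Im w *\<^sub>R fderiv f x \<i>"
  by (rule linear_complex_split[OF linear_frechet_derivative[OF assms]])

lemma second_dd_expand:
  fixes f :: "complex \<Rightarrow> 'f::euclidean_space"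
  assumes "open U" "Cinf_on U f" "x \<in> U"
  shows "dd u (dd w f) x = (Re u * Re w) *\<^sub>R dd 1 (dd 1 f) x + (Re u * Im w + Im u * Re w) *\<^sub>R dd 1 (dd \<i> f) x
     + (Im u * Im w) *\<^sub>R dd \<i> (dd \<i> f) x"
proof -
  have d: "dd w f differentiable (at x)" for w
    using Cinf_on_differentiable[OF Cinf_on_dd[OF assms(2)] assms(1,3)] .
  have c: "dd 1 (dd w f) x = dd w (dd 1 f) x" "dd \<i> (dd w f) x = dd w (dd \<i> f) x"
    by (rule dd_commute[OF assms])+
  show ?thesis
    unfolding dd_complex_split[OF d[of w], of u] c dd_complex_split[OF d[of 1], of w] dd_complex_split[OF d[of \<i>], of w]
      dd_commute[OF assms, of \<i> 1]
    by (simp add: algebra_simps)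
qed

text \<open>Let \<mu> be the derivative of \<open>J\<close> at \<open>x\<close>. The composite has
  as its derivatives along 1 and \<i> those of \<open>f\<close> along \<mu> and
  \<open>\<i> * \<mu>\<close>, two orthogonal vectors of equal length. So traces of quadratic terms
  scale by the square of that length, and the terms with second derivatives of \<open>J\<close>
  cancel.\<close>

lemma tension_conformal:
  fixes f :: "complex \<Rightarrow> 'n::euclidean_space" and J :: "complex \<Rightarrow> complex"
  assumes U: "open U" "Cinf_on U J" and W: "open W" "Cinf_on W f" "J ` U \<subseteq> W"
    and holo: "\<And>y. y \<in> U \<Longrightarrow> dd \<i> J y = \<i> * dd 1 J y" and x: "x \<in> U"
    and \<Gamma>: "bilinear (\<Gamma> (f (J x)))"
  shows "tension \<Gamma> (\<lambda>x. f (J x)) x = (norm (dd 1 J x))\<^sup>2 *\<^sub>R tension \<Gamma> f (J x)"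
proof -
  define \<mu> where "\<mu> = dd 1 J x"
  have dJ: "J differentiable (at y)" "dd v J differentiable (at y)" if "y \<in> U" for y v
    using that U by (auto intro: Cinf_on_differentiable Cinf_on_dd)
  have df: "f differentiable (at (J y))" "dd v f differentiable (at (J y))" if "y \<in> U" for y v
    using that W by (auto intro!: Cinf_on_differentiable Cinf_on_dd)
  have d1: "dd v (\<lambda>x. f (J x)) y = dd (dd v J y) f (J y)" if "y \<in> U" for y v
    by (rule dd_compose[OF df(1) dJ(1)]) (use that in auto)
  \<comment> \<open>The Hessian of \<open>f\<close> along \<open>dd v J\<close>, plus the derivative
    of \<open>f\<close> applied to the second derivative of \<open>J\<close>. The varying direction
    is split into real and imaginary parts, so that only derivatives of \<open>f\<close> in fixed
    directions are differentiated.\<close>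
  have d2: "dd v (dd v (\<lambda>x. f (J x))) x = dd (dd v J x) (dd (dd v J x) f) (J x) + dd (dd v (dd v J) x) f (J x)" for v
  proof -
    let ?j = "dd v J"
    have e: "dd v (\<lambda>x. f (J x)) y = Re (?j y) *\<^sub>R dd 1 f (J y) + Im (?j y) *\<^sub>R dd \<i> f (J y)" if "y \<in> U" for y
      unfolding d1[OF that] by (rule dd_complex_split[OF df(1)[OF that]])
    have "dd v (dd v (\<lambda>x. f (J x))) x = dd v (\<lambda>y. Re (?j y) *\<^sub>R dd 1 f (J y) + Im (?j y) *\<^sub>R dd \<i> f (J y)) x"
      by (rule fun_cong[OF dd_cong[OF U(1) e x]])
    also have "\<dots> = (Re (?j x) *\<^sub>R dd (?j x) (dd 1 f) (J x) + Re (dd v ?j x) *\<^sub>R dd 1 f (J x)) +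
       (Im (?j x) *\<^sub>R dd (?j x) (dd \<i> f) (J x) + Im (dd v ?j x) *\<^sub>R dd \<i> f (J x))"
    proof -
      have c: "((\<lambda>y. dd w f (J y)) has_derivative (\<lambda>v. fderiv (dd w f) (J x) (fderiv J x v))) (at x)" for w
        by (rule has_derivative_compose[OF has_derivative_dd[OF dJ(1)[OF x]] has_derivative_dd[OF df(2)[OF x]]])
      note j = has_derivative_dd[OF dJ(2)[OF x, of v]]
      have "((\<lambda>y. Re (?j y) *\<^sub>R dd 1 f (J y) + Im (?j y) *\<^sub>R dd \<i> f (J y)) has_derivative
        (\<lambda>w. (Re (?j x) *\<^sub>R fderiv (dd 1 f) (J x) (fderiv J x w) + Re (fderiv ?j x w) *\<^sub>R dd 1 f (J x)) +
        (Im (?j x) *\<^sub>R fderiv (dd \<i> f) (J x) (fderiv J x w) + Im (fderiv ?j x w) *\<^sub>R dd \<i> f (J x)))) (at x)"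
        by (intro has_derivative_add has_derivative_scaleR bounded_linear.has_derivative[OF bounded_linear_Re]
            bounded_linear.has_derivative[OF bounded_linear_Im] j c)
      from dd_eqI[OF this, of v] show ?thesis .
    qed
    also have "\<dots> = (Re (?j x) *\<^sub>R dd (?j x) (dd 1 f) (J x) + Im (?j x) *\<^sub>R dd (?j x) (dd \<i> f) (J x)) + dd (dd v ?j x) f (J x)"
      unfolding dd_complex_split[OF df(1)[OF x], of "dd v ?j x"] by simp
    also have "Re (?j x) *\<^sub>R dd (?j x) (dd 1 f) (J x) + Im (?j x) *\<^sub>R dd (?j x) (dd \<i> f) (J x) = dd (?j x) (dd (?j x) f) (J x)"
    proof -
      have Jx: "J x \<in> W" using W x by auto
      show ?thesis
        unfolding dd_commute[OF W(1,2) Jx, of 1 "?j x"] dd_commute[OF W(1,2) Jx, of \<i> "?j x"]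
        by (rule dd_complex_split[OF df(2)[OF x], symmetric])
    qed
    finally show ?thesis .
  qed
  \<comment> \<open>Cauchy-Riemann used twice: \<open>J\<close> is harmonic, so its second
    derivatives drop out of the Laplacian of the composite.\<close>
  have "dd \<i> (dd \<i> J) x = dd \<i> (\<lambda>y. \<i> * dd 1 J y) x"
    by (rule fun_cong[OF dd_cong[OF U(1) _ x]]) (simp add: holo)
  also have "\<dots> = \<i> * dd \<i> (dd 1 J) x"
    by (rule bounded_linear.dd_compose[OF bounded_linear_mult_right dJ(2)[OF x]])
  also have "dd \<i> (dd 1 J) x = dd 1 (dd \<i> J) x" by (rule dd_commute[OF U x])
  also have "\<dots> = dd 1 (\<lambda>y. \<i> * dd 1 J y) x"
    by (rule fun_cong[OF dd_cong[OF U(1) _ x]]) (simp add: holo)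
  also have "\<dots> = \<i> * dd 1 (dd 1 J) x"
    by (rule bounded_linear.dd_compose[OF bounded_linear_mult_right dJ(2)[OF x]])
  finally have ii: "dd \<i> (dd \<i> J) x = - dd 1 (dd 1 J) x" by (simp flip: mult.assoc)
  have Jx: "J x \<in> W" using W x by auto
  have n: "(norm \<mu>)\<^sup>2 = Re \<mu> * Re \<mu> + Im \<mu> * Im \<mu>"
    unfolding cmod_power2 by (simp add: power2_eq_square)
  have neg: "dd (- w) f (J x) = - dd w f (J x)" for w
    using linear_neg[OF linear_frechet_derivative[OF df(1)[OF x]]] .
  have lap: "laplace (\<lambda>x. f (J x)) x = (norm \<mu>)\<^sup>2 *\<^sub>R laplace f (J x)"
    unfolding laplace_def d2 ii neg holo[OF x] \<mu>_def[symmetric] n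
      second_dd_expand[OF W(1,2) Jx, of \<mu> \<mu>] second_dd_expand[OF W(1,2) Jx, of "\<i> * \<mu>" "\<i> * \<mu>"]
    by (simp add: algebra_simps)
  let ?G = "\<Gamma> (f (J x))"
  have split: "dd w f (J x) = Re w *\<^sub>R dd 1 f (J x) + Im w *\<^sub>R dd \<i> f (J x)" for w
    by (rule dd_complex_split[OF df(1)[OF x]])
  have "?G (dd \<mu> f (J x)) (dd \<mu> f (J x)) + ?G (dd (\<i> * \<mu>) f (J x)) (dd (\<i> * \<mu>) f (J x)) =
    (norm \<mu>)\<^sup>2 *\<^sub>R (?G (dd 1 f (J x)) (dd 1 f (J x)) + ?G (dd \<i> f (J x)) (dd \<i> f (J x)))"
    unfolding n split[of \<mu>] split[of "\<i> * \<mu>"]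
    by (simp add: bilinear_ladd[OF \<Gamma>] bilinear_radd[OF \<Gamma>] bilinear_lmul[OF \<Gamma>] bilinear_rmul[OF \<Gamma>]
        bilinear_lneg[OF \<Gamma>] bilinear_rneg[OF \<Gamma>] bilinear_lsub[OF \<Gamma>] bilinear_rsub[OF \<Gamma>] algebra_simps)
  then show ?thesis
    unfolding tension_def lap d1[OF x] holo[OF x] \<mu>_def[symmetric] by (simp add: scaleR_right_distrib add.assoc)
qed

lemma lowered_tension_conformal:
  fixes f :: "complex \<Rightarrow> 'n::euclidean_space" and J :: "complex \<Rightarrow> complex"
  assumes N: "smooth_manifold UNIV N" "riemannian_metric N g" "d \<in> atlas N"
    and U: "open U" "Cinf_on U J" and W: "open W" "Cinf_on W f" "J ` U \<subseteq> W"
    and holo: "\<And>y. y \<in> U \<Longrightarrow> dd \<i> J y = \<i> * dd 1 J y" and x: "x \<in> U"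
    and f: "f (J x) \<in> chart_range d"
  shows "low_tension N g d (\<lambda>x. f (J x)) b x =
    (norm (dd 1 J x))\<^sup>2 * low_tension N g d f b (J x)"
proof -
  have lin: "linear (\<lambda>a. metric_coord N g d (f (J x)) a b)"
    using metric_coord_props(1)[OF N f] by (auto simp: bilinear_def)
  have "tension (christoffel N g d) (\<lambda>x. f (J x)) x = (norm (dd 1 J x))\<^sup>2 *\<^sub>R tension (christoffel N g d) f (J x)"
    by (rule tension_conformal[OF U W]) (fact holo x christoffel_props(1)[OF N f])+
  then show ?thesis
    unfolding lowered_tension_eq[OF N, where F=f and x="J x", OF f, symmetric]
      lowered_tension_eq[OF N, where F="\<lambda>x. f (J x)" and x=x, OF f, symmetric]
    by (simp add: linear_scale[OF lin])
qed

section \<open>Harmonic maps and Cauchy data on Riemann surfaces\<close>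

lemma half_plane_interior_dense:
  assumes "open S" "z \<in> S" "z \<in> half_plane"
  shows "z \<in> closure (S \<inter> {w. 0 < Im w})"
proof (cases "0 < Im z")
  case True then show ?thesis using assms(2) by (simp add: closure_def)
next
  case False
  then have z: "Im z = 0" using assms(3) by (simp add: half_plane_def)
  show ?thesis unfolding closure_approachable
  proof (intro allI impI)
    fix e :: real assume "0 < e"
    obtain r where r: "r > 0" "ball z r \<subseteq> S" using assms openE by blast
    define t where "t = min e r / 2"
    have t: "0 < t" "t < e" "t < r" using \<open>0 < e\<close> r by (auto simp: t_def)
    have "dist (z + t *\<^sub>R \<i>) z = t" using t by (simp add: dist_norm)
    moreover have "z + t *\<^sub>R \<i> \<in> ball z r" using t by (simp add: dist_norm)
    ultimately show "\<exists>y\<in>S \<inter> {w. 0 < Im w}. dist y z < e"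
      using t r(2) z by (intro bexI[of _ "z + t *\<^sub>R \<i>"]) auto
  qed
qed

text \<open>Holomorphy is asked in the interior of the chart domain; at boundary points the
  Cauchy-Riemann equation follows by continuity of the derivative, see
  \<open>holomorphic_map_ext\<close>.\<close>

definition holomorphic_map ::
  "('a, complex) manifold \<Rightarrow> ('b, complex) manifold \<Rightarrow> ('a \<Rightarrow> 'b) \<Rightarrow> bool" where
  "holomorphic_map M M' F \<longleftrightarrow> smooth_map M M' F \<and>
     (\<forall>c\<in>atlas M. \<forall>d\<in>atlas M'. local_rep c d F holomorphic_on interior (local_dom c d F))"

lemma riemann_surface_smooth: "riemann_surface M \<Longrightarrow> smooth_manifold half_plane M"
  by (simp add: riemann_surface_def)

lemma holomorphic_map_id: "riemann_surface M \<Longrightarrow> holomorphic_map M M id"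
  using smooth_map_id[of half_plane M] unfolding holomorphic_map_def riemann_surface_def by blast

lemma holomorphic_embedding_map: "holomorphic_embedding M M' F \<Longrightarrow> holomorphic_map M M' F"
  unfolding holomorphic_embedding_def holomorphic_map_def smooth_embedding_def by blast

text \<open>The part of the chart image off the real axis. It is open in the plane, so holomorphy
  can be used on it, and it is dense in the image, so identities between smooth extensions pass from
  it to boundary points.\<close>

lemma chart_interior_open:
  assumes "smooth_manifold half_plane M" "c \<in> atlas M"
  obtains O' where "open O'" "O' \<subseteq> snd c ` fst c" "\<And>x. x \<in> O' \<Longrightarrow> 0 < Im x"
    "\<And>x. x \<in> snd c ` fst c \<Longrightarrow> 0 < Im x \<Longrightarrow> x \<in> O'"
    "\<And>x S. open S \<Longrightarrow> x \<in> S \<Longrightarrow> x \<in> snd c ` fst c \<Longrightarrow> x \<in> closure (S \<inter> O')"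
proof -
  obtain T where T: "open T" "snd c ` fst c = half_plane \<inter> T"
    using chart_image_openin[OF assms] by (auto simp: openin_open)
  let ?O = "T \<inter> {w. 0 < Im w}"
  have "open {w. 0 < Im w}" by (rule open_halfspace_Im_gt)
  then have o: "open ?O" using T(1) by blast
  have sub: "?O \<subseteq> snd c ` fst c" unfolding T(2) by (auto simp: half_plane_def)
  have cl: "x \<in> closure (S \<inter> ?O)" if "open S" "x \<in> S" "x \<in> snd c ` fst c" for x S
  proof -
    have "x \<in> closure ((S \<inter> T) \<inter> {w. 0 < Im w})"
      using that T by (intro half_plane_interior_dense) auto
    then show ?thesis by (simp add: Int_assoc)
  qed
  show thesis
    by (rule that[OF o sub _ _ cl]) (use T in auto)
qed

lemma holomorphic_map_ext_interior:
  assumes \<Sigma>: "smooth_manifold half_plane M" and F: "holomorphic_map M M' F"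
    and c: "c \<in> atlas M" and d: "d \<in> atlas M'" and U: "local_ext c d F p U h"
    and O': "open O'" "O' \<subseteq> snd c ` fst c" and x: "x \<in> U \<inter> O'"
  shows "fderiv h x (\<i> * v) = \<i> * fderiv h x v"
proof -
  note U' = local_extD[OF U]
  have o: "open (U \<inter> O')" using U'(1) O'(1) by blast
  have eq: "local_rep c d F y = h y" "y \<in> local_dom c d F" if y: "y \<in> U \<inter> O'" for y
  proof -
    obtain q where q: "q \<in> fst c" "y = snd c q" using y O'(2) by auto
    then show "local_rep c d F y = h y" "y \<in> local_dom c d F"
      using U'(4,5)[OF q(1)] y chart_inv_chart[OF \<Sigma> c q(1)] by (auto simp: local_rep_def local_dom_def)
  qed
  have "U \<inter> O' \<subseteq> interior (local_dom c d F)" using eq(2) o by (intro interior_maximal) auto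
  then have "local_rep c d F holomorphic_on (U \<inter> O')"
    using F c d holomorphic_on_subset unfolding holomorphic_map_def by blast
  then have "h holomorphic_on (U \<inter> O')" using eq(1) holomorphic_transform by metis
  then obtain D where "(h has_field_derivative D) (at x)"
    using o x holomorphic_on_imp_differentiable_at field_differentiable_def by blast
  then have "(h has_derivative (*) D) (at x)" by (simp add: has_field_derivative_def)
  then show ?thesis using dd_eqI by (metis mult.left_commute)
qed

text \<open>The smooth extension \<open>h\<close> need not be holomorphic beyond the chart image.
  Its derivative is still complex linear at points of the image, as a limit of such derivatives from
  the interior.\<close>

lemma holomorphic_map_ext:
  assumes \<Sigma>: "smooth_manifold half_plane M" and F: "holomorphic_map M M' F"
    and c: "c \<in> atlas M" and d: "d \<in> atlas M'" and U: "local_ext c d F p U h"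
    and q: "q \<in> fst c" "snd c q \<in> U"
  shows "fderiv h (snd c q) (\<i> * v) = \<i> * fderiv h (snd c q) v"
proof -
  obtain O' where O': "open O'" "O' \<subseteq> snd c ` fst c"
    "\<And>x S. open S \<Longrightarrow> x \<in> S \<Longrightarrow> x \<in> snd c ` fst c \<Longrightarrow> x \<in> closure (S \<inter> O')"
    using chart_interior_open[OF \<Sigma> c] by metis
  note U' = local_extD[OF U]
  have "flat_on 0 {snd c q} (\<lambda>x. dd (\<i> * v) h x - \<i> * dd v h x)"
  proof (rule flat_on_of_vanishing[OF U'(1), where O' = "U \<inter> O'"])
    show "Cinf_on U (\<lambda>x. dd (\<i> * v) h x - \<i> * dd v h x)"
      by (intro Cinf_on_diff Cinf_on_dd U' Cinf_on_bounded_linear[OF _ bounded_linear_mult_right])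
    show "{snd c q} \<subseteq> closure (U \<inter> O')" using O'(3)[OF U'(1) q(2)] q(1) by auto
    show "dd (\<i> * v) h x - \<i> * dd v h x = 0" if "x \<in> U \<inter> O'" for x
      using holomorphic_map_ext_interior[OF \<Sigma> F c d U O'(1,2) that] by simp
  qed (use q U' O' in auto)
  then show ?thesis by simp
qed

lemma local_deriv_ii:
  assumes "smooth_manifold half_plane M" "smooth_manifold half_plane M'" "holomorphic_map M M' F"
    "c \<in> charts_at M p" "d \<in> charts_at M' (F p)"
  shows "local_deriv c d F p (\<i> * v) = \<i> * local_deriv c d F p v"
    "local_deriv c d F p (- \<i> * v) = - \<i> * local_deriv c d F p v"
proof -
  have F: "smooth_map M M' F" using assms(3) by (simp add: holomorphic_map_def)
  obtain U h where U: "local_ext c d F p U h"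
    using smooth_map_local_ext_ex[OF assms(1,2) F assms(4,5)] by blast
  show 1: "local_deriv c d F p (\<i> * v) = \<i> * local_deriv c d F p v" for v
    unfolding local_deriv_eq[OF assms(1) solid_half_plane assms(4) U]
    by (rule holomorphic_map_ext[OF assms(1,3) _ _ U])
      (use assms(4,5) local_extD(2)[OF U] in \<open>auto simp: charts_at_def\<close>)
  show "local_deriv c d F p (- \<i> * v) = - \<i> * local_deriv c d F p v"
    using 1[of "- v"] linear_neg[OF local_deriv_linear[OF assms(1) solid_half_plane assms(2) F assms(4,5)]]
    by simp
qed

text \<open>Coordinate changes have complex linear derivatives, also at the boundary, so multiplying
  all coordinate vectors by \<open>- \<i>\<close> respects the transformation rule. This is what
  makes \<open>hodge_star\<close> meaningful on tangent vectors.\<close>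

lemma tangent_space_ii:
  assumes "riemann_surface M" "v \<in> tangent_space M p"
  shows "(\<lambda>c. - \<i> * v c) \<in> tangent_space M p"
  unfolding tangent_space_def
proof (intro CollectI conjI ballI allI impI)
  fix c d assume cd: "c \<in> charts_at M p" "d \<in> charts_at M p"
  then have v: "v d = local_deriv c d id p (v c)" using assms(2) unfolding tangent_space_def by blast
  note M = riemann_surface_smooth[OF assms(1)]
  show "- \<i> * v d = local_deriv c d id p (- \<i> * v c)"
    unfolding v by (rule local_deriv_ii(2)[OF M M holomorphic_map_id[OF assms(1)], symmetric]) (use cd in auto)
next
  fix c assume "c \<notin> charts_at M p"
  then have "v c = 0" using assms(2) unfolding tangent_space_def by blast
  then show "- \<i> * v c = 0" by simp
qed

lemma hodge_star_differential:
  assumes "riemann_surface M" "smooth_manifold H' N" "smooth_map M N \<phi>"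
    "v \<in> tangent_space M p" "c \<in> charts_at M p" "d \<in> charts_at N (\<phi> p)"
  shows "hodge_star (differential M N \<phi>) p v d = local_deriv c d \<phi> p (- \<i> * v c)"
  unfolding hodge_star_def
  by (rule differential_eq[OF riemann_surface_smooth[OF assms(1)] solid_half_plane assms(2,3,5,6)
        tangent_space_ii[OF assms(1,4)]])

section \<open>The harmonic map equation at a single point\<close>

definition harmonic_at ::
  "('a, complex) manifold \<Rightarrow> ('q, 'n::euclidean_space) manifold \<Rightarrow> ('q, 'n) metric \<Rightarrow> ('a \<Rightarrow> 'q) \<Rightarrow>
   ('a, complex) chart \<Rightarrow> ('q, 'n) chart \<Rightarrow> 'a \<Rightarrow> bool" where
  "harmonic_at M N g \<phi> c d p \<longleftrightarrow>
     (\<forall>u v. ext_cov_deriv M N g \<phi> (hodge_star (differential M N \<phi>)) c d (snd c p) u v = 0)"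

lemma harmonic_maps_iff:
  "\<phi> \<in> harmonic_maps M N g \<longleftrightarrow> \<phi> \<in> extensional (points M) \<and> smooth_map M N \<phi> \<and>
     (\<forall>p. \<forall>c\<in>charts_at M p. \<forall>d\<in>charts_at N (\<phi> p). harmonic_at M N g \<phi> c d p)"
  unfolding harmonic_maps_def harmonic_at_def local_dom_def charts_at_def by fast

text \<open>An exterior derivative is antisymmetric in \<open>u\<close> and \<open>v\<close>, so in
  the plane it is their determinant times its value on \<open>1\<close> and \<i>. The star turns
  \<open>v\<close> into \<open>- \<i> * v\<close>, which makes that value a trace, the tension; all
  mixed terms cancel.\<close>

lemma harmonic_at_iff_tension:
  assumes M: "riemann_surface M" and N: "smooth_manifold UNIV N" and g: "riemannian_metric N g"
    and \<phi>: "smooth_map M N \<phi>" and c: "c \<in> charts_at M p" and d: "d \<in> charts_at N (\<phi> p)"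
    and U: "local_ext c d \<phi> p U h"
  shows "harmonic_at M N g \<phi> c d p \<longleftrightarrow> tension (christoffel N g d) h (snd c p) = 0"
proof -
  note Ms = riemann_surface_smooth[OF M] and U' = local_extD[OF U]
  have cp: "c \<in> atlas M" "p \<in> fst c" and dp: "d \<in> atlas N" "\<phi> p \<in> fst d"
    using c d by (auto simp: charts_at_def)
  let ?z = "snd c p" let ?\<alpha> = "hodge_star (differential M N \<phi>)" let ?D = "local_dom c d \<phi>"
  have hz: "h ?z \<in> chart_range d" "local_rep c d \<phi> ?z = h ?z"
    using U'(5)[OF cp(2) U'(2)] dp chart_inv_chart[OF Ms cp] by (auto simp: local_rep_def)
  have dh: "h differentiable (at ?z)" "dd v h differentiable (at ?z)" for v
    using U' by (auto intro: Cinf_on_differentiable Cinf_on_dd)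
  have form: "form_coord M c d ?\<alpha> (snd c q) v = dd (- \<i> * v) h (snd c q)"
    if q: "q \<in> fst c" "snd c q \<in> U" for q v
  proof -
    have cq: "c \<in> charts_at M q" and dq: "d \<in> charts_at N (\<phi> q)"
      using q cp dp U'(4) by (auto simp: charts_at_def)
    show ?thesis
      unfolding form_coord_def chart_inv_chart[OF Ms cp(1) q(1)]
        hodge_star_differential[OF M N \<phi> coord_vec_tangent(1)[OF Ms solid_half_plane cq] cq dq]
        coord_vec_tangent(2)[OF Ms solid_half_plane cq]
        local_deriv_eq[OF Ms solid_half_plane cq local_ext_move[OF U q(2)]] ..
  qed
  have dform: "frechet_derivative (\<lambda>w. form_coord M c d ?\<alpha> w v) (at ?z within ?D) = fderiv (dd (- \<i> * v) h) ?z" for v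
    by (rule local_ext_deriv_within[OF Ms solid_half_plane c U dh(2)]) (rule form)
  have conn: "pullback_conn N g d ?D (local_rep c d \<phi>) (\<lambda>w. form_coord M c d ?\<alpha> w v) ?z u =
      dd u (dd (- \<i> * v) h) ?z + christoffel N g d (h ?z) (dd u h ?z) (dd (- \<i> * v) h ?z)" for u v
    unfolding pullback_conn_def hz(2) form[OF cp(2) U'(2)]
      local_deriv_eq[OF Ms solid_half_plane c U, unfolded local_deriv_def] dform ..
  define \<Gamma> where "\<Gamma> = christoffel N g d (h ?z)"
  have \<Gamma>: "bilinear \<Gamma>" unfolding \<Gamma>_def by (rule christoffel_props(1)[OF N g dp(1) hz(1)])
  have "ext_cov_deriv M N g \<phi> ?\<alpha> c d ?z u v = (Re u * Im v - Im u * Re v) *\<^sub>R tension (christoffel N g d) h ?z" for u v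
    unfolding ext_cov_deriv_def conn tension_def laplace_def \<Gamma>_def[symmetric]
      second_dd_expand[OF U'(1,3,2), where u=u and w="- \<i> * v"] second_dd_expand[OF U'(1,3,2), where u=v and w="- \<i> * u"]
      dd_complex_split[OF dh(1), of u] dd_complex_split[OF dh(1), of v]
      dd_complex_split[OF dh(1), of "- \<i> * u"] dd_complex_split[OF dh(1), of "- \<i> * v"]
    by (simp add: bilinear_ladd[OF \<Gamma>] bilinear_radd[OF \<Gamma>] bilinear_lmul[OF \<Gamma>] bilinear_rmul[OF \<Gamma>]
        bilinear_lneg[OF \<Gamma>] bilinear_rneg[OF \<Gamma>] bilinear_lsub[OF \<Gamma>] bilinear_rsub[OF \<Gamma>] algebra_simps)
  note E = this
  show ?thesis
  proof
    assume "harmonic_at M N g \<phi> c d p"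
    then show "tension (christoffel N g d) h ?z = 0"
      using E[of 1 \<i>] unfolding harmonic_at_def by simp
  qed (simp add: harmonic_at_def E)
qed

text \<open>In charts \<psi> is the composite of a representative of \<phi> with \<open>J\<close>,
  and the conformal factor is nonzero because the derivative of \<open>J\<close> is injective.
  Boundary points are included, so a map on the glued surface can be tested on one piece at a time,
  even on the seam.\<close>

lemma harmonic_at_pullback:
  assumes M: "riemann_surface M" and M': "riemann_surface M'"
    and N: "smooth_manifold UNIV N" and g: "riemannian_metric N g"
    and j: "holomorphic_map M M' j" and \<phi>: "smooth_map M' N \<phi>" and \<psi>: "smooth_map M N \<psi>"
    and eq: "\<And>x. x \<in> points M \<Longrightarrow> \<psi> x = \<phi> (j x)"
    and c: "c \<in> charts_at M x" and c': "c' \<in> charts_at M' (j x)" and d: "d \<in> charts_at N (\<psi> x)"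
    and inj: "inj (local_deriv c c' j x)"
  shows "harmonic_at M N g \<psi> c d x \<longleftrightarrow> harmonic_at M' N g \<phi> c' d (j x)"
proof -
  note Ms = riemann_surface_smooth[OF M] and Ms' = riemann_surface_smooth[OF M']
  have js: "smooth_map M M' j" using j by (simp add: holomorphic_map_def)
  have cx: "c \<in> atlas M" "x \<in> fst c" and dx: "d \<in> atlas N" "c' \<in> atlas M'"
    using c c' d by (auto simp: charts_at_def)
  have xM: "x \<in> points M" by (rule charts_at_points[OF Ms c])
  have d': "d \<in> charts_at N (\<phi> (j x))" using d eq[OF xM] by simp
  obtain U J where U: "local_ext c c' j x U J"
    using smooth_map_local_ext_ex[OF Ms Ms' js c c'] by blast
  obtain U' h where U': "local_ext c' d \<phi> (j x) U' h"
    using smooth_map_local_ext_ex[OF Ms' N \<phi> c' d'] by blast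
  have B: "open (chart_range d)" by (rule chart_range_open[OF N g dx(1)])
  have h': "h (snd c' (j x)) \<in> chart_range d"
    using local_extD(2)[OF U'] local_extD(4,5)[OF U', of "j x"] c' by (auto simp: charts_at_def)
  \<comment> \<open>The coefficients of the lowered equation live on the range of \<open>d\<close>,
    which the extension \<open>h\<close> may leave beyond the surface.\<close>
  define V where "V = U' \<inter> h -` chart_range d"
  have V: "local_ext c' d \<phi> (j x) V h"
    by (rule local_ext_subset[OF U'])
      (use continuous_open_preimage[OF Cinf_on_continuous[OF local_extD(3)[OF U']] local_extD(1)[OF U'] B] h'
        local_extD(2)[OF U'] in \<open>auto simp: V_def\<close>)
  define W where "W = U \<inter> J -` V"
  have W: "local_ext c d (\<lambda>x. \<phi> (j x)) x W (\<lambda>x. h (J x))"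
    unfolding W_def by (rule local_ext_compose[OF U V cx(2)])
  have W\<psi>: "local_ext c d \<psi> x W (\<lambda>x. h (J x))"
    by (rule local_ext_cong[OF W]) (use eq chart_subset[OF Ms cx(1)] in auto)
  note U1 = local_extD[OF U] and V1 = local_extD[OF V] and W1 = local_extD[OF W]
  let ?z = "snd c x"
  have Jz: "J ?z = snd c' (j x)" using U1(5)[OF cx(2) U1(2)] .
  let ?L = "low_tension N g d"
  have CJ: "Cinf_on W J" by (rule Cinf_on_subset[OF U1(3)]) (auto simp: W_def)
  have JW: "J ` W \<subseteq> V" by (auto simp: W_def)
  have Vd: "h ` V \<subseteq> chart_range d" by (auto simp: V_def)
  obtain O' where O': "open O'" "O' \<subseteq> snd c ` fst c"
    "\<And>x S. open S \<Longrightarrow> x \<in> S \<Longrightarrow> x \<in> snd c ` fst c \<Longrightarrow> x \<in> closure (S \<inter> O')"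
    using chart_interior_open[OF Ms cx(1)] by metis
  have low: "?L (\<lambda>x. h (J x)) b ?z = (norm (dd 1 J ?z))\<^sup>2 * ?L h b (J ?z)" for b
  proof -
    have n: "(norm w)\<^sup>2 = Re w * Re w + Im w * Im w" for w :: complex
      unfolding cmod_power2 by (simp add: power2_eq_square)
    \<comment> \<open>At a boundary point the conformal law is not directly available, since
      Cauchy-Riemann fails for the extension \<open>J\<close> beyond the surface. Both sides of the
      lowered law are smooth, so it passes from interior points to \<open>?z\<close>. The squared
      norm is written in real and imaginary parts to make its smoothness visible.\<close>
    have "flat_on 0 {?z} (\<lambda>x. ?L (\<lambda>x. h (J x)) b x - (Re (dd 1 J x) * Re (dd 1 J x) + Im (dd 1 J x) * Im (dd 1 J x)) * ?L h b (J x))"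
    proof (rule flat_on_of_vanishing[OF W1(1), where O' = "W \<inter> O'"])
      have 1: "Cinf_on W (?L (\<lambda>x. h (J x)) b)"
        by (rule Cinf_on_lowered_tension[OF W1(1) B W1(3) _ metric_coord_Cinf[OF N g dx(1)] christoffel_low_Cinf[OF N g dx(1)]])
          (use JW Vd in auto)
      have 2: "Cinf_on V (?L h b)"
        by (rule Cinf_on_lowered_tension[OF V1(1) B V1(3) Vd metric_coord_Cinf[OF N g dx(1)] christoffel_low_Cinf[OF N g dx(1)]])
      show "Cinf_on W (\<lambda>x. ?L (\<lambda>x. h (J x)) b x - (Re (dd 1 J x) * Re (dd 1 J x) + Im (dd 1 J x) * Im (dd 1 J x)) * ?L h b (J x))"
        by (intro Cinf_on_diff Cinf_on_mult Cinf_on_add W1(1) 1 Cinf_on_compose[OF W1(1) V1(1) 2 CJ JW]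
           Cinf_on_bounded_linear[OF _ bounded_linear_Re] Cinf_on_bounded_linear[OF _ bounded_linear_Im] Cinf_on_dd CJ)
      show "{?z} \<subseteq> closure (W \<inter> O')" using O'(3)[OF W1(1,2)] cx by auto
      fix y assume y: "y \<in> W \<inter> O'"
      have "?L (\<lambda>x. h (J x)) b y = (norm (dd 1 J y))\<^sup>2 * ?L h b (J y)"
      proof (rule lowered_tension_conformal[OF N g dx(1) _ _ V1(1,3)])
        show "open (W \<inter> O')" using W1(1) O'(1) by blast
        show "Cinf_on (W \<inter> O') J" by (rule Cinf_on_subset[OF CJ]) auto
        show "dd \<i> J y = \<i> * dd 1 J y" if "y \<in> W \<inter> O'" for y
          using holomorphic_map_ext_interior[OF Ms j cx(1) dx(2) U O'(1,2), of y 1] that by (simp add: W_def)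
      qed (use y JW Vd in auto)
      then show "?L (\<lambda>x. h (J x)) b y - (Re (dd 1 J y) * Re (dd 1 J y) + Im (dd 1 J y) * Im (dd 1 J y)) * ?L h b (J y) = 0"
        unfolding n by simp
    qed (use W1 open_Int[OF W1(1) O'(1)] in auto)
    then show ?thesis unfolding n by simp
  qed
  have "local_deriv c c' j x = fderiv J ?z"
    by (rule local_deriv_eq[OF Ms solid_half_plane c U])
  moreover have "linear (fderiv J ?z)"
    using linear_frechet_derivative[OF Cinf_on_differentiable[OF U1(3,1,2)]] .
  ultimately have "dd 1 J ?z \<noteq> 0"
    using inj by (metis injD linear_0 zero_neq_one)
  then have "?L (\<lambda>x. h (J x)) b ?z = 0 \<longleftrightarrow> ?L h b (J ?z) = 0" for b unfolding low by simp
  then show ?thesis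
    unfolding harmonic_at_iff_tension[OF M N g \<psi> c d W\<psi>] harmonic_at_iff_tension[OF M' N g \<phi> c' d' V]
      Jz[symmetric]
    using tension_zero_iff[OF N g dx(1), of "\<lambda>x. h (J x)" ?z] tension_zero_iff[OF N g dx(1), of h "J ?z"] h' Jz
    by auto
qed

lemma Cinf_on_dd_apply:
  assumes "open U" "open W" "Cinf_on W k" "Cinf_on U h" "h ` U \<subseteq> W" "Cinf_on U w"
  shows "Cinf_on U (\<lambda>x. fderiv k (h x) (w x))"
proof (rule Cinf_on_cong_imp[OF assms(1)])
  show "Cinf_on U (\<lambda>x. \<Sum>b\<in>Basis. (w x \<bullet> b) *\<^sub>R fderiv k (h x) b)"
    by (intro Cinf_on_sum Cinf_on_scaleR Cinf_on_inner_left assms(1,6)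
        Cinf_on_compose[OF assms(1,2) Cinf_on_dd[OF assms(3)] assms(4,5)])
  show "(\<Sum>b\<in>Basis. (w x \<bullet> b) *\<^sub>R fderiv k (h x) b) = fderiv k (h x) (w x)"
    if "x \<in> U" for x
    by (rule linear_eq_sum_Basis[OF linear_frechet_derivative[OF Cinf_on_differentiable[OF assms(3,2)]], symmetric])
      (use assms(5) that in auto)
qed

section \<open>Cauchy data along a curve in the surface\<close>

context
  fixes S :: "('s, real) manifold" and M :: "('a, complex) manifold"
    and N :: "('q, 'n::euclidean_space) manifold" and i :: "'s \<Rightarrow> 'a" and \<phi> :: "'a \<Rightarrow> 'q"
  assumes S: "smooth_manifold UNIV S" and M: "riemann_surface M" and N: "smooth_manifold UNIV N"
    and i: "smooth_map S M i" and \<phi>: "smooth_map M N \<phi>"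
begin

lemma cauchy_form_eq:
  assumes c: "c \<in> charts_at S s" and e: "e \<in> charts_at M (i s)" and d: "d \<in> charts_at N (\<phi> (i s))"
    and v: "v \<in> tangent_space S s"
  shows "snd (cauchy_data S M N i \<phi>) s v d = local_deriv e d \<phi> (i s) (- \<i> * local_deriv c e i s (v c))"
proof -
  note Ms = riemann_surface_smooth[OF M]
  have s: "s \<in> points S" by (rule charts_at_points[OF S c])
  have "snd (cauchy_data S M N i \<phi>) s v = hodge_star (differential M N \<phi>) (i s) (differential S M i s v)"
    using s v by (simp add: cauchy_data_def)
  then show ?thesis
    using hodge_star_differential[OF M N \<phi> differential_tangent[OF S solid_UNIV Ms solid_half_plane i s v] e d]
      differential_eq[OF S solid_UNIV Ms i c e v] by simp
qed

text \<open>Membership in the Cauchy spaces is part of \<open>compose_relations\<close>. In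
  coordinates the form is the derivative of \<phi> applied to \<open>- \<i>\<close> times the
  velocity of \<open>i\<close>; with smooth extensions \<open>k\<close> and \<open>h\<close> it
  becomes \<open>fderiv k (h y) (- \<i> * dd u h y)\<close>, smooth on an open set.\<close>

lemma cauchy_data_in_space: "cauchy_data S M N i \<phi> \<in> cauchy_space S N"
proof -
  note Ms = riemann_surface_smooth[OF M]
  let ?\<beta> = "\<lambda>s\<in>points S. \<phi> (i s)" let ?\<alpha> = "snd (cauchy_data S M N i \<phi>)"
  have "smooth_map S N (\<lambda>s. \<phi> (i s))" by (rule smooth_map_compose[OF S Ms N i \<phi>])
  then have \<beta>: "smooth_map S N ?\<beta>" by (rule smooth_map_cong[OF S N]) simp
  have form: "form_coord S c d ?\<alpha> (snd c s) u = local_deriv e d \<phi> (i s) (- \<i> * local_deriv c e i s u)"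
    if "c \<in> charts_at S s" "e \<in> charts_at M (i s)" "d \<in> charts_at N (\<phi> (i s))" for c e d s u
    using cauchy_form_eq[OF that coord_vec_tangent(1)[OF S solid_UNIV that(1)]]
      coord_vec_tangent(2)[OF S solid_UNIV that(1)] chart_inv_chart[OF S conjunct1[OF charts_atD[OF that(1)]]]
      charts_atD[OF that(1)]
    by (simp add: form_coord_def)
  have pts: "\<exists>s. x = snd c s \<and> c \<in> charts_at S s \<and> d \<in> charts_at N (\<phi> (i s)) \<and> (\<exists>e. e \<in> charts_at M (i s))"
    if "c \<in> atlas S" "d \<in> atlas N" and x: "x \<in> local_dom c d ?\<beta>" for c d x
  proof -
    obtain s where s: "x = snd c s" "s \<in> fst c" "?\<beta> s \<in> fst d" using x by (auto simp: local_dom_def)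
    then have c: "c \<in> charts_at S s" and sS: "s \<in> points S"
      using that(1) chart_subset[OF S that(1)] by (auto simp: charts_at_def)
    then show ?thesis
      using s that(2) charts_at_nonempty[OF Ms smooth_map_points[OF i sS]] by (auto simp: charts_at_def)
  qed
  have "?\<alpha> \<in> one_forms S N ?\<beta>"
    unfolding one_forms_def
  proof (intro CollectI conjI ballI allI)
    show "?\<alpha> \<in> (\<Pi>\<^sub>E p\<in>points S. tangent_space S p \<rightarrow>\<^sub>E tangent_space N (?\<beta> p))"
    proof (intro PiE_I)
      fix s v assume s: "s \<in> points S" and v: "v \<in> tangent_space S s"
      have "(\<lambda>c. - \<i> * differential S M i s v c) \<in> tangent_space M (i s)"
        by (rule tangent_space_ii[OF M differential_tangent[OF S solid_UNIV Ms solid_half_plane i s v]])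
      from differential_tangent[OF Ms solid_half_plane N solid_UNIV \<phi> smooth_map_points[OF i s] this]
      show "?\<alpha> s v \<in> tangent_space N (?\<beta> s)"
        using s v by (simp add: cauchy_data_def hodge_star_def)
    qed (auto simp: cauchy_data_def)
    fix c d assume cd: "c \<in> atlas S" "d \<in> atlas N"
    show "linear (form_coord S c d ?\<alpha> x)" if x: "x \<in> local_dom c d ?\<beta>" for x
    proof -
      obtain s e where s: "x = snd c s" "c \<in> charts_at S s" "d \<in> charts_at N (\<phi> (i s))" "e \<in> charts_at M (i s)"
        using pts[OF cd x] by blast
      note 1 = local_deriv_linear[OF S solid_UNIV Ms i s(2,4)]
        and 2 = local_deriv_linear[OF Ms solid_half_plane N \<phi> s(4,3)]
      have "linear (\<lambda>u. local_deriv e d \<phi> (i s) (- \<i> * local_deriv c e i s u))"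
        using linear_compose[OF linear_compose[OF 1, of "\<lambda>w. - \<i> * w"] 2]
          bounded_linear.linear[OF bounded_linear_mult_right[of "- \<i>"]] by (simp only: o_def)
      then show ?thesis unfolding s(1) form[OF s(2,4,3), abs_def] by (simp add: form[OF s(2,4,3)])
    qed
    fix u
    show "smooth_on (local_dom c d ?\<beta>) (\<lambda>x. form_coord S c d ?\<alpha> x u)"
    proof (rule Cinf_on_imp_smooth_on)
      fix x assume x: "x \<in> local_dom c d ?\<beta>"
      obtain s e where s: "x = snd c s" "c \<in> charts_at S s" "d \<in> charts_at N (\<phi> (i s))" "e \<in> charts_at M (i s)"
        using pts[OF cd x] by blast
      obtain U h where U: "local_ext c e i s U h"
        using smooth_map_local_ext_ex[OF S Ms i s(2,4)] by blast
      obtain U' k where U': "local_ext e d \<phi> (i s) U' k"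
        using smooth_map_local_ext_ex[OF Ms N \<phi> s(4,3)] by blast
      have sc: "s \<in> fst c" using s(2) by (simp add: charts_at_def)
      let ?W = "U \<inter> h -` U'"
      note W = local_extD[OF local_ext_compose[OF U U' sc]] and U1 = local_extD[OF U] and U1' = local_extD[OF U']
      have h: "Cinf_on ?W h" by (rule Cinf_on_subset[OF U1(3)]) auto
      have "Cinf_on ?W (\<lambda>y. fderiv k (h y) (- \<i> * dd u h y))"
        by (rule Cinf_on_dd_apply[OF W(1) U1'(1,3) h])
          (auto intro!: Cinf_on_bounded_linear[OF W(1) bounded_linear_mult_right] Cinf_on_dd h Cinf_on_minus[OF W(1)])
      moreover have "fderiv k (h y) (- \<i> * dd u h y) = form_coord S c d ?\<alpha> y u"
        if y: "y \<in> local_dom c d ?\<beta> \<inter> ?W" for y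
      proof -
        obtain t where t: "y = snd c t" "c \<in> charts_at S t" "d \<in> charts_at N (\<phi> (i t))"
          using pts[OF cd] y by blast
        have tc: "t \<in> fst c" using t(2) by (simp add: charts_at_def)
        have ty: "snd c t \<in> U" "h (snd c t) \<in> U'" using y t(1) by auto
        have hy: "h (snd c t) = snd e (i t)" by (rule U1(5)[OF tc ty(1)])
        have e: "e \<in> charts_at M (i t)" using U1(4)[OF tc ty(1)] s(4) by (simp add: charts_at_def)
        have 2: "local_ext e d \<phi> (i t) U' k" by (rule local_ext_move[OF U']) (use ty hy in simp)
        show ?thesis
          unfolding t(1) form[OF t(2) e t(3)] local_deriv_eq[OF S solid_UNIV t(2) local_ext_move[OF U ty(1)]]
            local_deriv_eq[OF Ms solid_half_plane e 2] hy ..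
      qed
      ultimately show "\<exists>W k. open W \<and> x \<in> W \<and> Cinf_on W k \<and>
          (\<forall>y\<in>local_dom c d ?\<beta> \<inter> W. k y = form_coord S c d ?\<alpha> y u)"
        using W(1,2) s(1) by blast
    qed
  qed
  moreover have "fst (cauchy_data S M N i \<phi>) = ?\<beta>" by (simp add: cauchy_data_def)
  ultimately show ?thesis
    unfolding cauchy_space_def using \<beta> by (auto simp: mem_Sigma_iff cauchy_data_def)
qed

end

text \<open>The forms agree by the chain rule, once the factor \<open>- \<i>\<close> of the star has
  been moved past the derivative of \<open>j\<close>, which is complex linear also at boundary
  points.\<close>

lemma cauchy_data_pullback:
  assumes S: "smooth_manifold UNIV S" and M: "riemann_surface M" and M': "riemann_surface M'"
    and N: "smooth_manifold UNIV N" and i: "smooth_map S M i" and i': "smooth_map S M' i'"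
    and j: "holomorphic_map M M' j" and \<phi>: "smooth_map M' N \<phi>" and \<psi>: "smooth_map M N \<psi>"
    and i'_eq: "\<And>s. s \<in> points S \<Longrightarrow> i' s = j (i s)" and \<psi>_eq: "\<And>x. x \<in> points M \<Longrightarrow> \<psi> x = \<phi> (j x)"
  shows "cauchy_data S M' N i' \<phi> = cauchy_data S M N i \<psi>"
proof (rule prod_eqI)
  note Ms = riemann_surface_smooth[OF M] and Ms' = riemann_surface_smooth[OF M']
  have js: "smooth_map M M' j" using j by (simp add: holomorphic_map_def)
  have base: "\<phi> (i' s) = \<psi> (i s)" if "s \<in> points S" for s
    using that i'_eq \<psi>_eq smooth_map_points[OF i that] by simp
  show "fst (cauchy_data S M' N i' \<phi>) = fst (cauchy_data S M N i \<psi>)"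
    using base by (auto simp: cauchy_data_def)
  have "snd (cauchy_data S M' N i' \<phi>) s v d = snd (cauchy_data S M N i \<psi>) s v d"
    if s: "s \<in> points S" and v: "v \<in> tangent_space S s" for s v d
  proof (cases "d \<in> charts_at N (\<psi> (i s))")
    \<comment> \<open>Outside the charts around the image point both sides take the default value
      \<open>0\<close>.\<close>
    case False
    then show ?thesis using s v base[OF s] by (simp add: cauchy_data_def hodge_star_def differential_def)
  next
    case d: True
    then have d': "d \<in> charts_at N (\<phi> (i' s))" using base[OF s] by simp
    have ip: "i s \<in> points M" by (rule smooth_map_points[OF i s])
    obtain c where c: "c \<in> charts_at S s" using charts_at_nonempty[OF S s] by blast
    obtain e where e: "e \<in> charts_at M (i s)" using charts_at_nonempty[OF Ms ip] by blast
    obtain e' where e': "e' \<in> charts_at M' (i' s)" using charts_at_nonempty[OF Ms' smooth_map_points[OF i' s]] by blast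
    have e'j: "e' \<in> charts_at M' (j (i s))" using e' i'_eq[OF s] by simp
    have d'j: "d \<in> charts_at N (\<phi> (j (i s)))" using d' i'_eq[OF s] by simp
    have ci: "local_deriv c e' i' s w = local_deriv e e' j (i s) (local_deriv c e i s w)" for w
    proof -
      have "local_deriv c e' i' s = local_deriv c e' (\<lambda>s. j (i s)) s"
        by (rule local_deriv_cong[OF i'_eq S c])
          (use e' chart_subset[OF S conjunct1[OF charts_atD[OF c]]] in \<open>auto simp: charts_at_def\<close>)
      then show ?thesis
        using local_deriv_chain[OF S solid_UNIV Ms solid_half_plane Ms' i js c e e'j] by simp
    qed
    have c\<psi>: "local_deriv e d \<psi> (i s) w = local_deriv e' d \<phi> (j (i s)) (local_deriv e e' j (i s) w)" for w
    proof -
      have "local_deriv e d \<psi> (i s) = local_deriv e d (\<lambda>x. \<phi> (j x)) (i s)"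
        by (rule local_deriv_cong[OF \<psi>_eq Ms e])
          (use d chart_subset[OF Ms conjunct1[OF charts_atD[OF e]]] in \<open>auto simp: charts_at_def\<close>)
      then show ?thesis
        using local_deriv_chain[OF Ms solid_half_plane Ms' solid_half_plane N js \<phi> e e'j d'j] by simp
    qed
    show ?thesis
      unfolding cauchy_form_eq[OF S M' N i' \<phi> c e' d' v] cauchy_form_eq[OF S M N i \<psi> c e d v] ci c\<psi>
        local_deriv_ii(2)[OF Ms Ms' j e e'j] i'_eq[OF s] ..
  qed
  then show "snd (cauchy_data S M' N i' \<phi>) = snd (cauchy_data S M N i \<psi>)"
    by (intro ext) (auto simp: cauchy_data_def restrict_def fun_eq_iff)
qed

lemma lowered_tension_cong:
  assumes "open V" "\<And>y. y \<in> V \<Longrightarrow> f y = h y" "x \<in> V"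
  shows "lowered_tension G K f b x = lowered_tension G K h b x"
proof -
  have 1: "dd v f x = dd v h x" for v by (rule fun_cong[OF dd_cong[OF assms]])
  have 2: "dd u (dd v f) x = dd u (dd v h) x" for u v
    by (rule fun_cong[OF dd_cong[OF assms(1) _ assms(3)]]) (rule fun_cong[OF dd_cong[OF assms(1,2)]])
  show ?thesis
    unfolding lowered_tension_def laplace_def 1[of 1] 1[of \<i>] 2[of 1 1] 2[of \<i> \<i>] assms(2)[OF assms(3)] ..
qed

section \<open>Images under embeddings, and pushing a map forward\<close>

lemma smooth_embedding_inj_on: "smooth_embedding M M' F \<Longrightarrow> inj_on F (points M)"
  unfolding smooth_embedding_def embedding_map_def using homeomorphic_imp_injective_map by blast

lemma smooth_embedding_open_image:
  assumes "smooth_embedding M M' F" "openin (mtop M) Q"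
  obtains O' where "openin (mtop M') O'" "F ` Q = O' \<inter> F ` points M"
proof -
  have "open_map (mtop M) (subtopology (mtop M') (F ` points M)) F"
    using assms(1) homeomorphic_imp_open_map unfolding smooth_embedding_def embedding_map_def by blast
  then have "openin (subtopology (mtop M') (F ` points M)) (F ` Q)"
    using assms(2) by (simp add: open_map_def)
  then show thesis using that by (auto simp: openin_subtopology)
qed

lemma image_closure_of_continuous:
  assumes "open U" "continuous_on U J" "z \<in> U" "\<And>T. open T \<Longrightarrow> z \<in> T \<Longrightarrow> T \<inter> S \<noteq> {}" "S \<subseteq> U" "J ` S \<subseteq> R"
  shows "J z \<in> closure R"
  unfolding closure_iff_nhds_not_empty
proof (intro allI impI)
  fix A T assume "T \<subseteq> A" "open T" "J z \<in> T"
  have "open (U \<inter> J -` T)" by (rule continuous_open_preimage[OF assms(2,1) \<open>open T\<close>])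
  then have "(U \<inter> J -` T) \<inter> S \<noteq> {}" using assms(3,4) \<open>J z \<in> T\<close> by auto
  then show "R \<inter> A \<noteq> {}" using assms(6) \<open>T \<subseteq> A\<close> by blast
qed

text \<open>\<open>F\<close> is the composite of \<open>\<psi>\<close>, extended over the boundary, with a local inverse of \<open>j\<close>, and \<open>O'\<close>
  is the image of interior points. So \<open>F\<close> is defined on both sides of the image of the boundary.\<close>

lemma pushforward_ext:
  assumes M: "riemann_surface M" and M': "riemann_surface M'"
    and N: "smooth_manifold UNIV N" and g: "riemannian_metric N g"
    and j: "holomorphic_embedding M M' j" and \<psi>: "smooth_map M N \<psi>" and x: "x \<in> points M"
    and c': "c' \<in> charts_at M' (j x)" and d: "d \<in> charts_at N (\<psi> x)"
  obtains V F O' where "open V" "snd c' (j x) \<in> V" "Cinf_on V F" "F ` V \<subseteq> chart_range d"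
    "\<And>q. \<lbrakk>q \<in> points M; j q \<in> fst c'; snd c' (j q) \<in> V\<rbrakk> \<Longrightarrow>
       \<psi> q \<in> fst d \<and> F (snd c' (j q)) = snd d (\<psi> q)"
    "\<And>q e v. \<lbrakk>q \<in> points M; j q \<in> fst c'; snd c' (j q) \<in> V; e \<in> charts_at M q\<rbrakk> \<Longrightarrow>
       fderiv F (snd c' (j q)) (local_deriv e c' j q v) = local_deriv e d \<psi> q v"
    "open O'" "O' \<subseteq> V"
    "\<And>q. \<lbrakk>q \<in> points M; j q \<in> fst c'; snd c' (j q) \<in> V\<rbrakk> \<Longrightarrow> snd c' (j q) \<in> closure O'"
    "\<And>y b. \<lbrakk>\<psi> \<in> harmonic_maps M N g; y \<in> O'; b \<in> Basis\<rbrakk> \<Longrightarrow>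
       low_tension N g d F b y = 0"
proof -
  note Ms = riemann_surface_smooth[OF M] and Ms' = riemann_surface_smooth[OF M']
  have jh: "holomorphic_map M M' j" by (rule holomorphic_embedding_map[OF j])
  have je: "smooth_embedding M M' j" using j by (simp add: holomorphic_embedding_def)
  have js: "smooth_map M M' j" using jh by (simp add: holomorphic_map_def)
  obtain c where c: "c \<in> charts_at M x" using charts_at_nonempty[OF Ms x] by blast
  have cx: "c \<in> atlas M" "x \<in> fst c" and dx: "d \<in> atlas N" "\<psi> x \<in> fst d" and cx': "c' \<in> atlas M'" "j x \<in> fst c'"
    using c c' d by (auto simp: charts_at_def)
  have B: "open (chart_range d)" by (rule chart_range_open[OF N g dx(1)])
  obtain U0 J where U0: "local_ext c c' j x U0 J"
    using smooth_map_local_ext_ex[OF Ms Ms' js c c'] by blast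
  obtain U1 \<Phi> where U1: "local_ext c d \<psi> x U1 \<Phi>"
    using smooth_map_local_ext_ex[OF Ms N \<psi> c d] by blast
  note U0' = local_extD[OF U0] and U1' = local_extD[OF U1]
  \<comment> \<open>The common domain of \<open>J\<close> and \<Phi>, shrunk until \<Phi> takes
    values in the range of \<open>d\<close>. This keeps \<open>F\<close> in that range also off the
    image of \<open>j\<close>.\<close>
  define U2 where "U2 = U0 \<inter> (U1 \<inter> \<Phi> -` chart_range d)"
  have o2: "open U2" unfolding U2_def
    using continuous_open_preimage[OF Cinf_on_continuous[OF U1'(3)] U1'(1) B] U0'(1) by blast
  have x2: "snd c x \<in> U2" unfolding U2_def using U0'(2) U1'(2) U1'(5)[OF cx(2) U1'(2)] dx by auto
  have J2: "Cinf_on U2 J" by (rule Cinf_on_subset[OF U0'(3)]) (auto simp: U2_def)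
  have "local_deriv c c' j x = fderiv J (snd c x)"
    by (rule local_deriv_eq[OF Ms solid_half_plane c U0])
  then have "inj (fderiv J (snd c x))"
    using je c c' x unfolding smooth_embedding_def by metis
  from Cinf_local_inverse_complex[OF o2 J2 x2 this]
  obtain U' V0 k where U': "open U'" "U' \<subseteq> U2" "snd c x \<in> U'" and V0: "open V0" "J (snd c x) \<in> V0"
    and hom: "homeomorphism U' V0 J k" and k: "Cinf_on V0 k"
    and injU: "\<And>w. w \<in> U' \<Longrightarrow> inj (fderiv J w)"
    by metis
  have kJ: "k (J w) = w" "J w \<in> V0" if "w \<in> U'" for w using hom that by (auto simp: homeomorphism_def)
  have Jk: "J (k y) = y" "k y \<in> U'" if "y \<in> V0" for y using hom that by (auto simp: homeomorphism_def)
  \<comment> \<open>An injective immersion could return close to \<open>j x\<close> from far away.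
    As \<open>j\<close> is an embedding, the piece of \<open>M\<close> over \<open>U'\<close> has a
    relatively open image, and \<open>O''\<close> isolates it.\<close>
  obtain O'' where O'': "openin (mtop M') O''" "j ` {q \<in> fst c. snd c q \<in> U'} = O'' \<inter> j ` points M"
    using smooth_embedding_open_image[OF je chart_open_preimage[OF Ms cx(1) U'(1)]] by metis
  have "openin (top_of_set half_plane) (snd c' ` (O'' \<inter> fst c'))"
    by (rule chart_open_image[OF Ms' cx'(1)]) (use O''(1) chart_openin[OF Ms' cx'(1)] in auto)
  then obtain T where T: "open T" "snd c' ` (O'' \<inter> fst c') = half_plane \<inter> T" by (auto simp: openin_open)
  \<comment> \<open>On \<open>V0\<close> the inverse \<open>k\<close> of \<open>J\<close> is
    defined; within \<open>T\<close> the only points in the image of \<open>j\<close> are those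
    coming from \<open>U'\<close>, which \<open>capture\<close> makes precise.\<close>
  define V where "V = V0 \<inter> T"
  define F where "F = (\<lambda>y. \<Phi> (k y))"
  have V: "open V" unfolding V_def using V0(1) T(1) by blast
  have kV: "Cinf_on V k" by (rule Cinf_on_subset[OF k]) (auto simp: V_def)
  have kU2: "k ` V \<subseteq> U2" using Jk(2) U'(2) by (auto simp: V_def)
  have \<Phi>2: "Cinf_on U2 \<Phi>" by (rule Cinf_on_subset[OF U1'(3)]) (auto simp: U2_def)
  have F: "Cinf_on V F" unfolding F_def by (rule Cinf_on_compose[OF V o2 \<Phi>2 kV kU2])
  have capture: "q \<in> fst c \<and> snd c q \<in> U' \<and> J (snd c q) = snd c' (j q)"
    if q: "q \<in> points M" "j q \<in> fst c'" "snd c' (j q) \<in> V" for q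
  proof -
    have "snd c' (j q) \<in> half_plane \<inter> T"
      using q chart_image_subset[OF Ms' cx'(1)] by (auto simp: V_def)
    then obtain m where m: "m \<in> O''" "m \<in> fst c'" "snd c' (j q) = snd c' m" unfolding T(2)[symmetric] by auto
    then have "m = j q" using chart_inj_on[OF Ms' cx'(1)] q(2) by (metis inj_onD)
    then have "j q \<in> j ` {q \<in> fst c. snd c q \<in> U'}" unfolding O''(2) using m q(1) by auto
    then obtain q' where q': "q' \<in> fst c" "snd c q' \<in> U'" "j q = j q'" by auto
    then have "q = q'" using smooth_embedding_inj_on[OF je] q(1) chart_subset[OF Ms cx(1)] by (metis inj_onD subsetD)
    then show ?thesis using q' U0'(5)[OF q'(1)] U'(2) by (auto simp: U2_def)
  qed
  define V' where "V' = U' \<inter> J -` V"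
  have JU': "Cinf_on U' J" by (rule Cinf_on_subset[OF J2 U'(2)])
  have V': "open V'" unfolding V'_def
    by (rule continuous_open_preimage[OF Cinf_on_continuous[OF JU'] U'(1) V])
  have FJ: "F (J w) = \<Phi> w" if "w \<in> V'" for w using kJ that by (simp add: F_def V'_def)
  obtain Q where Q: "open Q" "Q \<subseteq> snd c ` fst c"
    "\<And>x S. open S \<Longrightarrow> x \<in> S \<Longrightarrow> x \<in> snd c ` fst c \<Longrightarrow> x \<in> closure (S \<inter> Q)"
    using chart_interior_open[OF Ms cx(1)] by metis
  define O' where "O' = V \<inter> k -` (U' \<inter> Q)"
  have O': "open O'" unfolding O'_def
    by (rule continuous_open_preimage[OF Cinf_on_continuous[OF kV] V open_Int[OF U'(1) Q(1)]])
  show thesis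
  proof (rule that[OF V _ F _ _ _ O'])
    have "j x \<in> j ` {q \<in> fst c. snd c q \<in> U'}" using cx U'(3) by auto
    then have "j x \<in> O''" unfolding O''(2) by auto
    then have "snd c' (j x) \<in> T" using T(2) cx'(2) by auto
    then show "snd c' (j x) \<in> V" using V0(2) U0'(5)[OF cx(2) U0'(2)] by (simp add: V_def)
    show "F ` V \<subseteq> chart_range d" using kU2 by (auto simp: F_def U2_def)
    show "O' \<subseteq> V" by (auto simp: O'_def)
  next
    fix q assume q: "q \<in> points M" "j q \<in> fst c'" "snd c' (j q) \<in> V"
    note q' = capture[OF q]
    have "F (snd c' (j q)) = \<Phi> (snd c q)" using FJ[of "snd c q"] q' q(3) by (simp add: V'_def)
    then show "\<psi> q \<in> fst d \<and> F (snd c' (j q)) = snd d (\<psi> q)"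
      using U1'(4,5)[of q] q' U'(2) by (auto simp: U2_def)
    show "snd c' (j q) \<in> closure O'"
    proof -
      have zV: "snd c q \<in> V'" using q' q(3) by (simp add: V'_def)
      have "J (snd c q) \<in> closure O'"
      proof (rule image_closure_of_continuous[OF U'(1) Cinf_on_continuous[OF JU'], where S = "V' \<inter> Q"])
        show "T \<inter> (V' \<inter> Q) \<noteq> {}" if "open T" "snd c q \<in> T" for T
        proof -
          have "snd c q \<in> closure (V' \<inter> Q)" by (rule Q(3)[OF V' zV]) (use q' in auto)
          then show ?thesis using that closure_iff_nhds_not_empty[of "snd c q" "V' \<inter> Q"] by blast
        qed
      qed (use q' kJ in \<open>auto simp: V'_def O'_def\<close>)
      then show ?thesis using q' by simp
    qed
    fix e v assume e: "e \<in> charts_at M q"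
    have cq: "c \<in> charts_at M q" using q' cx by (simp add: charts_at_def)
    have cq': "c' \<in> charts_at M' (j q)" using q(2) cx' by (simp add: charts_at_def)
    have z: "snd c q \<in> U0" "snd c q \<in> U1" "snd c q \<in> U2" "snd c q \<in> V'" using q' U'(2) q(3) by (auto simp: U2_def V'_def)
    have dq: "d \<in> charts_at N (\<psi> q)" using U1'(4)[OF _ z(2)] q' dx by (simp add: charts_at_def)
    \<comment> \<open>\<Phi> is the composite of \<open>F\<close> and \<open>J\<close> on the open
      set \<open>V'\<close>, so the ordinary chain rule applies at boundary points as well.\<close>
    have "fderiv F (snd c' (j q)) (local_deriv c c' j q w) = local_deriv c d \<psi> q w" for w
    proof -
      have dJ: "J differentiable (at (snd c q))" by (rule Cinf_on_differentiable[OF J2 o2 z(3)])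
      have dF: "F differentiable (at (J (snd c q)))"
        by (rule Cinf_on_differentiable[OF F V]) (use z(4) in \<open>simp add: V'_def\<close>)
      have "fderiv \<Phi> (snd c q) w = fderiv (\<lambda>w. F (J w)) (snd c q) w"
        by (rule fun_cong[OF dd_cong[OF V' _ z(4)]]) (simp add: FJ)
      then show ?thesis
        unfolding dd_compose[OF dF dJ] local_deriv_eq[OF Ms solid_half_plane cq local_ext_move[OF U0 z(1)]]
          local_deriv_eq[OF Ms solid_half_plane cq local_ext_move[OF U1 z(2)]] using q' by simp
    qed
    then show "fderiv F (snd c' (j q)) (local_deriv e c' j q v) = local_deriv e d \<psi> q v"
      unfolding local_deriv_chart_change[OF Ms solid_half_plane Ms' js e cq cq', of v]
        local_deriv_chart_change[OF Ms solid_half_plane N \<psi> e cq dq, of v] .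
  next
    fix y and b :: 'c assume h: "\<psi> \<in> harmonic_maps M N g" and y: "y \<in> O'" and b: "b \<in> Basis"
    let ?L = "low_tension N g d"
    have yV: "y \<in> V" "k y \<in> U'" "k y \<in> Q" using y by (auto simp: O'_def)
    then obtain q where q: "q \<in> fst c" "k y = snd c q" using Q(2) by blast
    have Jy: "J (snd c q) = y" using Jk(1)[of y] yV q(2) by (simp add: V_def)
    have z: "snd c q \<in> U1" "snd c q \<in> V' \<inter> Q" "snd c q \<in> U'" "snd c q \<in> U2"
      using yV q(2) U'(2) Jy by (auto simp: U2_def V'_def)
    have cq: "c \<in> charts_at M q" using q cx by (simp add: charts_at_def)
    have dq: "d \<in> charts_at N (\<psi> q)" using U1'(4)[OF q(1) z(1)] dx by (simp add: charts_at_def)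
    have "harmonic_at M N g \<psi> c d q" using h cq dq unfolding harmonic_maps_iff by blast
    then have "tension (christoffel N g d) \<Phi> (snd c q) = 0"
      unfolding harmonic_at_iff_tension[OF M N g \<psi> cq dq local_ext_move[OF U1 z(1)]] .
    then have "?L \<Phi> b (snd c q) = 0"
      using tension_zero_iff[OF N g dx(1), of \<Phi> "snd c q"] z(4) b by (auto simp: U2_def)
    moreover have "?L \<Phi> b (snd c q) = ?L (\<lambda>w. F (J w)) b (snd c q)"
      by (rule lowered_tension_cong[OF V']) (use FJ z in auto)
    \<comment> \<open>The conformal law read backwards: the equation is known for the composite with
      \<open>J\<close>, and the factor is nonzero because \<open>J\<close> has injective derivatives
      on \<open>U'\<close>.\<close>
    moreover have "?L (\<lambda>w. F (J w)) b (snd c q) = (norm (dd 1 J (snd c q)))\<^sup>2 * ?L F b (J (snd c q))"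
    proof (rule lowered_tension_conformal[OF N g dx(1) _ _ V F])
      show "open (V' \<inter> Q)" using V' Q(1) by blast
      show "Cinf_on (V' \<inter> Q) J" by (rule Cinf_on_subset[OF JU']) (auto simp: V'_def)
      show "dd \<i> J w = \<i> * dd 1 J w" if "w \<in> V' \<inter> Q" for w
        using holomorphic_map_ext_interior[OF Ms jh cx(1) cx'(1) U0 Q(1,2), of w 1] that U'(2)
        by (auto simp: V'_def U2_def)
      show "F (J (snd c q)) \<in> chart_range d" using FJ[of "snd c q"] z(2,4) by (auto simp: U2_def)
    qed (use z(2) in \<open>auto simp: V'_def\<close>)
    moreover have "dd 1 J (snd c q) \<noteq> 0"
    proof -
      have "linear (fderiv J (snd c q))"
        using linear_frechet_derivative[OF Cinf_on_differentiable[OF J2 o2 z(4)]] .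
      then show ?thesis using injU[OF z(3)] by (metis injD linear_0 zero_neq_one)
    qed
    ultimately show "?L F b y = 0" unfolding Jy by simp
  qed
qed

section \<open>Gluing\<close>

lemma segalD:
  assumes "segal_morphism W"
  shows "riemann_surface (surface W)" "compact_space (mtop (surface W))"
    "smooth_manifold UNIV (source W)" "smooth_manifold UNIV (target W)"
    "smooth_embedding (source W) (surface W) (in_map W)" "smooth_embedding (target W) (surface W) (out_map W)"
    "in_map W ` points (source W) \<inter> out_map W ` points (target W) = {}"
    "in_map W ` points (source W) \<union> out_map W ` points (target W) = surface_boundary (surface W)"
    "smooth_map (source W) (surface W) (in_map W)" "smooth_map (target W) (surface W) (out_map W)"
proof -
  note a = assms[unfolded segal_morphism_def oriented_1_manifold_def]
  show "riemann_surface (surface W)" "compact_space (mtop (surface W))"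
    "smooth_manifold UNIV (source W)" "smooth_manifold UNIV (target W)"
    "in_map W ` points (source W) \<inter> out_map W ` points (target W) = {}"
    "in_map W ` points (source W) \<union> out_map W ` points (target W) = surface_boundary (surface W)"
    using a by (simp_all only:)
  show "smooth_embedding (source W) (surface W) (in_map W)" "smooth_embedding (target W) (surface W) (out_map W)"
    using a by (simp_all only:)
  then show "smooth_map (source W) (surface W) (in_map W)" "smooth_map (target W) (surface W) (out_map W)"
    by (simp_all only: smooth_embedding_def)
qed

lemma smooth_embedding_inj_deriv:
  "smooth_embedding M M' F \<Longrightarrow> p \<in> points M \<Longrightarrow> c \<in> charts_at M p \<Longrightarrow> d \<in> charts_at M' (F p) \<Longrightarrow>
   inj (local_deriv c d F p)"
  unfolding smooth_embedding_def by blast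

lemma smooth_embedding_closed_image:
  assumes "smooth_embedding M M' F" "compact_space (mtop M)" "Hausdorff_space (mtop M')" "closedin (mtop M) K"
  shows "closedin (mtop M') (F ` K)"
proof -
  have "continuous_map (mtop M) (mtop M') F"
    using assms(1) unfolding smooth_embedding_def smooth_map_def by blast
  then have "compactin (mtop M') (F ` K)"
    using image_compactin closedin_compact_space[OF assms(2,4)] by blast
  then show ?thesis using compactin_imp_closedin[OF assms(3)] by blast
qed

lemma smooth_manifold_Hausdorff: "smooth_manifold H M \<Longrightarrow> Hausdorff_space (mtop M)"
  unfolding smooth_manifold_def by blast

lemma harmonic_restrict:
  assumes M: "riemann_surface M" and M': "riemann_surface M'"
    and N: "smooth_manifold UNIV N" and g: "riemannian_metric N g"
    and j: "holomorphic_embedding M M' j" and \<phi>: "\<phi> \<in> harmonic_maps M' N g"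
  shows "restrict (\<lambda>x. \<phi> (j x)) (points M) \<in> harmonic_maps M N g"
proof -
  note Ms = riemann_surface_smooth[OF M] and Ms' = riemann_surface_smooth[OF M']
  have jh: "holomorphic_map M M' j" by (rule holomorphic_embedding_map[OF j])
  have je: "smooth_embedding M M' j" using j by (simp add: holomorphic_embedding_def)
  have js: "smooth_map M M' j" using jh by (simp add: holomorphic_map_def)
  have \<phi>s: "smooth_map M' N \<phi>" using \<phi> by (simp add: harmonic_maps_iff)
  let ?\<psi> = "restrict (\<lambda>x. \<phi> (j x)) (points M)"
  have \<psi>s: "smooth_map M N ?\<psi>"
    by (rule smooth_map_cong[OF Ms N smooth_map_compose[OF Ms Ms' N js \<phi>s]]) simp
  have "harmonic_at M N g ?\<psi> c d p" if c: "c \<in> charts_at M p" and d: "d \<in> charts_at N (?\<psi> p)" for c d p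
  proof -
    have p: "p \<in> points M" by (rule charts_at_points[OF Ms c])
    obtain c' where c': "c' \<in> charts_at M' (j p)" using charts_at_nonempty[OF Ms' smooth_map_points[OF js p]] by blast
    have "harmonic_at M' N g \<phi> c' d (j p)"
      using \<phi> c' d p by (simp add: harmonic_maps_iff)
    moreover have "harmonic_at M N g ?\<psi> c d p \<longleftrightarrow> harmonic_at M' N g \<phi> c' d (j p)"
      by (rule harmonic_at_pullback[OF M M' N g jh \<phi>s \<psi>s _ c c' d smooth_embedding_inj_deriv[OF je p c c']]) simp
    ultimately show ?thesis by blast
  qed
  then show ?thesis using \<psi>s by (simp add: harmonic_maps_iff)
qed

text \<open>The complement of the closed set \<open>C\<close> lies in the image of \<open>j\<close>,
  so near \<open>p\<close> the map \<phi> is represented by the pushforward of \<psi>. With the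
  other piece as \<open>C\<close> this handles every point off the seam.\<close>

lemma smooth_off_closed:
  assumes M: "riemann_surface M" and M': "riemann_surface M'"
    and N: "smooth_manifold UNIV N" and g: "riemannian_metric N g"
    and j: "holomorphic_embedding M M' j" and \<psi>: "smooth_map M N \<psi>"
    and \<phi>: "\<And>x. x \<in> points M \<Longrightarrow> \<phi> (j x) = \<psi> x"
    and C: "closedin (mtop M') C" "points M' \<subseteq> j ` points M \<union> C"
    and c: "c \<in> atlas M'" "p \<in> fst c" "p \<notin> C" and d: "d \<in> atlas N" "\<phi> p \<in> fst d"
  shows "\<exists>U h. open U \<and> snd c p \<in> U \<and> Cinf_on U h \<and>
        (\<forall>q\<in>fst c. \<phi> q \<in> fst d \<longrightarrow> snd c q \<in> U \<longrightarrow> h (snd c q) = snd d (\<phi> q))"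
proof -
  note Ms' = riemann_surface_smooth[OF M']
  obtain x where x: "x \<in> points M" "p = j x" using C(2) c chart_subset[OF Ms' c(1)] by blast
  have c': "c \<in> charts_at M' (j x)" and d': "d \<in> charts_at N (\<psi> x)"
    using c d x \<phi> by (auto simp: charts_at_def)
  obtain V F where V: "open V" "snd c (j x) \<in> V" "Cinf_on V F"
    "\<And>q. \<lbrakk>q \<in> points M; j q \<in> fst c; snd c (j q) \<in> V\<rbrakk> \<Longrightarrow> \<psi> q \<in> fst d \<and> F (snd c (j q)) = snd d (\<psi> q)"
    by (rule pushforward_ext[OF M M' N g j \<psi> x(1) c' d']) blast
  have "openin (mtop M') (fst c - C)" using chart_openin[OF Ms' c(1)] C(1) by blast
  then have "openin (top_of_set half_plane) (snd c ` (fst c - C))"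
    by (rule chart_open_image[OF Ms' c(1)]) auto
  then obtain T where T: "open T" "snd c ` (fst c - C) = half_plane \<inter> T" by (auto simp: openin_open)
  have pT: "snd c p \<in> T" using T(2) c by auto
  have "F (snd c q) = snd d (\<phi> q)" if q: "q \<in> fst c" "snd c q \<in> V \<inter> T" for q
  proof -
    have "snd c q \<in> half_plane \<inter> T" using q chart_image_subset[OF Ms' c(1)] by auto
    then obtain m where m: "m \<in> fst c" "m \<notin> C" "snd c q = snd c m" unfolding T(2)[symmetric] by auto
    then have "q \<notin> C" using chart_inj_on[OF Ms' c(1)] q(1) by (metis inj_onD)
    then obtain y where y: "y \<in> points M" "q = j y" using C(2) q(1) chart_subset[OF Ms' c(1)] by blast
    then show ?thesis using V(4)[of y] q \<phi> by auto
  qed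
  then show ?thesis
    using V(1-3) T(1) pT x(2) Cinf_on_subset[OF V(3), of "V \<inter> T"] by (intro exI[of _ "V \<inter> T"] exI[of _ F]) auto
qed

text \<open>Over the reals \<tau> and \<open>- \<i> * \<tau>\<close> span the plane; the
  coefficients of \<open>v\<close> are the real part of \<open>v / \<tau>\<close> and minus its
  imaginary part. The two directions will be tangential and normal to the seam.\<close>

lemma complex_linear_span:
  fixes L :: "complex \<Rightarrow> 'f::real_vector"
  assumes "linear L" "\<tau> \<noteq> 0" "L \<tau> = 0" "L (- \<i> * \<tau>) = 0" shows "L v = 0"
proof -
  have "v = Re (v / \<tau>) *\<^sub>R \<tau> + (- Im (v / \<tau>)) *\<^sub>R (- \<i> * \<tau>)"
  proof -
    have "v = (v / \<tau>) * \<tau>" using assms(2) by simp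
    also have "\<dots> = (complex_of_real (Re (v / \<tau>)) + \<i> * complex_of_real (Im (v / \<tau>))) * \<tau>"
      using complex_eq[of "v / \<tau>"] by simp
    finally show ?thesis by (simp add: scaleR_conv_of_real algebra_simps)
  qed
  then have "L v = Re (v / \<tau>) *\<^sub>R L \<tau> + (- Im (v / \<tau>)) *\<^sub>R L (- \<i> * \<tau>)"
    using linear_add[OF assms(1)] linear_scale[OF assms(1)] by metis
  then show ?thesis using assms(3,4) by simp
qed

section \<open>The glued surface and its seam\<close>

locale gluing =
  fixes N :: "('q, 'n::euclidean_space) manifold" and g :: "('q, 'n) metric"
    and W1 :: "('s, 'a, 't) cobordism" and W2 :: "('t, 'b, 'r) cobordism" and W :: "('s, 'c, 'r) cobordism"
    and j1 :: "'a \<Rightarrow> 'c" and j2 :: "'b \<Rightarrow> 'c"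
  assumes N: "smooth_manifold UNIV N" and g: "riemannian_metric N g"
    and W1: "segal_morphism W1" and W2: "segal_morphism W2" and seam: "target W1 = source W2"
    and W: "segal_morphism W" and ends: "source W = source W1" "target W = target W2"
    and j1: "holomorphic_embedding (surface W1) (surface W) j1"
    and j2: "holomorphic_embedding (surface W2) (surface W) j2"
    and cover: "j1 ` points (surface W1) \<union> j2 ` points (surface W2) = points (surface W)"
    and overlap: "\<And>x y. \<lbrakk>x \<in> points (surface W1); y \<in> points (surface W2)\<rbrakk> \<Longrightarrow>
       j1 x = j2 y \<longleftrightarrow> (\<exists>s\<in>points (target W1). x = out_map W1 s \<and> y = in_map W2 s)"
    and in_eq: "\<And>s. s \<in> points (source W) \<Longrightarrow> in_map W s = j1 (in_map W1 s)"
    and out_eq: "\<And>s. s \<in> points (target W) \<Longrightarrow> out_map W s = j2 (out_map W2 s)"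
begin

abbreviation "M1 \<equiv> surface W1"
abbreviation "M2 \<equiv> surface W2"
abbreviation "M \<equiv> surface W"
abbreviation "T \<equiv> target W1"
abbreviation "i1 \<equiv> out_map W1"
abbreviation "i2 \<equiv> in_map W2"

lemmas M1 = segalD(1)[OF W1] and M2 = segalD(1)[OF W2] and M = segalD(1)[OF W]
lemmas M1s = riemann_surface_smooth[OF M1] and M2s = riemann_surface_smooth[OF M2] and Ms = riemann_surface_smooth[OF M]
lemmas Ts = segalD(4)[OF W1]
lemmas i1e = segalD(6)[OF W1] and i2e = segalD(5)[OF W2, folded seam]
lemmas i1s = segalD(10)[OF W1] and i2s = segalD(9)[OF W2, folded seam]
lemmas j1h = holomorphic_embedding_map[OF j1] and j2h = holomorphic_embedding_map[OF j2]

lemma j1e: "smooth_embedding M1 M j1" and j2e: "smooth_embedding M2 M j2"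
  using j1 j2 by (auto simp: holomorphic_embedding_def)

lemma j1s: "smooth_map M1 M j1" and j2s: "smooth_map M2 M j2"
  using j1h j2h by (auto simp: holomorphic_map_def)

lemma seam_eq: "s \<in> points T \<Longrightarrow> j1 (i1 s) = j2 (i2 s)"
  using overlap[OF smooth_map_points[OF i1s] smooth_map_points[OF i2s], of s s] by blast

lemma seam_smooth: "smooth_map T M (\<lambda>s. j1 (i1 s))"
  by (rule smooth_map_compose[OF Ts M1s Ms i1s j1s])

text \<open>Along the seam both pieces are compared with \<phi> on the glued surface, where
  \<open>j1\<close> after \<open>i1\<close> and \<open>j2\<close> after \<open>i2\<close> are the
  same curve. The two ends are direct pullbacks.\<close>

lemma cauchy_pieces:
  assumes \<phi>: "smooth_map M N \<phi>" and \<phi>1: "smooth_map M1 N \<phi>1" and \<phi>2: "smooth_map M2 N \<phi>2"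
    and 1: "\<And>x. x \<in> points M1 \<Longrightarrow> \<phi>1 x = \<phi> (j1 x)" and 2: "\<And>x. x \<in> points M2 \<Longrightarrow> \<phi>2 x = \<phi> (j2 x)"
  shows "cauchy_data (source W) M N (in_map W) \<phi> = cauchy_data (source W1) M1 N (in_map W1) \<phi>1"
    "cauchy_data (target W) M N (out_map W) \<phi> = cauchy_data (target W2) M2 N (out_map W2) \<phi>2"
    "cauchy_data T M1 N i1 \<phi>1 = cauchy_data T M2 N i2 \<phi>2"
proof -
  show "cauchy_data (source W) M N (in_map W) \<phi> = cauchy_data (source W1) M1 N (in_map W1) \<phi>1"
    using cauchy_data_pullback[OF segalD(3)[OF W] M1 M N _ segalD(9)[OF W] j1h \<phi> \<phi>1 in_eq 1]
      segalD(9)[OF W1] ends by simp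
  show "cauchy_data (target W) M N (out_map W) \<phi> = cauchy_data (target W2) M2 N (out_map W2) \<phi>2"
    using cauchy_data_pullback[OF segalD(4)[OF W] M2 M N _ segalD(10)[OF W] j2h \<phi> \<phi>2 out_eq 2]
      segalD(10)[OF W2] ends by simp
  have "cauchy_data T M N (\<lambda>s. j1 (i1 s)) \<phi> = cauchy_data T M1 N i1 \<phi>1"
    by (rule cauchy_data_pullback[OF Ts M1 M N i1s seam_smooth j1h \<phi> \<phi>1 refl 1])
  moreover have "cauchy_data T M N (\<lambda>s. j1 (i1 s)) \<phi> = cauchy_data T M2 N i2 \<phi>2"
    by (rule cauchy_data_pullback[OF Ts M2 M N i2s seam_smooth j2h \<phi> \<phi>2 seam_eq 2])
  ultimately show "cauchy_data T M1 N i1 \<phi>1 = cauchy_data T M2 N i2 \<phi>2" by simp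
qed

text \<open>A boundary point of the glued surface is an incoming point of the first piece or an
  outgoing point of the second, and those are disjoint from the seam within their piece. So a chart
  leaves room on both sides of the seam.\<close>

lemma seam_interior:
  assumes s: "s \<in> points T" and c: "c \<in> charts_at M (j1 (i1 s))"
  shows "0 < Im (snd c (j1 (i1 s)))"
proof (rule ccontr)
  let ?p = "j1 (i1 s)"
  note i1p = smooth_map_points[OF i1s s] and i2p = smooth_map_points[OF i2s s]
  assume "\<not> 0 < Im (snd c ?p)"
  moreover have "0 \<le> Im (snd c ?p)"
    using chart_image_subset[OF Ms conjunct1[OF charts_atD[OF c]]] charts_atD[OF c] by (auto simp: half_plane_def)
  ultimately have "?p \<in> surface_boundary M"
    using c charts_at_points[OF Ms c] unfolding surface_boundary_def by auto
  then consider r where "r \<in> points (source W1)" "?p = j1 (in_map W1 r)"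
    | r where "r \<in> points (target W2)" "?p = j2 (out_map W2 r)"
    unfolding segalD(8)[OF W, symmetric] using in_eq out_eq ends by auto
  then show False
  proof cases
    case 1
    then have "i1 s = in_map W1 r"
      using inj_onD[OF smooth_embedding_inj_on[OF j1e] _ i1p smooth_map_points[OF segalD(9)[OF W1] 1(1)]] by blast
    then show False using segalD(7)[OF W1] s 1(1) by blast
  next
    case 2
    then have "i2 s = out_map W2 r"
      using inj_onD[OF smooth_embedding_inj_on[OF j2e] _ i2p smooth_map_points[OF segalD(10)[OF W2] 2(1)]]
        seam_eq[OF s] by simp
    then show False using segalD(7)[OF W2] s 2(1) seam by auto
  qed
qed

end

lemma chart_range_diff_open:
  assumes "smooth_manifold H M" "c \<in> atlas M" "closedin (mtop M) C" "open V" "V \<subseteq> snd c ` fst c"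
  shows "open (V - snd c ` (fst c \<inter> C))"
proof -
  have "openin (mtop M) (fst c - C)" using chart_openin[OF assms(1,2)] assms(3) by blast
  then have "openin (top_of_set H) (snd c ` (fst c - C))"
    by (rule chart_open_image[OF assms(1,2)]) auto
  then obtain T where T: "open T" "snd c ` (fst c - C) = H \<inter> T" by (auto simp: openin_open)
  have inj: "q = q'" if "q \<in> fst c" "q' \<in> fst c" "snd c q = snd c q'" for q q'
    using chart_inj_on[OF assms(1,2)] that by (metis inj_onD)
  have "z \<in> V - snd c ` (fst c \<inter> C) \<longleftrightarrow> z \<in> V \<inter> T" for z
  proof (cases "z \<in> V")
    case True
    then obtain q where q: "q \<in> fst c" "z = snd c q" using assms(5) by auto
    have "z \<in> H" using q chart_image_subset[OF assms(1,2)] by auto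
    then have "z \<in> T \<longleftrightarrow> z \<in> snd c ` (fst c - C)" unfolding T(2) by simp
    also have "\<dots> \<longleftrightarrow> q \<notin> C" using q inj by blast
    also have "\<dots> \<longleftrightarrow> z \<notin> snd c ` (fst c \<inter> C)" using q inj by blast
    finally show ?thesis using True by simp
  qed simp
  then have "V - snd c ` (fst c \<inter> C) = V \<inter> T" by blast
  then show ?thesis using assms(4) T(1) by auto
qed

text \<open>The chart of the one-manifold covers a full neighbourhood of the parameter, so
  \<open>D\<close> along the curve vanishes on an open set of parameters. By the chain rule its
  derivative there is that of \<open>D\<close> along the velocity.\<close>

lemma curve_tangent_direction:
  fixes S :: "('s, real) manifold" and M :: "('a, complex) manifold"
  assumes S: "smooth_manifold UNIV S" and M: "smooth_manifold half_plane M"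
    and \<gamma>: "smooth_map S M \<gamma>" and a: "a \<in> charts_at S s" and c: "c \<in> charts_at M (\<gamma> s)"
    and nz: "local_deriv a c \<gamma> s 1 \<noteq> 0"
    and V: "open V" "snd c (\<gamma> s) \<in> V"
    and Z: "\<And>t. \<lbrakk>t \<in> points S; \<gamma> t \<in> fst c; snd c (\<gamma> t) \<in> V\<rbrakk> \<Longrightarrow> snd c (\<gamma> t) \<in> Z"
  shows "tangent_direction TYPE('f::euclidean_space) Z (snd c (\<gamma> s)) (local_deriv a c \<gamma> s 1)"
  unfolding tangent_direction_def
proof (intro conjI allI impI nz)
  fix D :: "complex \<Rightarrow> 'f"
  assume D: "D differentiable (at (snd c (\<gamma> s)))" and D0: "\<forall>y\<in>Z. D y = 0"
  have as: "a \<in> atlas S" "s \<in> fst a" using a by (auto simp: charts_at_def)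
  obtain U k where U: "local_ext a c \<gamma> s U k" "U \<inter> UNIV \<subseteq> snd a ` fst a"
    by (rule smooth_map_local_ext[OF S M \<gamma> a c open_UNIV UNIV_I]) blast
  note U' = local_extD[OF U(1)]
  have ks: "k (snd a s) = snd c (\<gamma> s)" by (rule U'(5)[OF as(2) U'(2)])
  define U1 where "U1 = U \<inter> k -` V"
  have U1: "open U1" unfolding U1_def
    by (rule continuous_open_preimage[OF Cinf_on_continuous[OF U'(3)] U'(1) V(1)])
  have sU1: "snd a s \<in> U1" using U'(2) ks V(2) by (simp add: U1_def)
  have "D (k r) = 0" if r: "r \<in> U1" for r
  proof -
    obtain t where t: "t \<in> fst a" "r = snd a t" using r U(2) by (auto simp: U1_def)
    then have "k r = snd c (\<gamma> t)" "\<gamma> t \<in> fst c" using U'(4,5)[OF t(1)] r by (auto simp: U1_def)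
    moreover have "t \<in> points S" using t(1) chart_subset[OF S as(1)] by blast
    ultimately show ?thesis using Z[of t] r D0 by (auto simp: U1_def)
  qed
  then have "fderiv (\<lambda>r. D (k r)) (snd a s) = fderiv (\<lambda>r. 0) (snd a s)"
    by (rule dd_cong[OF U1 _ sU1])
  moreover have "fderiv (\<lambda>r. D (k r)) (snd a s) 1 =
     fderiv D (snd c (\<gamma> s)) (local_deriv a c \<gamma> s 1)"
    unfolding local_deriv_eq[OF S solid_UNIV a U(1)] ks[symmetric]
    by (rule dd_compose) (use D ks Cinf_on_differentiable[OF U'(3,1,2)] in auto)
  ultimately show "fderiv D (snd c (\<gamma> s)) (local_deriv a c \<gamma> s 1) = 0" by simp
qed

text \<open>The Cauchy form on a tangent vector is the differential of \<psi> on that vector turned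
  by \<open>- \<i>\<close>, i.e. a normal derivative. \<open>L\<close> stands for the derivative of
  a pushed forward representative, known through its values on the derivative of \<open>j\<close>;
  complex linearity of the latter lets \<open>- \<i>\<close> pass.\<close>

lemma cauchy_normal_derivative:
  fixes S :: "('s, real) manifold"
  assumes S: "smooth_manifold UNIV S" and M: "riemann_surface M" and M': "riemann_surface M'"
    and N: "smooth_manifold UNIV N" and i: "smooth_map S M i" and j: "holomorphic_map M M' j"
    and \<psi>: "smooth_map M N \<psi>" and a: "a \<in> charts_at S s" and c: "c \<in> charts_at M' (j (i s))"
    and d: "d \<in> charts_at N (\<psi> (i s))"
    and F: "\<And>e v. e \<in> charts_at M (i s) \<Longrightarrow> L (local_deriv e c j (i s) v) = local_deriv e d \<psi> (i s) v"
  shows "L (- \<i> * local_deriv a c (\<lambda>s. j (i s)) s 1) = snd (cauchy_data S M N i \<psi>) s (coord_vec S a s 1) d"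
proof -
  note Ms = riemann_surface_smooth[OF M] and Ms' = riemann_surface_smooth[OF M']
  have js: "smooth_map M M' j" using j by (simp add: holomorphic_map_def)
  obtain e where e: "e \<in> charts_at M (i s)"
    using charts_at_nonempty[OF Ms smooth_map_points[OF i charts_at_points[OF S a]]] by blast
  show ?thesis
    unfolding cauchy_form_eq[OF S M N i \<psi> a e d coord_vec_tangent(1)[OF S solid_UNIV a]]
      coord_vec_tangent(2)[OF S solid_UNIV a] local_deriv_chain[OF S solid_UNIV Ms solid_half_plane Ms' i js a e c]
      local_deriv_ii(2)[OF Ms Ms' j e c, symmetric]
    by (rule F[OF e])
qed

context gluing
begin

abbreviation "C1 \<equiv> j1 ` points M1"
abbreviation "C2 \<equiv> j2 ` points M2"

lemma closed_pieces: "closedin (mtop M) C1" "closedin (mtop M) C2"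
  using smooth_embedding_closed_image[OF j1e segalD(2)[OF W1] smooth_manifold_Hausdorff[OF Ms] closedin_topspace]
    smooth_embedding_closed_image[OF j2e segalD(2)[OF W2] smooth_manifold_Hausdorff[OF Ms] closedin_topspace]
  by auto

lemma overlap_points: "p \<in> C1 \<Longrightarrow> p \<in> C2 \<Longrightarrow> \<exists>s\<in>points T. p = j1 (i1 s)"
  using overlap by fastforce

lemma seam_tangent_nonzero:
  assumes a: "a \<in> charts_at T s" and c: "c \<in> charts_at M (j1 (i1 s))"
  shows "local_deriv a c (\<lambda>s. j1 (i1 s)) s 1 \<noteq> 0"
proof -
  have s: "s \<in> points T" by (rule charts_at_points[OF Ts a])
  note p = smooth_map_points[OF i1s s]
  obtain e where e: "e \<in> charts_at M1 (i1 s)" using charts_at_nonempty[OF M1s p] by blast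
  note l1 = local_deriv_linear[OF Ts solid_UNIV M1s i1s a e] and l2 = local_deriv_linear[OF M1s solid_half_plane Ms j1s e c]
  note n1 = smooth_embedding_inj_deriv[OF i1e s a e] and n2 = smooth_embedding_inj_deriv[OF j1e p e c]
  have "local_deriv a e i1 s 1 \<noteq> 0" using l1 n1 by (metis injD linear_0 zero_neq_one)
  then have "local_deriv e c j1 (i1 s) (local_deriv a e i1 s 1) \<noteq> 0" using l2 n2 by (metis injD linear_0)
  then show ?thesis
    unfolding local_deriv_chain[OF Ts solid_UNIV M1s solid_half_plane Ms i1s j1s a e c] .
qed

section \<open>The glued map of two harmonic maps with matching Cauchy data\<close>

context
  fixes \<phi>1 :: "'a \<Rightarrow> 'q" and \<phi>2 :: "'b \<Rightarrow> 'q"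
  assumes h1: "\<phi>1 \<in> harmonic_maps M1 N g" and h2: "\<phi>2 \<in> harmonic_maps M2 N g"
    and cd: "cauchy_data T M1 N i1 \<phi>1 = cauchy_data T M2 N i2 \<phi>2"
begin

lemma \<phi>1s: "smooth_map M1 N \<phi>1" and \<phi>2s: "smooth_map M2 N \<phi>2"
  using h1 h2 by (auto simp: harmonic_maps_iff)

lemma seam_match: "s \<in> points T \<Longrightarrow> \<phi>1 (i1 s) = \<phi>2 (i2 s)"
proof -
  assume s: "s \<in> points T"
  have "fst (cauchy_data T M1 N i1 \<phi>1) s = fst (cauchy_data T M2 N i2 \<phi>2) s" using cd by simp
  then show ?thesis using s by (simp add: cauchy_data_def)
qed

text \<open>On the seam the first branch is taken; \<open>seam_match\<close> makes it agree with the
  second, as \<open>glued_j2\<close> records.\<close>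

definition glued :: "'c \<Rightarrow> 'q" where
  "glued = (\<lambda>p\<in>points M. if p \<in> C1 then \<phi>1 (inv_into (points M1) j1 p) else \<phi>2 (inv_into (points M2) j2 p))"

lemma glued_j1: "x \<in> points M1 \<Longrightarrow> glued (j1 x) = \<phi>1 x"
  using inv_into_f_f[OF smooth_embedding_inj_on[OF j1e]] smooth_map_points[OF j1s] by (simp add: glued_def)

lemma glued_j2: "y \<in> points M2 \<Longrightarrow> glued (j2 y) = \<phi>2 y"
proof -
  assume y: "y \<in> points M2"
  show ?thesis
  proof (cases "j2 y \<in> C1")
    case True
    then obtain x where x: "x \<in> points M1" "j2 y = j1 x" by auto
    then obtain s where s: "s \<in> points T" "x = i1 s" "y = i2 s" using overlap[OF x(1) y] by auto
    then show ?thesis using glued_j1[OF x(1)] x(2) seam_match by simp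
  next
    case False
    then show ?thesis
      using inv_into_f_f[OF smooth_embedding_inj_on[OF j2e] y] smooth_map_points[OF j2s y] by (simp add: glued_def)
  qed
qed

text \<open>The pieces are compact and the glued surface is Hausdorff, so closed subsets of the
  pieces have closed images; the preimage of a closed set is a union of two of these.\<close>

lemma glued_continuous: "continuous_map (mtop M) (mtop N) glued"
  unfolding continuous_map_closedin
proof (intro conjI allI impI)
  show "glued \<in> points M \<rightarrow> points N"
    unfolding cover[symmetric]
    using glued_j1 glued_j2 smooth_map_points[OF \<phi>1s] smooth_map_points[OF \<phi>2s] by auto
  fix K assume K: "closedin (mtop N) K"
  have "{p \<in> points M. glued p \<in> K} = j1 ` {x \<in> points M1. \<phi>1 x \<in> K} \<union> j2 ` {x \<in> points M2. \<phi>2 x \<in> K}"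
    unfolding cover[symmetric] using glued_j1 glued_j2 by auto
  moreover have "closedin (mtop M1) {x \<in> points M1. \<phi>1 x \<in> K}" "closedin (mtop M2) {x \<in> points M2. \<phi>2 x \<in> K}"
    using \<phi>1s \<phi>2s K closedin_continuous_map_preimage unfolding smooth_map_def by blast+
  ultimately show "closedin (mtop M) {p \<in> points M. glued p \<in> K}"
    using smooth_embedding_closed_image[OF j1e segalD(2)[OF W1] smooth_manifold_Hausdorff[OF Ms]]
      smooth_embedding_closed_image[OF j2e segalD(2)[OF W2] smooth_manifold_Hausdorff[OF Ms]]
    by (simp add: closedin_Un)
qed

text \<open>In one chart around the seam point the two maps are pushed forward to \<open>F1\<close>
  and \<open>F2\<close>, each smooth on both sides. They agree on the seam together with their first
  derivatives, so the equation makes all their jets agree there, and \<open>Cinf_on_glue\<close>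
  applies to the two closed sides \<open>A1\<close> and \<open>A2\<close>.\<close>

lemma glued_smooth_seam:
  assumes s: "s \<in> points T" and c: "c \<in> charts_at M (j1 (i1 s))" and d: "d \<in> charts_at N (\<phi>1 (i1 s))"
  shows "\<exists>U h. open U \<and> snd c (j1 (i1 s)) \<in> U \<and> Cinf_on U h \<and>
     (\<forall>q\<in>fst c. glued q \<in> fst d \<longrightarrow> snd c q \<in> U \<longrightarrow> h (snd c q) = snd d (glued q))"
proof -
  let ?p = "j1 (i1 s)"
  note x = smooth_map_points[OF i1s s] and y = smooth_map_points[OF i2s s]
  have cx: "c \<in> atlas M" "?p \<in> fst c" and dx: "d \<in> atlas N" using c d by (auto simp: charts_at_def)
  have c2: "c \<in> charts_at M (j2 (i2 s))" using c seam_eq[OF s] by simp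
  have d2: "d \<in> charts_at N (\<phi>2 (i2 s))" using d seam_match[OF s] by simp
  let ?L = "low_tension N g d"
  obtain V1 F1 O1 where V1: "open V1" "snd c ?p \<in> V1" "Cinf_on V1 F1" "F1 ` V1 \<subseteq> chart_range d"
    and F1: "\<And>q. \<lbrakk>q \<in> points M1; j1 q \<in> fst c; snd c (j1 q) \<in> V1\<rbrakk> \<Longrightarrow>
       \<phi>1 q \<in> fst d \<and> F1 (snd c (j1 q)) = snd d (\<phi>1 q)"
    and dF1: "\<And>q e v. \<lbrakk>q \<in> points M1; j1 q \<in> fst c; snd c (j1 q) \<in> V1; e \<in> charts_at M1 q\<rbrakk> \<Longrightarrow>
       fderiv F1 (snd c (j1 q)) (local_deriv e c j1 q v) = local_deriv e d \<phi>1 q v"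
    and O1: "open O1" "O1 \<subseteq> V1"
    and cl1: "\<And>q. \<lbrakk>q \<in> points M1; j1 q \<in> fst c; snd c (j1 q) \<in> V1\<rbrakk> \<Longrightarrow> snd c (j1 q) \<in> closure O1"
    and L1: "\<And>y b. \<lbrakk>\<phi>1 \<in> harmonic_maps M1 N g; y \<in> O1; b \<in> Basis\<rbrakk> \<Longrightarrow> ?L F1 b y = 0"
  proof (rule pushforward_ext[OF M1 M N g j1 \<phi>1s x c d], goal_cases)
    case (1 V F O')
    show ?case by (rule that) (fact 1)+
  qed
  obtain V2 F2 O2 where V2: "open V2" "snd c (j2 (i2 s)) \<in> V2" "Cinf_on V2 F2" "F2 ` V2 \<subseteq> chart_range d"
    and F2: "\<And>q. \<lbrakk>q \<in> points M2; j2 q \<in> fst c; snd c (j2 q) \<in> V2\<rbrakk> \<Longrightarrow>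
       \<phi>2 q \<in> fst d \<and> F2 (snd c (j2 q)) = snd d (\<phi>2 q)"
    and dF2: "\<And>q e v. \<lbrakk>q \<in> points M2; j2 q \<in> fst c; snd c (j2 q) \<in> V2; e \<in> charts_at M2 q\<rbrakk> \<Longrightarrow>
       fderiv F2 (snd c (j2 q)) (local_deriv e c j2 q v) = local_deriv e d \<phi>2 q v"
    and O2: "open O2" "O2 \<subseteq> V2"
    and cl2: "\<And>q. \<lbrakk>q \<in> points M2; j2 q \<in> fst c; snd c (j2 q) \<in> V2\<rbrakk> \<Longrightarrow> snd c (j2 q) \<in> closure O2"
    and L2: "\<And>y b. \<lbrakk>\<phi>2 \<in> harmonic_maps M2 N g; y \<in> O2; b \<in> Basis\<rbrakk> \<Longrightarrow> ?L F2 b y = 0"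
  proof (rule pushforward_ext[OF M2 M N g j2 \<phi>2s y c2 d2], goal_cases)
    case (1 V F O')
    show ?case by (rule that) (fact 1)+
  qed
  obtain Q where Q: "open Q" "Q \<subseteq> snd c ` fst c" "\<And>x. x \<in> snd c ` fst c \<Longrightarrow> 0 < Im x \<Longrightarrow> x \<in> Q"
    by (rule chart_interior_open[OF Ms cx(1)]) blast
  \<comment> \<open>Intersecting with \<open>Q\<close> keeps \<open>V\<close> inside the chart
    image, so that every point of \<open>V\<close> belongs to one of the two pieces.\<close>
  define V where "V = V1 \<inter> V2 \<inter> Q"
  have V: "open V" "V \<subseteq> V1" "V \<subseteq> V2" "V \<subseteq> snd c ` fst c" unfolding V_def using V1(1) V2(1) Q(1,2) by auto
  have pV: "snd c ?p \<in> V"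
    unfolding V_def using V1(2) V2(2) Q(3)[OF _ seam_interior[OF s c]] cx(2) seam_eq[OF s] by simp
  define A1 where "A1 = V \<inter> snd c ` (fst c \<inter> C1)"
  define A2 where "A2 = V \<inter> snd c ` (fst c \<inter> C2)"
  have "V - A1 = V - snd c ` (fst c \<inter> C1)" "V - A2 = V - snd c ` (fst c \<inter> C2)"
    by (auto simp: A1_def A2_def)
  then have oA: "open (V - A1)" "open (V - A2)"
    using chart_range_diff_open[OF Ms cx(1) closed_pieces(1) V(1,4)]
      chart_range_diff_open[OF Ms cx(1) closed_pieces(2) V(1,4)] by auto
  have inj: "q = q'" if "q \<in> fst c" "q' \<in> fst c" "snd c q = snd c q'" for q q'
    using chart_inj_on[OF Ms cx(1)] that by (metis inj_onD)
  have AV: "A1 \<union> A2 = V"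
  proof -
    have "fst c \<subseteq> C1 \<union> C2" using chart_subset[OF Ms cx(1)] cover by blast
    then have "fst c = (fst c \<inter> C1) \<union> (fst c \<inter> C2)" by (simp add: Int_absorb2 flip: Int_Un_distrib)
    then have "snd c ` fst c = snd c ` (fst c \<inter> C1) \<union> snd c ` (fst c \<inter> C2)" using image_Un by metis
    then show ?thesis
      unfolding A1_def A2_def Int_Un_distrib[symmetric] using V(4) by (simp only: Int_absorb2)
  qed
  let ?Z = "A1 \<inter> A2"
  have Zpts: "\<exists>t\<in>points T. z = snd c (j1 (i1 t)) \<and> j1 (i1 t) \<in> fst c" if z: "z \<in> ?Z" for z
  proof -
    obtain q q' where q: "q \<in> fst c" "q \<in> C1" "z = snd c q" and q': "q' \<in> fst c" "q' \<in> C2" "z = snd c q'"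
      using z unfolding A1_def A2_def by blast
    then have "q = q'" using inj by blast
    then show ?thesis using overlap_points[OF q(2)] q'(2) q by blast
  qed
  have ZI: "snd c (j1 (i1 t)) \<in> ?Z" if t: "t \<in> points T" "j1 (i1 t) \<in> fst c" "snd c (j1 (i1 t)) \<in> V" for t
  proof -
    have "j1 (i1 t) \<in> fst c \<inter> C1" "j1 (i1 t) \<in> fst c \<inter> C2"
      using t(2) smooth_map_points[OF i1s t(1)] smooth_map_points[OF i2s t(1)] imageI[of "i2 t" _ j2]
      by (simp_all add: seam_eq[OF t(1)]) (simp flip: seam_eq[OF t(1)])
    then show ?thesis unfolding A1_def A2_def using t(3) by simp
  qed
  define F where "F = (\<lambda>z. snd d (glued (chart_inv c z)))"
  have FA1: "F z = F1 z" if "z \<in> A1" for z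
    using that V(2) F1 glued_j1 chart_inv_chart[OF Ms cx(1)] unfolding A1_def F_def by auto
  have FA2: "F z = F2 z" if "z \<in> A2" for z
    using that V(3) F2 glued_j2 chart_inv_chart[OF Ms cx(1)] unfolding A2_def F_def by auto
  have ZV: "?Z \<subseteq> V" by (auto simp: A1_def)
  have CF: "Cinf_on V F1" "Cinf_on V F2"
    by (rule Cinf_on_subset[OF V1(3) V(2)], rule Cinf_on_subset[OF V2(3) V(3)])
  have VB: "F1 ` V \<subseteq> chart_range d" "F2 ` V \<subseteq> chart_range d"
    using order_trans[OF image_mono[OF V(2)] V1(4)] order_trans[OF image_mono[OF V(3)] V2(4)] by auto
  have cl: "z \<in> closure (O' \<inter> V)" if "z \<in> V" "z \<in> closure O'" for z O'
    using open_Int_closure_subset[OF V(1), of O'] that by (metis IntI inf_commute subsetD)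
  \<comment> \<open>The tangent comes from the seam curve. Along \<open>- \<i> * \<tau>\<close> both
    derivatives are the value of the common Cauchy datum on the unit coordinate vector.\<close>
  have tan: "\<exists>\<tau>. tangent_direction TYPE('n) ?Z z \<tau> \<and>
      fderiv F1 z (- \<i> * \<tau>) = fderiv F2 z (- \<i> * \<tau>)" if z: "z \<in> ?Z" for z
  proof -
    obtain t where t: "t \<in> points T" "z = snd c (j1 (i1 t))" "j1 (i1 t) \<in> fst c" using Zpts[OF z] by blast
    obtain a where a: "a \<in> charts_at T t" using charts_at_nonempty[OF Ts t(1)] by blast
    have ct: "c \<in> charts_at M (j1 (i1 t))" "c \<in> charts_at M (j2 (i2 t))"
      using t seam_eq[OF t(1)] cx by (auto simp: charts_at_def)
    note x = smooth_map_points[OF i1s t(1)] and y = smooth_map_points[OF i2s t(1)]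
    have zV: "snd c (j1 (i1 t)) \<in> V" "snd c (j2 (i2 t)) \<in> V" using z ZV t seam_eq[OF t(1)] by auto
    have jt: "j2 (i2 t) \<in> fst c" using t seam_eq by simp
    let ?\<tau> = "local_deriv a c (\<lambda>s. j1 (i1 s)) t 1"
    have \<tau>2: "?\<tau> = local_deriv a c (\<lambda>s. j2 (i2 s)) t 1"
      by (rule fun_cong[OF local_deriv_cong[OF _ Ts a]])
        (use chart_subset[OF Ts conjunct1[OF charts_atD[OF a]]] seam_eq t(3) in auto)
    have dt: "d \<in> charts_at N (\<phi>1 (i1 t))" "d \<in> charts_at N (\<phi>2 (i2 t))"
      using F1[OF x t(3)] zV V(2) dx seam_match[OF t(1)] by (auto simp: charts_at_def)
    have "fderiv F1 z (- \<i> * ?\<tau>) = snd (cauchy_data T M1 N i1 \<phi>1) t (coord_vec T a t 1) d"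
      by (rule cauchy_normal_derivative[OF Ts M1 M N i1s j1h \<phi>1s a ct(1) dt(1)])
        (use dF1[OF x t(3)] zV V(2) t(2) in auto)
    moreover have "fderiv F2 z (- \<i> * ?\<tau>) = snd (cauchy_data T M2 N i2 \<phi>2) t (coord_vec T a t 1) d"
      unfolding \<tau>2
      by (rule cauchy_normal_derivative[OF Ts M2 M N i2s j2h \<phi>2s a ct(2) dt(2)])
        (use dF2[OF y jt] zV V(3) t seam_eq[OF t(1)] in auto)
    moreover have "tangent_direction TYPE('n) ?Z z ?\<tau>"
      unfolding t(2)
      by (rule curve_tangent_direction[OF Ts Ms seam_smooth a ct(1) seam_tangent_nonzero[OF a ct(1)] V(1) zV(1) ZI])
    ultimately show ?thesis using cd by auto
  qed
  have eq: "F1 z = F2 z" if "z \<in> ?Z" for z using FA1[of z] FA2[of z] that by simp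
  have dF: "F1 differentiable (at z)" "F2 differentiable (at z)" if "z \<in> V" for z
    using Cinf_on_differentiable[OF CF(1) V(1) that] Cinf_on_differentiable[OF CF(2) V(1) that] by auto
  have deq: "dd v F1 z = dd v F2 z" if z: "z \<in> ?Z" for z v
  proof -
    obtain \<tau> where \<tau>: "tangent_direction TYPE('n) ?Z z \<tau>"
      "fderiv F1 z (- \<i> * \<tau>) = fderiv F2 z (- \<i> * \<tau>)" using tan[OF z] by blast
    have zV: "z \<in> V" using z ZV by auto
    let ?D = "\<lambda>x. F1 x - F2 x"
    have D: "?D differentiable (at z)" using dF[OF zV] by (rule differentiable_diff)
    note e = dd_diff[OF dF[OF zV]]
    have "fderiv ?D z v = 0"
    proof (rule complex_linear_span[OF linear_frechet_derivative[OF D]])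
      show "\<tau> \<noteq> 0" "fderiv ?D z \<tau> = 0"
        using \<tau>(1) D eq unfolding tangent_direction_def by auto
      show "fderiv ?D z (- \<i> * \<tau>) = 0" unfolding e using \<tau>(2) by simp
    qed
    then show ?thesis unfolding e by simp
  qed
  have "flat_on k ?Z (\<lambda>x. F1 x - F2 x)" for k
  proof (rule lowered_tension_jets_agree[OF V(1) chart_range_open[OF N g dx] ZV CF VB
        metric_coord_Cinf[OF N g dx] christoffel_low_Cinf[OF N g dx] metric_nondegenerate[OF N g dx]])
    show "open (O1 \<inter> V)" "open (O2 \<inter> V)" using O1(1) O2(1) V(1) by auto
    show "?Z \<subseteq> closure (O1 \<inter> V)"
    proof
      fix z assume z: "z \<in> ?Z"
      obtain t where t: "t \<in> points T" "z = snd c (j1 (i1 t))" "j1 (i1 t) \<in> fst c" using Zpts[OF z] by blast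
      show "z \<in> closure (O1 \<inter> V)"
        using cl1[OF smooth_map_points[OF i1s t(1)] t(3)] z ZV V(2) t(2) by (intro cl) auto
    qed
    show "?Z \<subseteq> closure (O2 \<inter> V)"
    proof
      fix z assume z: "z \<in> ?Z"
      obtain t where t: "t \<in> points T" "z = snd c (j1 (i1 t))" "j1 (i1 t) \<in> fst c" using Zpts[OF z] by blast
      show "z \<in> closure (O2 \<inter> V)"
        using cl2[OF smooth_map_points[OF i2s t(1)]] z ZV V(3) t seam_eq[OF t(1)] by (intro cl) auto
    qed
    show "\<exists>\<tau>. tangent_direction TYPE('n) ?Z z \<tau>" if "z \<in> ?Z" for z using tan[OF that] by blast
  qed (use L1[OF h1] L2[OF h2] eq deq in auto)
  from Cinf_on_glue[OF V(1) AV oA CF FA1 FA2 this]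
  have "Cinf_on V F" by blast
  then show ?thesis
    using V(1) pV chart_inv_chart[OF Ms cx(1)] by (intro exI[of _ V] exI[of _ F]) (auto simp: F_def)
qed

lemma glued_smooth: "smooth_map M N glued"
proof (rule smooth_mapI[OF Ms glued_continuous])
  fix c d p assume c: "c \<in> atlas M" "p \<in> fst c" and d: "d \<in> atlas N" "glued p \<in> fst d"
  consider "p \<notin> C2" | "p \<notin> C1" | "p \<in> C1" "p \<in> C2" by blast
  then show "\<exists>U h. open U \<and> snd c p \<in> U \<and> Cinf_on U h \<and>
        (\<forall>q\<in>fst c. glued q \<in> fst d \<longrightarrow> snd c q \<in> U \<longrightarrow> h (snd c q) = snd d (glued q))"
  proof cases
    case 1
    show ?thesis
      by (rule smooth_off_closed[OF M1 M N g j1 \<phi>1s glued_j1 closed_pieces(2) _ c 1 d]) (use cover in auto)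
  next
    case 2
    show ?thesis
      by (rule smooth_off_closed[OF M2 M N g j2 \<phi>2s glued_j2 closed_pieces(1) _ c 2 d]) (use cover in auto)
  next
    case 3
    then obtain s where s: "s \<in> points T" "p = j1 (i1 s)" using overlap_points by blast
    have "glued p = \<phi>1 (i1 s)" using glued_j1[OF smooth_map_points[OF i1s s(1)]] s(2) by simp
    then show ?thesis
      unfolding s(2) using c d s(2) by (intro glued_smooth_seam[OF s(1)]) (auto simp: charts_at_def)
  qed
qed

text \<open>Once the glued map is smooth, the equation at a point, on the seam or not, is equivalent
  to the equation at a preimage in one of the pieces.\<close>

lemma glued_harmonic: "glued \<in> harmonic_maps M N g"
  unfolding harmonic_maps_iff
proof (intro conjI allI ballI glued_smooth)
  show "glued \<in> extensional (points M)" by (simp add: glued_def)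
  fix p c d assume c: "c \<in> charts_at M p" and d: "d \<in> charts_at N (glued p)"
  have "p \<in> C1 \<union> C2" using charts_at_points[OF Ms c] cover by blast
  then show "harmonic_at M N g glued c d p"
  proof
    assume "p \<in> C1"
    then obtain x where x: "x \<in> points M1" "p = j1 x" by blast
    obtain e where e: "e \<in> charts_at M1 x" using charts_at_nonempty[OF M1s x(1)] by blast
    have c': "c \<in> charts_at M (j1 x)" and d': "d \<in> charts_at N (\<phi>1 x)" using c d x glued_j1[OF x(1)] by auto
    have "harmonic_at M1 N g \<phi>1 e d x" using h1 e d' by (simp add: harmonic_maps_iff)
    then show ?thesis
      using harmonic_at_pullback[OF M1 M N g j1h glued_smooth \<phi>1s glued_j1[symmetric] e c' d'
          smooth_embedding_inj_deriv[OF j1e x(1) e c']] x(2) by blast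
  next
    assume "p \<in> C2"
    then obtain x where x: "x \<in> points M2" "p = j2 x" by blast
    obtain e where e: "e \<in> charts_at M2 x" using charts_at_nonempty[OF M2s x(1)] by blast
    have c': "c \<in> charts_at M (j2 x)" and d': "d \<in> charts_at N (\<phi>2 x)" using c d x glued_j2[OF x(1)] by auto
    have "harmonic_at M2 N g \<phi>2 e d x" using h2 e d' by (simp add: harmonic_maps_iff)
    then show ?thesis
      using harmonic_at_pullback[OF M2 M N g j2h glued_smooth \<phi>2s glued_j2[symmetric] e c' d'
          smooth_embedding_inj_deriv[OF j2e x(1) e c']] x(2) by blast
  qed
qed

lemma glued_relation:
  "(cauchy_data (source W1) M1 N (in_map W1) \<phi>1, cauchy_data (target W2) M2 N (out_map W2) \<phi>2) \<in> harm_relation N g W"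
proof -
  have "cauchy_data (source W) M N (in_map W) glued = cauchy_data (source W1) M1 N (in_map W1) \<phi>1"
    "cauchy_data (target W) M N (out_map W) glued = cauchy_data (target W2) M2 N (out_map W2) \<phi>2"
    by (rule cauchy_pieces[OF glued_smooth \<phi>1s \<phi>2s]; simp add: glued_j1 glued_j2)+
  then show ?thesis unfolding harm_relation_def using glued_harmonic by force
qed

end

text \<open>The middle element of the composition is the Cauchy datum of \<phi> along the seam,
  which is the same seen from either piece.\<close>

lemma harm_relation_cut:
  assumes \<phi>: "\<phi> \<in> harmonic_maps M N g"
  shows "(cauchy_data (source W) M N (in_map W) \<phi>, cauchy_data (target W) M N (out_map W) \<phi>) \<in>
    compose_relations (cauchy_space (source W1) N) (cauchy_space (target W1) N) (cauchy_space (target W2) N)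
      (harm_relation N g W2) (harm_relation N g W1)"
proof -
  define \<phi>1 where "\<phi>1 = restrict (\<lambda>x. \<phi> (j1 x)) (points M1)"
  define \<phi>2 where "\<phi>2 = restrict (\<lambda>x. \<phi> (j2 x)) (points M2)"
  have h: "\<phi>1 \<in> harmonic_maps M1 N g" "\<phi>2 \<in> harmonic_maps M2 N g"
    unfolding \<phi>1_def \<phi>2_def using harmonic_restrict[OF M1 M N g j1 \<phi>] harmonic_restrict[OF M2 M N g j2 \<phi>] by auto
  have s: "smooth_map M N \<phi>" "smooth_map M1 N \<phi>1" "smooth_map M2 N \<phi>2"
    using h \<phi> by (auto simp: harmonic_maps_iff)
  have e: "\<And>x. x \<in> points M1 \<Longrightarrow> \<phi>1 x = \<phi> (j1 x)" "\<And>x. x \<in> points M2 \<Longrightarrow> \<phi>2 x = \<phi> (j2 x)"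
    by (simp_all add: \<phi>1_def \<phi>2_def)
  have c: "cauchy_data (source W) M N (in_map W) \<phi> = cauchy_data (source W1) M1 N (in_map W1) \<phi>1"
    "cauchy_data (target W) M N (out_map W) \<phi> = cauchy_data (target W2) M2 N (out_map W2) \<phi>2"
    "cauchy_data T M1 N i1 \<phi>1 = cauchy_data T M2 N i2 \<phi>2"
    by (rule cauchy_pieces[OF s]; simp add: e)+
  have 1: "cauchy_data (source W1) M1 N (in_map W1) \<phi>1 \<in> cauchy_space (source W1) N"
    by (rule cauchy_data_in_space[OF segalD(3)[OF W1] M1 N segalD(9)[OF W1] s(2)])
  have 2: "cauchy_data (target W2) M2 N (out_map W2) \<phi>2 \<in> cauchy_space (target W2) N"
    by (rule cauchy_data_in_space[OF segalD(4)[OF W2] M2 N segalD(10)[OF W2] s(3)])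
  have 3: "cauchy_data T M1 N i1 \<phi>1 \<in> cauchy_space T N"
    by (rule cauchy_data_in_space[OF Ts M1 N i1s s(2)])
  have "(cauchy_data (source W1) M1 N (in_map W1) \<phi>1, cauchy_data T M1 N i1 \<phi>1) \<in> harm_relation N g W1"
    unfolding harm_relation_def using h(1) by blast
  moreover have "(cauchy_data T M1 N i1 \<phi>1, cauchy_data (target W2) M2 N (out_map W2) \<phi>2) \<in> harm_relation N g W2"
    unfolding harm_relation_def using h(2) c(3) seam by force
  ultimately show ?thesis
    unfolding compose_relations_def c(1,2) using 1 2 3 by blast
qed

end

theorem lemma1:
  fixes N :: "('q, 'n::euclidean_space) manifold"
    and g :: "('q, 'n) metric"
    and W1 :: "('s, 'a, 't) cobordism"
    and W2 :: "('t, 'b, 'r) cobordism"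
    and W :: "('s, 'c, 'r) cobordism"
  assumes "smooth_manifold UNIV N"
    and "riemannian_metric N g"
    and "segal_morphism W1"
    and "segal_morphism W2"
    and "target W1 = source W2"
    and "segal_composite W2 W1 W"
  shows "compose_relations
           (cauchy_space (source W1) N) (cauchy_space (target W1) N) (cauchy_space (target W2) N)
           (harm_relation N g W2) (harm_relation N g W1)
         = harm_relation N g W"
proof -
  obtain j1 j2 where "gluing N g W1 W2 W j1 j2"
    using assms unfolding segal_composite_def gluing_def by metis
  then interpret gluing N g W1 W2 W j1 j2 .
  show ?thesis
  proof (intro equalityI subsetI)
    fix r assume "r \<in> compose_relations (cauchy_space (source W1) N) (cauchy_space (target W1) N)
      (cauchy_space (target W2) N) (harm_relation N g W2) (harm_relation N g W1)"
    then obtain \<phi>1 \<phi>2 where h: "\<phi>1 \<in> harmonic_maps M1 N g" "\<phi>2 \<in> harmonic_maps M2 N g"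
      and c: "cauchy_data T M1 N i1 \<phi>1 = cauchy_data (source W2) M2 N i2 \<phi>2"
      and r: "r = (cauchy_data (source W1) M1 N (in_map W1) \<phi>1, cauchy_data (target W2) M2 N (out_map W2) \<phi>2)"
      unfolding compose_relations_def harm_relation_def by auto
    show "r \<in> harm_relation N g W"
      unfolding r by (rule glued_relation[OF h c[folded seam]])
  next
    fix r assume "r \<in> harm_relation N g W"
    then obtain \<phi> where "\<phi> \<in> harmonic_maps M N g"
      "r = (cauchy_data (source W) M N (in_map W) \<phi>, cauchy_data (target W) M N (out_map W) \<phi>)"
      unfolding harm_relation_def by blast
    then show "r \<in> compose_relations (cauchy_space (source W1) N) (cauchy_space (target W1) N)
      (cauchy_space (target W2) N) (harm_relation N g W2) (harm_relation N g W1)"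
      using harm_relation_cut by simp
  qed
qed

end
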